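(* Let $K$ be a field complete with respect to a (possibly trivial) non-Archimedean valuation, let $M\cong\mathbb{Z}^d$ be a lattice with dual $N$, and let $\mathcal{A}=\mathcal{A}(a,r)$ be an affine hyperplane arrangement in $M_{\mathbb{R}}$ defined by a primitive spanning configuration $a\in N^E$ ($E$ a finite set) and $r\in\mathbb{Z}^E$. Let $\mathfrak{M}_{\mathcal{A}}$ be the associated hypertoric variety and $\mathrm{Trop}(\mathfrak{M}_{\mathcal{A}})$ its tropicalization with respect to its embedding in the Lawrence toric variety $\mathfrak{B}_{\mathcal{A}}$. Then there is a unique continuous section $s:\mathrm{Trop}(\mathfrak{M}_{\mathcal{A}})\to\mathfrak{M}_{\mathcal{A}}^{\mathrm{an}}$ of the tropicalization map $\mathrm{trop}:\mathfrak{M}_{\mathcal{A}}^{\mathrm{an}}\to\mathrm{Trop}(\mathfrak{M}_{\mathcal{A}})$.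
   Context: **Arrangements.** $M\cong\mathbb{Z}^d$, $N=\mathrm{Hom}(M,\mathbb{Z})$, $M_{\mathbb{R}}=M\otimes\mathbb{R}$. A tuple $a=(a_e)_{e\in E}\in N^E$ of nonzero vectors is a primitive spanning configuration if each $a_e$ is primitive and the $a_e$ generate $N$. The arrangement $\mathcal{A}=\mathcal{A}(a,r)$ is the multiset of hyperplanes $H_e=\{m\in M_{\mathbb{R}}: \langle m,a_e\rangle+r_e=0\}$, $e\in E$, with closed halfspaces $H_e^+=\{\langle m,a_e\rangle+r_e\le 0\}$ and $H_e^-=\{\langle m,a_e\rangle+r_e\ge 0\}$. A vertex of $\mathcal{A}$ is a point $\xi\in M_{\mathbb{R}}$ such that $\{\xi\}$ is a fiber of the map sending $m\in M_{\mathbb R}$ to its sign vector in $\{+,0,-\}^E$ (entry $+$ if $m\in H_e^+\setminus H_e$, $0$ if $m\in H_e$, $-$ if $m\in H_e^-\setminus H_e$); put $E^{\pm}(\xi)=\{e\in E:\xi\in H_e^{\pm}\}$. **Lawrence toric variety.** Let $\Lambda=\ker(\mathbb{Z}^E\to N,\ \delta_e\mapsto a_e)$, embedded in $\mathbb{Z}^E\oplus\mathbb{Z}^E$ (with bases $\delta_e^+$, $\delta_e^-$) via $\delta_e\mapsto\delta_e^+-\delta_e^-$. Let $\widetilde N=(\mathbb{Z}^E\oplus\mathbb{Z}^E)/\Lambda$ (free of rank $|E|+d$), $\rho_e^{\pm}$ the image of $\delta_e^{\pm}$, and $\widetilde M$ the dual lattice. The Lawrence toric variety $\mathfrak{B}_{\mathcal{A}}$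 is the toric $K$-variety with dense torus $\widetilde T=\mathrm{Spec}\,K[\widetilde M]$ and fan $\Delta_{\mathcal{A}}$ in $\widetilde N_{\mathbb{R}}$ whose maximal cones are the cones generated by $\{\rho_e^+: e\in E^+(\xi)\}\cup\{\rho_f^-: f\in E^-(\xi)\}$ for $\xi$ a vertex of $\mathcal{A}$. **Hypertoric variety.** The map $\widetilde N\to\mathbb{Z}^E$, $\rho_e^{\pm}\mapsto\delta_e$, induces a surjective toric morphism $\Phi:\mathfrak{B}_{\mathcal{A}}\to\mathbb{A}^E$. Let $L_{\mathcal{A}_0}\subseteq\mathbb{A}^E=\mathrm{Spec}\,K[x_e: e\in E]$ be the linear subspace cut out by the forms $\sum_e c_e x_e$ for all relations $\sum_e c_e a_e=0$ in $N$. The hypertoric variety is $\mathfrak{M}_{\mathcal{A}}=\Phi^{-1}(L_{\mathcal{A}_0})$; it is irreducible of dimension $2d$. **Tropicalization.** $X^{\mathrm{an}}$ denotes the Berkovich analytification of a $K$-variety $X$; for $X=\mathrm{Spec}\,A$ its points are the ring valuations $A\to\mathbb{T}=\mathbb{R}\cup\{\infty\}$ extending the valuation on $K$, with the coarsest topology making all evaluations $\nu\mapsto\nu(a)$ continuous. The space $\overline{\widetilde N}{}_{\mathbb{R}}^{\Delta_{\mathcal{A}}}$ is obtained by gluing the spaces of monoid homomorphisms $\mathrm{Hom}(\sigma^\vee\cap\widetilde M,\mathbb{T})$, $\sigma\in\Delta_{\mathcal{A}}$ (topology of pointwise convergence), where for a face $\tau$ of $\sigma$ the space for $\tau$ is an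 open subset of the space for $\sigma$. The tropicalization map $\mathrm{trop}:\mathfrak{B}_{\mathcal{A}}^{\mathrm{an}}\to\overline{\widetilde N}{}_{\mathbb{R}}^{\Delta_{\mathcal{A}}}$ sends a valuation on $K[\sigma^\vee\cap\widetilde M]$ to its restriction to $\sigma^\vee\cap\widetilde M$, and $\mathrm{Trop}(\mathfrak{M}_{\mathcal{A}})=\mathrm{trop}(\mathfrak{M}_{\mathcal{A}}^{\mathrm{an}})$. A section of $\mathrm{trop}$ is a map $s$ with $\mathrm{trop}\circ s=\mathrm{id}$. *)

theory Defs
  imports
    "HOL-Analysis.Analysis"
    "HOL-Algebra.Free_Abelian_Groups"
    "HOL-Algebra.Ideal"
    "HOL-Library.Poly_Mapping"
    "HOL-Library.Function_Algebras"
begin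

section \<open>Valued fields\<close>

text \<open>
  The tropical semifield consists of the elements of \<^typ>\<open>ereal\<close> other than \<open>-\<infinity>\<close>.
\<close>

definition nonarch_valuation :: "('k::field \<Rightarrow> ereal) \<Rightarrow> bool" where
  "nonarch_valuation v \<longleftrightarrow>
     (\<forall>x. v x \<noteq> -\<infinity>) \<and> (\<forall>x. v x = \<infinity> \<longleftrightarrow> x = 0) \<and>
     (\<forall>x y. v (x * y) = v x + v y) \<and> (\<forall>x y. min (v x) (v y) \<le> v (x + y))"

definition valuation_complete :: "('k::field \<Rightarrow> ereal) \<Rightarrow> bool" where
  "valuation_complete v \<longleftrightarrow>
     (\<forall>X :: nat \<Rightarrow> 'k.
        (\<forall>C::real. \<exists>k. \<forall>m\<ge>k. \<forall>n\<ge>k. ereal C < v (X m - X n)) \<longrightarrow>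
        (\<exists>x. (\<lambda>n. v (X n - x)) \<longlonglongrightarrow> \<infinity>))"


section \<open>Lattices, cones and fans\<close>

text \<open>
  Elements of \<open>Hom(G, \<int>)\<close> are extended by 0 (rather than by \<^const>\<open>undefined\<close>) outside the
  carrier, so that the group operation is pointwise addition of functions and monomials with
  exponents in \<open>Hom(G, \<int>)\<close> multiply correctly in the polynomial mapping type.
\<close>

definition dual_lattice :: "('a, 'b) monoid_scheme \<Rightarrow> ('a \<Rightarrow> int) monoid" where
  "dual_lattice G =
     \<lparr>carrier = {f \<in> hom G integer_group. \<forall>x. x \<notin> carrier G \<longrightarrow> f x = 0},
      monoid.mult = (+), one = 0\<rparr>"

text \<open>
  For a lattice \<open>G\<close> (free abelian of finite rank), \<open>G \<otimes> \<real>\<close> is \<open>Hom(Hom(G, \<int>), \<real>)\<close>; the pairing of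
  \<open>x \<in> G \<otimes> \<real>\<close> with \<open>u \<in> Hom(G, \<int>)\<close> is the application \<open>x u\<close>.
\<close>

definition real_lattice :: "('a, 'b) monoid_scheme \<Rightarrow> (('a \<Rightarrow> int) \<Rightarrow> real) set" where
  "real_lattice G =
     {x. (\<forall>u\<in>carrier (dual_lattice G). \<forall>w\<in>carrier (dual_lattice G). x (u + w) = x u + x w) \<and>
         (\<forall>u. u \<notin> carrier (dual_lattice G) \<longrightarrow> x u = 0)}"

definition lattice_point :: "('a, 'b) monoid_scheme \<Rightarrow> 'a \<Rightarrow> ('a \<Rightarrow> int) \<Rightarrow> real" where
  "lattice_point G n = (\<lambda>u. if u \<in> carrier (dual_lattice G) then real_of_int (u n) else 0)"

definition cone_over :: "('a, 'b) monoid_scheme \<Rightarrow> 'a set \<Rightarrow> (('a \<Rightarrow> int) \<Rightarrow> real) set" where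
  "cone_over G R = {(\<lambda>u. \<Sum>n\<in>R. c n * lattice_point G n u) | c :: 'a \<Rightarrow> real. \<forall>n\<in>R. 0 \<le> c n}"

text \<open>The monoid \<open>\<sigma>\<^sup>\<or> \<inter> Hom(G, \<int>)\<close>.\<close>

definition dual_monoid ::
    "('a, 'b) monoid_scheme \<Rightarrow> (('a \<Rightarrow> int) \<Rightarrow> real) set \<Rightarrow> ('a \<Rightarrow> int) set" where
  "dual_monoid G \<sigma> = {u \<in> carrier (dual_lattice G). \<forall>x\<in>\<sigma>. 0 \<le> x u}"

text \<open>
  All cones considered are rational, so every face is cut out by a lattice point of the dual cone.
\<close>

definition cone_face ::
    "('a, 'b) monoid_scheme \<Rightarrow> (('a \<Rightarrow> int) \<Rightarrow> real) set \<Rightarrow> (('a \<Rightarrow> int) \<Rightarrow> real) set \<Rightarrow> bool" where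
  "cone_face G \<tau> \<sigma> \<longleftrightarrow> (\<exists>u\<in>dual_monoid G \<sigma>. \<tau> = {x \<in> \<sigma>. x u = 0})"

definition fan_of_cones ::
    "('a, 'b) monoid_scheme \<Rightarrow> (('a \<Rightarrow> int) \<Rightarrow> real) set set \<Rightarrow> (('a \<Rightarrow> int) \<Rightarrow> real) set set" where
  "fan_of_cones G \<C> = {\<tau>. \<exists>\<sigma>\<in>\<C>. cone_face G \<tau> \<sigma>}"


section \<open>Gluing\<close>

text \<open>
  The charts \<open>X i\<close> are spaces of functions on \<open>D i\<close>.  For \<open>below i j\<close> one has \<open>D j \<subseteq> D i\<close>, and \<open>X i\<close> is
  glued into \<open>X j\<close> along the restriction of functions to \<open>D j\<close>.  The glued space is the quotient of
  the disjoint union by the equivalence relation which these identifications generate.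
\<close>

definition glue_rel ::
    "'i set \<Rightarrow> ('i \<Rightarrow> 'i \<Rightarrow> bool) \<Rightarrow> ('i \<Rightarrow> 'f set) \<Rightarrow> ('i \<Rightarrow> ('f \<Rightarrow> 'v) topology)
      \<Rightarrow> (('i \<times> ('f \<Rightarrow> 'v)) \<times> ('i \<times> ('f \<Rightarrow> 'v))) set" where
  "glue_rel I below D X =
     (let R = {((i, x), (j, restrict x (D j))) | i j x. i \<in> I \<and> j \<in> I \<and> below i j \<and> x \<in> topspace (X i)}
      in (R \<union> R\<inverse>)\<^sup>*)"

definition quotient_space :: "'a topology \<Rightarrow> ('a \<times> 'a) set \<Rightarrow> 'a set topology" where
  "quotient_space X r =
     topology (\<lambda>U. U \<subseteq> topspace X // r \<and> openin X {x \<in> topspace X. r `` {x} \<in> U})"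

lemma istopology_quotient_space:
  "istopology (\<lambda>U. U \<subseteq> topspace X // r \<and> openin X {x \<in> topspace X. r `` {x} \<in> U})"
  unfolding istopology_def
proof (intro conjI allI impI)
  fix S T
  assume S: "S \<subseteq> topspace X // r \<and> openin X {x \<in> topspace X. r `` {x} \<in> S}"
    and T: "T \<subseteq> topspace X // r \<and> openin X {x \<in> topspace X. r `` {x} \<in> T}"
  have "{x \<in> topspace X. r `` {x} \<in> S \<inter> T} =
      {x \<in> topspace X. r `` {x} \<in> S} \<inter> {x \<in> topspace X. r `` {x} \<in> T}"
    by auto
  with S T show "openin X {x \<in> topspace X. r `` {x} \<in> S \<inter> T}"
    by auto
  from S show "S \<inter> T \<subseteq> topspace X // r"
    by auto
next
  fix \<K>
  assume \<K>: "\<forall>U\<in>\<K>. U \<subseteq> topspace X // r \<and> openin X {x \<in> topspace X. r `` {x} \<in> U}"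
  have "{x \<in> topspace X. r `` {x} \<in> \<Union>\<K>} = \<Union>((\<lambda>U. {x \<in> topspace X. r `` {x} \<in> U}) ` \<K>)"
    by auto
  moreover have "openin X \<dots>"
    using \<K> by (intro openin_Union) auto
  ultimately show "openin X {x \<in> topspace X. r `` {x} \<in> \<Union>\<K>}"
    by simp
  show "\<Union>\<K> \<subseteq> topspace X // r"
    using \<K> by blast
qed

lemma openin_quotient_space:
  "openin (quotient_space X r) U \<longleftrightarrow>
     U \<subseteq> topspace X // r \<and> openin X {x \<in> topspace X. r `` {x} \<in> U}"
  by (simp add: quotient_space_def istopology_quotient_space topology_inverse')

definition glued_space ::
    "'i set \<Rightarrow> ('i \<Rightarrow> 'i \<Rightarrow> bool) \<Rightarrow> ('i \<Rightarrow> 'f set) \<Rightarrow> ('i \<Rightarrow> ('f \<Rightarrow> 'v) topology)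
      \<Rightarrow> ('i \<times> ('f \<Rightarrow> 'v)) set topology" where
  "glued_space I below D X = quotient_space (sum_topology X I) (glue_rel I below D X)"


section \<open>Analytified and tropical toric varieties\<close>

definition monoid_algebra :: "'u::comm_monoid_add set \<Rightarrow> ('u \<Rightarrow>\<^sub>0 'k::field) ring" where
  "monoid_algebra S =
     \<lparr>carrier = {f. Poly_Mapping.keys f \<subseteq> S}, monoid.mult = (*), one = 1, ring.zero = 0, add = (+)\<rparr>"

definition berkovich_points ::
    "('k::field \<Rightarrow> ereal) \<Rightarrow> 'u::comm_monoid_add set \<Rightarrow> (('u \<Rightarrow>\<^sub>0 'k) \<Rightarrow> ereal) set" where
  "berkovich_points v S =
     {\<nu> \<in> extensional (carrier (monoid_algebra S)).
        (\<forall>c. \<nu> (Poly_Mapping.single 0 c) = v c) \<and>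
        (\<forall>f\<in>carrier (monoid_algebra S). \<nu> f \<noteq> -\<infinity>) \<and>
        (\<forall>f\<in>carrier (monoid_algebra S). \<forall>g\<in>carrier (monoid_algebra S).
           \<nu> (f * g) = \<nu> f + \<nu> g \<and> min (\<nu> f) (\<nu> g) \<le> \<nu> (f + g))}"

definition berkovich_chart ::
    "('k::field \<Rightarrow> ereal) \<Rightarrow> 'u::comm_monoid_add set \<Rightarrow> (('u \<Rightarrow>\<^sub>0 'k) \<Rightarrow> ereal) topology" where
  "berkovich_chart v S =
     subtopology (product_topology (\<lambda>_. euclidean) (carrier (monoid_algebra S)))
       (berkovich_points v S)"

definition tropical_points :: "'u::comm_monoid_add set \<Rightarrow> ('u \<Rightarrow> ereal) set" where
  "tropical_points S =
     {w \<in> extensional S. (\<forall>u\<in>S. w u \<noteq> -\<infinity>) \<and> w 0 = 0 \<and> (\<forall>u\<in>S. \<forall>u'\<in>S. w (u + u') = w u + w u')}"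

definition tropical_chart :: "'u::comm_monoid_add set \<Rightarrow> ('u \<Rightarrow> ereal) topology" where
  "tropical_chart S = subtopology (product_topology (\<lambda>_. euclidean) S) (tropical_points S)"

definition toric_an ::
    "('k::field \<Rightarrow> ereal) \<Rightarrow> ('a, 'b) monoid_scheme \<Rightarrow> (('a \<Rightarrow> int) \<Rightarrow> real) set set
      \<Rightarrow> ((('a \<Rightarrow> int) \<Rightarrow> real) set \<times> ((('a \<Rightarrow> int) \<Rightarrow>\<^sub>0 'k) \<Rightarrow> ereal)) set topology" where
  "toric_an v G \<Delta> =
     glued_space \<Delta> (cone_face G)
       (\<lambda>\<sigma>. carrier (monoid_algebra (dual_monoid G \<sigma>)))
       (\<lambda>\<sigma>. berkovich_chart v (dual_monoid G \<sigma>))"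

definition toric_trop_rel ::
    "('a, 'b) monoid_scheme \<Rightarrow> (('a \<Rightarrow> int) \<Rightarrow> real) set set
      \<Rightarrow> (((('a \<Rightarrow> int) \<Rightarrow> real) set \<times> (('a \<Rightarrow> int) \<Rightarrow> ereal)) \<times>
          ((('a \<Rightarrow> int) \<Rightarrow> real) set \<times> (('a \<Rightarrow> int) \<Rightarrow> ereal))) set" where
  "toric_trop_rel G \<Delta> =
     glue_rel \<Delta> (cone_face G) (dual_monoid G) (\<lambda>\<sigma>. tropical_chart (dual_monoid G \<sigma>))"

definition toric_trop_space ::
    "('a, 'b) monoid_scheme \<Rightarrow> (('a \<Rightarrow> int) \<Rightarrow> real) set set
      \<Rightarrow> ((('a \<Rightarrow> int) \<Rightarrow> real) set \<times> (('a \<Rightarrow> int) \<Rightarrow> ereal)) set topology" where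
  "toric_trop_space G \<Delta> =
     glued_space \<Delta> (cone_face G) (dual_monoid G) (\<lambda>\<sigma>. tropical_chart (dual_monoid G \<sigma>))"

text \<open>
  A point of the glued space is an equivalence class of pairs \<open>(\<sigma>, \<nu>)\<close>; its tropicalization is the
  class of the restriction of \<open>\<nu>\<close> to the monomials.
\<close>

definition toric_trop ::
    "('a, 'b) monoid_scheme \<Rightarrow> (('a \<Rightarrow> int) \<Rightarrow> real) set set
      \<Rightarrow> ((('a \<Rightarrow> int) \<Rightarrow> real) set \<times> ((('a \<Rightarrow> int) \<Rightarrow>\<^sub>0 'k::field) \<Rightarrow> ereal)) set
      \<Rightarrow> ((('a \<Rightarrow> int) \<Rightarrow> real) set \<times> (('a \<Rightarrow> int) \<Rightarrow> ereal)) set" where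
  "toric_trop G \<Delta> P =
     toric_trop_rel G \<Delta> ``
       ((\<lambda>(\<sigma>, \<nu>). (\<sigma>, \<lambda>u\<in>dual_monoid G \<sigma>. \<nu> (Poly_Mapping.single u 1))) ` P)"


section \<open>Arrangements\<close>

definition primitive_in :: "('a, 'b) monoid_scheme \<Rightarrow> 'a \<Rightarrow> bool" where
  "primitive_in G x \<longleftrightarrow>
     x \<in> carrier G \<and> x \<noteq> \<one>\<^bsub>G\<^esub> \<and> (\<forall>y\<in>carrier G. \<forall>k::int. x = y [^]\<^bsub>G\<^esub> k \<longrightarrow> \<bar>k\<bar> = 1)"

definition primitive_spanning ::
    "('m, 'b) monoid_scheme \<Rightarrow> 'e set \<Rightarrow> ('e \<Rightarrow> 'm \<Rightarrow> int) \<Rightarrow> bool" where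
  "primitive_spanning M E a \<longleftrightarrow>
     (\<forall>e\<in>E. primitive_in (dual_lattice M) (a e)) \<and>
     generate (dual_lattice M) (a ` E) = carrier (dual_lattice M)"

definition hyperplane_at ::
    "('m, 'b) monoid_scheme \<Rightarrow> ('e \<Rightarrow> 'm \<Rightarrow> int) \<Rightarrow> ('e \<Rightarrow> int) \<Rightarrow> 'e \<Rightarrow> (('m \<Rightarrow> int) \<Rightarrow> real) set" where
  "hyperplane_at M a r e = {m \<in> real_lattice M. m (a e) + real_of_int (r e) = 0}"

definition halfspace_plus ::
    "('m, 'b) monoid_scheme \<Rightarrow> ('e \<Rightarrow> 'm \<Rightarrow> int) \<Rightarrow> ('e \<Rightarrow> int) \<Rightarrow> 'e \<Rightarrow> (('m \<Rightarrow> int) \<Rightarrow> real) set" where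
  "halfspace_plus M a r e = {m \<in> real_lattice M. m (a e) + real_of_int (r e) \<le> 0}"

definition halfspace_minus ::
    "('m, 'b) monoid_scheme \<Rightarrow> ('e \<Rightarrow> 'm \<Rightarrow> int) \<Rightarrow> ('e \<Rightarrow> int) \<Rightarrow> 'e \<Rightarrow> (('m \<Rightarrow> int) \<Rightarrow> real) set" where
  "halfspace_minus M a r e = {m \<in> real_lattice M. m (a e) + real_of_int (r e) \<ge> 0}"

datatype sign = Plus | Zero | Minus

definition sign_vector ::
    "('m, 'b) monoid_scheme \<Rightarrow> 'e set \<Rightarrow> ('e \<Rightarrow> 'm \<Rightarrow> int) \<Rightarrow> ('e \<Rightarrow> int)
      \<Rightarrow> (('m \<Rightarrow> int) \<Rightarrow> real) \<Rightarrow> 'e \<Rightarrow> sign" where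
  "sign_vector M E a r m =
     (\<lambda>e\<in>E. if m \<in> hyperplane_at M a r e then Zero
            else if m \<in> halfspace_plus M a r e then Plus else Minus)"

definition arr_vertices ::
    "('m, 'b) monoid_scheme \<Rightarrow> 'e set \<Rightarrow> ('e \<Rightarrow> 'm \<Rightarrow> int) \<Rightarrow> ('e \<Rightarrow> int)
      \<Rightarrow> (('m \<Rightarrow> int) \<Rightarrow> real) set" where
  "arr_vertices M E a r =
     {\<xi> \<in> real_lattice M.
        {m \<in> real_lattice M. sign_vector M E a r m = sign_vector M E a r \<xi>} = {\<xi>}}"


section \<open>Lawrence toric varieties and hypertoric varieties\<close>

definition relation_lattice ::
    "('m, 'b) monoid_scheme \<Rightarrow> 'e set \<Rightarrow> ('e \<Rightarrow> 'm \<Rightarrow> int) \<Rightarrow> ('e \<Rightarrow>\<^sub>0 int) set" where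
  "relation_lattice M E a =
     kernel (free_Abelian_group E) (dual_lattice M)
       (\<lambda>c m. \<Sum>e\<in>E. Poly_Mapping.lookup c e * a e m)"

text \<open>
  In \<open>\<int>\<^sup>E \<oplus> \<int>\<^sup>E\<close>, the free abelian group on \<open>E <+> E\<close>, the basis vectors \<open>\<delta>\<^sub>e\<^sup>+\<close> and \<open>\<delta>\<^sub>e\<^sup>-\<close> are
  \<^term>\<open>frag_of (Inl e)\<close> and \<^term>\<open>frag_of (Inr e)\<close>.
\<close>

definition lawrence_relations ::
    "('m, 'b) monoid_scheme \<Rightarrow> 'e set \<Rightarrow> ('e \<Rightarrow> 'm \<Rightarrow> int) \<Rightarrow> ('e + 'e \<Rightarrow>\<^sub>0 int) set" where
  "lawrence_relations M E a =
     frag_extend (\<lambda>e. frag_of (Inl e) - frag_of (Inr e)) ` relation_lattice M E a"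

definition lawrence_lattice ::
    "('m, 'b) monoid_scheme \<Rightarrow> 'e set \<Rightarrow> ('e \<Rightarrow> 'm \<Rightarrow> int) \<Rightarrow> ('e + 'e \<Rightarrow>\<^sub>0 int) set monoid" where
  "lawrence_lattice M E a = free_Abelian_group (E <+> E) Mod lawrence_relations M E a"

definition lawrence_ray ::
    "('m, 'b) monoid_scheme \<Rightarrow> 'e set \<Rightarrow> ('e \<Rightarrow> 'm \<Rightarrow> int) \<Rightarrow> 'e + 'e \<Rightarrow> ('e + 'e \<Rightarrow>\<^sub>0 int) set" where
  "lawrence_ray M E a i =
     lawrence_relations M E a #>\<^bsub>free_Abelian_group (E <+> E)\<^esub> frag_of i"

definition lawrence_cone ::
    "('m, 'b) monoid_scheme \<Rightarrow> 'e set \<Rightarrow> ('e \<Rightarrow> 'm \<Rightarrow> int) \<Rightarrow> ('e \<Rightarrow> int)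
      \<Rightarrow> (('m \<Rightarrow> int) \<Rightarrow> real) \<Rightarrow> ((('e + 'e \<Rightarrow>\<^sub>0 int) set \<Rightarrow> int) \<Rightarrow> real) set" where
  "lawrence_cone M E a r \<xi> =
     cone_over (lawrence_lattice M E a)
       (lawrence_ray M E a `
          ({e \<in> E. \<xi> \<in> halfspace_plus M a r e} <+> {f \<in> E. \<xi> \<in> halfspace_minus M a r f}))"

definition lawrence_fan ::
    "('m, 'b) monoid_scheme \<Rightarrow> 'e set \<Rightarrow> ('e \<Rightarrow> 'm \<Rightarrow> int) \<Rightarrow> ('e \<Rightarrow> int)
      \<Rightarrow> ((('e + 'e \<Rightarrow>\<^sub>0 int) set \<Rightarrow> int) \<Rightarrow> real) set set" where
  "lawrence_fan M E a r =
     fan_of_cones (lawrence_lattice M E a) (lawrence_cone M E a r ` arr_vertices M E a r)"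

definition lawrence_an ::
    "('k::field \<Rightarrow> ereal) \<Rightarrow> ('m, 'b) monoid_scheme \<Rightarrow> 'e set \<Rightarrow> ('e \<Rightarrow> 'm \<Rightarrow> int) \<Rightarrow> ('e \<Rightarrow> int)
      \<Rightarrow> (((('e + 'e \<Rightarrow>\<^sub>0 int) set \<Rightarrow> int) \<Rightarrow> real) set \<times>
          (((('e + 'e \<Rightarrow>\<^sub>0 int) set \<Rightarrow> int) \<Rightarrow>\<^sub>0 'k) \<Rightarrow> ereal)) set topology" where
  "lawrence_an v M E a r = toric_an v (lawrence_lattice M E a) (lawrence_fan M E a r)"

definition lawrence_trop_space ::
    "('m, 'b) monoid_scheme \<Rightarrow> 'e set \<Rightarrow> ('e \<Rightarrow> 'm \<Rightarrow> int) \<Rightarrow> ('e \<Rightarrow> int)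
      \<Rightarrow> (((('e + 'e \<Rightarrow>\<^sub>0 int) set \<Rightarrow> int) \<Rightarrow> real) set \<times>
          ((('e + 'e \<Rightarrow>\<^sub>0 int) set \<Rightarrow> int) \<Rightarrow> ereal)) set topology" where
  "lawrence_trop_space M E a r = toric_trop_space (lawrence_lattice M E a) (lawrence_fan M E a r)"

definition lawrence_trop ::
    "('m, 'b) monoid_scheme \<Rightarrow> 'e set \<Rightarrow> ('e \<Rightarrow> 'm \<Rightarrow> int) \<Rightarrow> ('e \<Rightarrow> int)
      \<Rightarrow> (((('e + 'e \<Rightarrow>\<^sub>0 int) set \<Rightarrow> int) \<Rightarrow> real) set \<times>
          (((('e + 'e \<Rightarrow>\<^sub>0 int) set \<Rightarrow> int) \<Rightarrow>\<^sub>0 'k::field) \<Rightarrow> ereal)) set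
      \<Rightarrow> (((('e + 'e \<Rightarrow>\<^sub>0 int) set \<Rightarrow> int) \<Rightarrow> real) set \<times>
          ((('e + 'e \<Rightarrow>\<^sub>0 int) set \<Rightarrow> int) \<Rightarrow> ereal)) set" where
  "lawrence_trop M E a r = toric_trop (lawrence_lattice M E a) (lawrence_fan M E a r)"

text \<open>
  The lattice map underlying \<open>\<Phi>\<close> is induced by \<open>\<delta>\<^sub>e\<^sup>\<plusminus> \<mapsto> \<delta>\<^sub>e\<close>, which is constant on the cosets of
  \<^const>\<open>lawrence_relations\<close>.  Its \<open>e\<close>-th coordinate is the exponent of the monomial to which \<open>\<Phi>\<close>
  pulls back the coordinate function \<open>x\<^sub>e\<close> of \<open>\<bbbA>\<^sup>E\<close>.
\<close>

definition lawrence_to_affine :: "('e + 'e \<Rightarrow>\<^sub>0 int) set \<Rightarrow> 'e \<Rightarrow>\<^sub>0 int" where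
  "lawrence_to_affine C = the_elem (frag_extend (\<lambda>i. frag_of (case_sum id id i)) ` C)"

definition coordinate_exponent ::
    "('m, 'b) monoid_scheme \<Rightarrow> 'e set \<Rightarrow> ('e \<Rightarrow> 'm \<Rightarrow> int) \<Rightarrow> 'e
      \<Rightarrow> ('e + 'e \<Rightarrow>\<^sub>0 int) set \<Rightarrow> int" where
  "coordinate_exponent M E a e =
     (\<lambda>C. if C \<in> carrier (lawrence_lattice M E a)
          then Poly_Mapping.lookup (lawrence_to_affine C) e else 0)"

definition hypertoric_ideal ::
    "('m, 'b) monoid_scheme \<Rightarrow> 'e set \<Rightarrow> ('e \<Rightarrow> 'm \<Rightarrow> int)
      \<Rightarrow> ((('e + 'e \<Rightarrow>\<^sub>0 int) set \<Rightarrow> int) \<Rightarrow> real) set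
      \<Rightarrow> ((('e + 'e \<Rightarrow>\<^sub>0 int) set \<Rightarrow> int) \<Rightarrow>\<^sub>0 'k::field) set" where
  "hypertoric_ideal M E a \<sigma> =
     Idl\<^bsub>monoid_algebra (dual_monoid (lawrence_lattice M E a) \<sigma>)\<^esub>
       {\<Sum>e\<in>E. Poly_Mapping.single (coordinate_exponent M E a e) (of_int (Poly_Mapping.lookup c e)) | c.
          c \<in> relation_lattice M E a}"

text \<open>
  The analytification of the closed subvariety with ideals \<^const>\<open>hypertoric_ideal\<close> on the toric
  charts: a valuation on a quotient ring is a valuation on the ring which is \<open>\<infinity>\<close> on the ideal.
\<close>

definition hypertoric_an ::
    "('k::field \<Rightarrow> ereal) \<Rightarrow> ('m, 'b) monoid_scheme \<Rightarrow> 'e set \<Rightarrow> ('e \<Rightarrow> 'm \<Rightarrow> int) \<Rightarrow> ('e \<Rightarrow> int)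
      \<Rightarrow> (((('e + 'e \<Rightarrow>\<^sub>0 int) set \<Rightarrow> int) \<Rightarrow> real) set \<times>
          (((('e + 'e \<Rightarrow>\<^sub>0 int) set \<Rightarrow> int) \<Rightarrow>\<^sub>0 'k) \<Rightarrow> ereal)) set set" where
  "hypertoric_an v M E a r =
     {P \<in> topspace (lawrence_an v M E a r).
        \<forall>(\<sigma>, \<nu>)\<in>P. \<forall>f\<in>hypertoric_ideal M E a \<sigma>. \<nu> f = \<infinity>}"

definition hypertoric_Trop ::
    "('k::field \<Rightarrow> ereal) \<Rightarrow> ('m, 'b) monoid_scheme \<Rightarrow> 'e set \<Rightarrow> ('e \<Rightarrow> 'm \<Rightarrow> int) \<Rightarrow> ('e \<Rightarrow> int)
      \<Rightarrow> (((('e + 'e \<Rightarrow>\<^sub>0 int) set \<Rightarrow> int) \<Rightarrow> real) set \<times>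
          ((('e + 'e \<Rightarrow>\<^sub>0 int) set \<Rightarrow> int) \<Rightarrow> ereal)) set set" where
  "hypertoric_Trop v M E a r = lawrence_trop M E a r ` hypertoric_an v M E a r"

end

theory Submission
  imports Defs
begin

text \<open>
  On a chart given by a vertex, the coordinate ring of the hypertoric variety is graded by the
  degrees \<open>(u(\<rho>\<^sub>e\<^sup>+) - u(\<rho>\<^sub>e\<^sup>-))\<^sub>e\<close> of its monomials, and every graded piece is free of rank one over the
  coordinate ring of the linear space \<open>L\<close>, which is a polynomial ring in the coordinates indexed by
  any basis \<open>B\<close> of the matroid of \<open>L\<close>.  Rewriting the other coordinates as linear forms in the \<open>x\<^sub>b\<close>
  gives a normal form of \<open>f\<close> for every \<open>B\<close>, and every valuation \<open>\<nu>\<close> above a tropical point \<open>w\<close> satisfies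
  \<open>\<nu>(f) \<ge> w(nf\<^sub>B(f))\<close>, the right-hand side being the tropical polynomial with the coefficients of
  the normal form.  Gaussian elimination with complete pivoting finds for every \<open>w\<close> a basis for which
  \<open>f \<mapsto> w(nf\<^sub>B(f))\<close> is itself a valuation above \<open>w\<close>.  Hence \<open>s(w)(f) = max\<^sub>B w(nf\<^sub>B(f))\<close> is the least
  element of the fibre over \<open>w\<close>; it is continuous in \<open>w\<close> as a maximum of finitely many tropical
  polynomials, and minimality makes the local sections agree on overlaps.

  Both the multiplicativity of \<open>s(w)\<close> and uniqueness rest on perturbation: \<open>w\<close> is a limit of points of
  the tropical variety at which a given normal form has a single dominant monomial, and there all
  valuations in the fibre take the same value.
\<close>

text \<open>The graded pieces do not multiply like monomials: the lowest monomials of two opposite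
  degrees can have a product divisible by some x_e, which must be rewritten again if e lies outside
  B. So \<open>nf f * nf g\<close> is in general not normal, leading terms might cancel in passing
  to \<open>nf (f * g)\<close>, and a Gauss lemma for monomial weights does not apply directly.
  Perturbing until each factor and each substituted linear form has one strictly dominant term
  excludes cancellation, and the equality survives the limit. The direction is a real-valued
  additive function, so coordinates of value \<infinity> stay infinite and the perturbed points
  remain in the same boundary stratum.

  Normal forms need at least one of the two rays of every e in the cone; otherwise no largest power
  of x_e divides a monomial. This holds at vertices and can fail on faces. The section is therefore
  built on vertex charts only, and points over two of them are compared on a common face, where a
  power of an invertible monomial brings every function back into either chart.\<close>

abbreviation single :: "'a \<Rightarrow> 'b::zero \<Rightarrow> 'a \<Rightarrow>\<^sub>0 'b" where "single \<equiv> Poly_Mapping.single"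
abbreviation lookup :: "('a \<Rightarrow>\<^sub>0 'b::zero) \<Rightarrow> 'a \<Rightarrow> 'b" where "lookup \<equiv> Poly_Mapping.lookup"
abbreviation keys :: "('a \<Rightarrow>\<^sub>0 'b::zero) \<Rightarrow> 'a set" where "keys \<equiv> Poly_Mapping.keys"

section \<open>Limits and comparisons of finite infima and suprema\<close>

lemma tendsto_INF_finite:
  fixes F :: "'a \<Rightarrow> 'i \<Rightarrow> 'b::{complete_linorder,linorder_topology}"
  assumes "finite A" and "\<And>i. i \<in> A \<Longrightarrow> ((\<lambda>x. F x i) \<longlongrightarrow> L i) net"
  shows "((\<lambda>x. INF i\<in>A. F x i) \<longlongrightarrow> (INF i\<in>A. L i)) net"
  using assms
proof (induction A rule: finite_induct)
  case (insert a A)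
  then have "((\<lambda>x. min (F x a) (INF i\<in>A. F x i)) \<longlongrightarrow> min (L a) (INF i\<in>A. L i)) net"
    by (intro tendsto_min) auto
  then show ?case
    by (simp add: inf_min)
qed simp

lemma tendsto_SUP_finite:
  fixes F :: "'a \<Rightarrow> 'i \<Rightarrow> 'b::{complete_linorder,linorder_topology}"
  assumes "finite A" and "\<And>i. i \<in> A \<Longrightarrow> ((\<lambda>x. F x i) \<longlongrightarrow> L i) net"
  shows "((\<lambda>x. SUP i\<in>A. F x i) \<longlongrightarrow> (SUP i\<in>A. L i)) net"
  using assms
proof (induction A rule: finite_induct)
  case (insert a A)
  then have "((\<lambda>x. max (F x a) (SUP i\<in>A. F x i)) \<longlongrightarrow> max (L a) (SUP i\<in>A. L i)) net"
    by (intro tendsto_max) auto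
  then show ?case
    by (simp add: sup_max)
qed simp

lemma less_INF_finite_iff:
  fixes F :: "'i \<Rightarrow> ereal"
  assumes "finite A"
  shows "x < (INF i\<in>A. F i) \<longleftrightarrow> x < \<infinity> \<and> (\<forall>i\<in>A. x < F i)"
  using assms by (induction A rule: finite_induct) (auto simp: inf_min top_ereal_def)

lemma sum_monomials: "(\<Sum>u\<in>keys f. single u (lookup f u)) = f"
  by (rule poly_mapping_eqI)
    (simp add: lookup_sum lookup_single when_def in_keys_iff)

section \<open>Valuations of sums\<close>

locale valued_field =
  fixes v :: "'k::field \<Rightarrow> ereal"
  assumes nonarch: "nonarch_valuation v"
begin

lemma v_nminf [simp]: "v x \<noteq> -\<infinity>"
  and v_inf_iff [simp]: "v x = \<infinity> \<longleftrightarrow> x = 0"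
  and v_mult: "v (x * y) = v x + v y"
  and v_add: "min (v x) (v y) \<le> v (x + y)"
  using nonarch by (auto simp: nonarch_valuation_def)

lemma v_zero [simp]: "v 0 = \<infinity>"
  by simp

lemma v_one [simp]: "v 1 = 0"
proof -
  have "v 1 + v 1 = v 1"
    using v_mult[of 1 1] by simp
  moreover have "v 1 \<noteq> \<infinity>" "v 1 \<noteq> -\<infinity>"
    by (simp_all del: v_inf_iff add: v_inf_iff[of 1])
  ultimately show ?thesis
    by (cases "v 1") (auto simp: zero_ereal_def)
qed

lemma v_minus_one: "v (-1) = 0"
proof -
  have "v (-1) + v (-1) = 0"
    using v_mult[of "-1" "-1"] by simp
  then show ?thesis
    by (cases "v (-1)") (auto simp: zero_ereal_def)
qed

lemma v_minus [simp]: "v (- x) = v x"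
  using v_mult[of "-1" x] by (simp add: v_minus_one)

text \<open>A Gauss-type value with weights \<open>w\<close>. The empty infimum is the top element,
  so the zero polynomial gets the value \<infinity>.\<close>

definition trop_eval :: "('u \<Rightarrow> ereal) \<Rightarrow> ('u \<Rightarrow>\<^sub>0 'k) \<Rightarrow> ereal" where
  "trop_eval w f = (INF u\<in>keys f. v (lookup f u) + w u)"

lemma le_trop_eval_iff:
  "x \<le> trop_eval w f \<longleftrightarrow> (\<forall>u\<in>keys f. x \<le> v (lookup f u) + w u)"
  by (simp add: trop_eval_def le_INF_iff)

lemma less_trop_eval_iff:
  "x < trop_eval w f \<longleftrightarrow>
    x < \<infinity> \<and> (\<forall>u\<in>keys f. x < v (lookup f u) + w u)"
  by (simp add: trop_eval_def less_INF_finite_iff top_ereal_def)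

lemma trop_eval_le:
  "u \<in> keys f \<Longrightarrow> trop_eval w f \<le> v (lookup f u) + w u"
  unfolding trop_eval_def by (rule INF_lower)

lemma trop_eval_zero [simp]: "trop_eval w 0 = \<infinity>"
  by (simp add: trop_eval_def top_ereal_def)

lemma trop_eval_single: "w u \<noteq> -\<infinity> \<Longrightarrow> trop_eval w (single u c) = v c + w u"
  by (cases "c = 0") (simp_all add: trop_eval_def top_ereal_def)

lemma trop_eval_nminf:
  assumes "\<And>u. u \<in> keys f \<Longrightarrow> w u \<noteq> -\<infinity>"
  shows "trop_eval w f \<noteq> -\<infinity>"
proof -
  have "-\<infinity> < trop_eval w f"
    unfolding less_trop_eval_iff using assms by (auto simp: less_le ereal_plus_eq_MInfty)
  then show ?thesis by simp
qed

lemma trop_eval_attained: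
  assumes "trop_eval w f \<noteq> \<infinity>"
  obtains u where "u \<in> keys f" "trop_eval w f = v (lookup f u) + w u"
proof -
  obtain u where "u \<in> keys f" "\<not> trop_eval w f < v (lookup f u) + w u"
    using assms less_trop_eval_iff[of "trop_eval w f" w f] by auto
  with trop_eval_le[of u f w] that show thesis
    by force
qed

lemma trop_eval_uminus [simp]: "trop_eval w (- f) = trop_eval w f"
  by (simp add: trop_eval_def)

lemma trop_eval_add:
  assumes "\<And>u. u \<in> keys f \<union> keys g \<Longrightarrow> w u \<noteq> -\<infinity>"
  shows "min (trop_eval w f) (trop_eval w g) \<le> trop_eval w (f + g)"
  unfolding le_trop_eval_iff
proof
  fix u assume "u \<in> keys (f + g)"
  then have u: "u \<in> keys f \<union> keys g"
    by (rule subsetD[OF keys_add])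
  \<comment> \<open>Off the support of \<open>h\<close> the right-hand side is
    \<open>v 0 + w u\<close>, hence \<infinity>, so the bound holds at every such
    \<open>u\<close>.\<close>
  have bd: "trop_eval w h \<le> v (lookup h u) + w u" for h
    using trop_eval_le[of u h w] assms[OF u] by (cases "u \<in> keys h") (simp_all add: in_keys_iff)
  have "min (trop_eval w f) (trop_eval w g) \<le>
      min (v (lookup f u) + w u) (v (lookup g u) + w u)"
    using bd by (intro min.mono)
  also have "\<dots> = min (v (lookup f u)) (v (lookup g u)) + w u"
    using linear[of "v (lookup f u)" "v (lookup g u)"]
    by (metis add_right_mono min_absorb1 min_absorb2)
  also have "\<dots> \<le> v (lookup (f + g) u) + w u"
    by (intro add_right_mono) (simp add: lookup_add v_add)
  finally show "min (trop_eval w f) (trop_eval w g) \<le> v (lookup (f + g) u) + w u" .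
qed

lemma trop_eval_sum:
  assumes "\<And>i u. i \<in> I \<Longrightarrow> u \<in> keys (f i) \<Longrightarrow> w u \<noteq> -\<infinity>"
    and "\<And>i. i \<in> I \<Longrightarrow> x \<le> trop_eval w (f i)"
  shows "x \<le> trop_eval w (\<Sum>i\<in>I. f i)"
  using assms
proof (induction I rule: infinite_finite_induct)
  case (insert i I)
  have "x \<le> min (trop_eval w (f i)) (trop_eval w (\<Sum>i\<in>I. f i))"
    using insert by auto
  also have "\<dots> \<le> trop_eval w (f i + (\<Sum>i\<in>I. f i))"
    using insert.prems(1) keys_sum[of f I] by (intro trop_eval_add) blast
  finally show ?case
    using insert.hyps by simp
qed auto

end

locale valued_monoid = valued_field v for v :: "'k::field \<Rightarrow> ereal" +
  fixes S :: "'u::comm_monoid_add set"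
  assumes zero_S: "0 \<in> S" and add_S: "a \<in> S \<Longrightarrow> b \<in> S \<Longrightarrow> a + b \<in> S"
begin

abbreviation A :: "('u \<Rightarrow>\<^sub>0 'k) set" where
  "A \<equiv> carrier (monoid_algebra S)"

lemma A_iff: "f \<in> A \<longleftrightarrow> keys f \<subseteq> S"
  by (simp add: monoid_algebra_def)

lemma A_keysD: "f \<in> A \<Longrightarrow> u \<in> keys f \<Longrightarrow> u \<in> S"
  by (auto simp: A_iff)

lemma A_zero [simp]: "0 \<in> A" and A_one [simp]: "1 \<in> A"
  by (auto simp: A_iff zero_S)

lemma A_single: "u \<in> S \<Longrightarrow> single u c \<in> A"
  by (auto simp: A_iff)

lemma A_add: "f \<in> A \<Longrightarrow> g \<in> A \<Longrightarrow> f + g \<in> A"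
  using keys_add[of f g] by (auto simp: A_iff)

lemma A_uminus: "f \<in> A \<Longrightarrow> - f \<in> A"
  by (auto simp: A_iff)

lemma A_diff: "f \<in> A \<Longrightarrow> g \<in> A \<Longrightarrow> f - g \<in> A"
  using keys_diff[of f g] by (auto simp: A_iff)

lemma A_mult: "f \<in> A \<Longrightarrow> g \<in> A \<Longrightarrow> f * g \<in> A"
  using keys_mult[of f g] add_S by (fastforce simp: A_iff)

lemma A_sum: "(\<And>i. i \<in> I \<Longrightarrow> f i \<in> A) \<Longrightarrow> sum f I \<in> A"
  by (induction I rule: infinite_finite_induct) (auto intro: A_add)

lemma A_prod: "(\<And>i. i \<in> I \<Longrightarrow> f i \<in> A) \<Longrightarrow> prod f I \<in> A"
  by (induction I rule: infinite_finite_induct) (auto intro: A_mult)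

lemma A_power: "f \<in> A \<Longrightarrow> f ^ n \<in> A"
  by (induction n) (auto intro: A_mult)

lemma trop_pointsD:
  assumes "w \<in> tropical_points S"
  shows "u \<in> S \<Longrightarrow> w u \<noteq> -\<infinity>" "w 0 = 0" "a \<in> S \<Longrightarrow> b \<in> S \<Longrightarrow> w (a + b) = w a + w b"
  using assms by (auto simp: tropical_points_def)

lemma trop_eval_A_nminf: "w \<in> tropical_points S \<Longrightarrow> f \<in> A \<Longrightarrow> trop_eval w f \<noteq> -\<infinity>"
  by (rule trop_eval_nminf) (auto simp: A_iff trop_pointsD)

lemma trop_eval_A_single:
  "w \<in> tropical_points S \<Longrightarrow> u \<in> S \<Longrightarrow> trop_eval w (single u c) = v c + w u"
  by (rule trop_eval_single) (rule trop_pointsD)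

lemma trop_eval_A_add:
  "w \<in> tropical_points S \<Longrightarrow> f \<in> A \<Longrightarrow> g \<in> A \<Longrightarrow> min (trop_eval w f) (trop_eval w g) \<le> trop_eval w (f + g)"
  by (rule trop_eval_add) (auto simp: A_iff trop_pointsD)

lemma trop_eval_A_sum:
  assumes "w \<in> tropical_points S" "\<And>i. i \<in> I \<Longrightarrow> f i \<in> A" "\<And>i. i \<in> I \<Longrightarrow> x \<le> trop_eval w (f i)"
  shows "x \<le> trop_eval w (\<Sum>i\<in>I. f i)"
  using assms by (intro trop_eval_sum) (auto simp: A_iff subset_iff trop_pointsD)

text \<open>Only an inequality: distinct products of terms can share an exponent and cancel.\<close>

lemma trop_eval_mult:
  assumes w: "w \<in> tropical_points S" and f: "f \<in> A" and g: "g \<in> A"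
  shows "trop_eval w f + trop_eval w g \<le> trop_eval w (f * g)"
proof -
  have "f * g = (\<Sum>a\<in>keys f. \<Sum>b\<in>keys g.
      single (a + b) (lookup f a * lookup g b))"
    by (subst (1 2) sum_monomials[symmetric]) (simp add: sum_product mult_single)
  moreover have "trop_eval w f + trop_eval w g \<le> trop_eval w
      (single (a + b) (lookup f a * lookup g b))"
    if "a \<in> keys f" "b \<in> keys g" for a b
  proof -
    have ab: "a \<in> S" "b \<in> S"
      using that f g by (auto simp: A_iff)
    have "trop_eval w f + trop_eval w g \<le>
        (v (lookup f a) + w a) + (v (lookup g b) + w b)"
      using that by (intro add_mono trop_eval_le)
    also have "\<dots> = trop_eval w
      (single (a + b) (lookup f a * lookup g b))"
      using trop_pointsD[OF w] ab add_S[OF ab] by (simp add: trop_eval_single v_mult ac_simps)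
    finally show ?thesis .
  qed
  moreover have "single (a + b) (lookup f a * lookup g b) \<in> A"
    if "a \<in> keys f" "b \<in> keys g" for a b
    using that f g by (intro A_single add_S) (auto simp: A_iff)
  ultimately show ?thesis
    by (simp only:) (intro trop_eval_A_sum w A_sum)
qed

text \<open>The term may differ from the true term of \<open>f\<close> at \<open>u\<close> by
  something of larger value; only the remainder is controlled. This slack lets the notion pass to
  products, where several products of terms share an exponent. Strictness forces the dominant value
  to be finite.\<close>

definition dominated_by :: "('u \<Rightarrow> ereal) \<Rightarrow> ('u \<Rightarrow>\<^sub>0 'k) \<Rightarrow> 'k \<Rightarrow> 'u \<Rightarrow> bool" where
  "dominated_by w f c u \<longleftrightarrow>
     f \<in> A \<and> u \<in> S \<and> v c + w u < trop_eval w (f - single u c)"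

lemma dominated_by_finite:
  "dominated_by w f c u \<Longrightarrow> v c + w u \<noteq> \<infinity>"
  by (auto simp: dominated_by_def)

lemma add_dominated:
  assumes "w \<in> tropical_points S" "dominated_by w f c u" "g \<in> A" "v c + w u < trop_eval w g"
  shows "dominated_by w (f + g) c u"
proof -
  have "v c + w u < min (trop_eval w (f - single u c)) (trop_eval w g)"
    using assms by (simp add: dominated_by_def)
  also have "\<dots> \<le> trop_eval w ((f - single u c) + g)"
    using assms by (intro trop_eval_A_add A_diff A_single) (auto simp: dominated_by_def)
  finally show ?thesis
    using assms by (auto simp: dominated_by_def intro: A_add simp: algebra_simps)
qed

lemma dominated_by_single:
  "u \<in> S \<Longrightarrow> v c + w u \<noteq> \<infinity> \<Longrightarrow> dominated_by w (single u c) c u"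
  by (simp add: dominated_by_def A_single less_top[symmetric, unfolded top_ereal_def])

lemma dominated_by_eval:
  assumes w: "w \<in> tropical_points S" and d: "dominated_by w f c u"
  shows "trop_eval w f = v c + w u"
proof (rule antisym)
  let ?s = "single u c"
  have m: "f \<in> A" "?s \<in> A" "u \<in> S" "f - ?s \<in> A" and less: "v c + w u < trop_eval w (f - ?s)"
    using d by (auto simp: dominated_by_def intro: A_single A_diff)
  have "min (trop_eval w (f - ?s)) (trop_eval w ?s) \<le> trop_eval w ((f - ?s) + ?s)"
    by (intro trop_eval_A_add w m)
  then show "v c + w u \<le> trop_eval w f"
    using less by (simp add: trop_eval_A_single w m)
  have "min (trop_eval w f) (trop_eval w (- (f - ?s))) \<le> trop_eval w (f + - (f - ?s))"
    by (intro trop_eval_A_add w m A_uminus)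
  then have "min (trop_eval w f) (trop_eval w (f - ?s)) \<le> v c + w u"
    by (simp only: trop_eval_uminus) (simp add: trop_eval_A_single w m)
  then show "trop_eval w f \<le> v c + w u"
    using less by (auto simp: min_le_iff_disj)
qed

text \<open>With leading terms s and t, \<open>f * g - s * t = (f - s) * g + s * (g - t)\<close>,
  and both summands lie strictly above the sum of the leading values, since these are finite and can
  be cancelled.\<close>

lemma mult_dominated:
  assumes w: "w \<in> tropical_points S"
    and f: "dominated_by w f c u" and g: "dominated_by w g c' u'"
  shows "dominated_by w (f * g) (c * c') (u + u')"
proof -
  let ?s = "single u c" and ?t = "single u' c'"
  have m: "f \<in> A" "g \<in> A" "u \<in> S" "u' \<in> S" "f - ?s \<in> A" "g - ?t \<in> A" "?s \<in> A" "?t \<in> A"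
    using f g by (auto simp: dominated_by_def intro: A_single A_diff)
  have nm: "v c + w u \<noteq> -\<infinity>" "v c' + w u' \<noteq> -\<infinity>"
    using trop_pointsD(1)[OF w] m by auto
  have eq: "v (c * c') + w (u + u') = (v c + w u) + (v c' + w u')"
    using trop_pointsD[OF w] m by (simp add: v_mult ac_simps)
  have 1: "v (c * c') + w (u + u') < trop_eval w ((f - ?s) * g)"
  proof -
    have "(v c' + w u') + (v c + w u) < trop_eval w g + trop_eval w (f - ?s)"
      using dominated_by_finite[OF g] nm f
      unfolding dominated_by_eval[OF w g] by (intro ereal_less_add) (auto simp: dominated_by_def)
    also have "\<dots> \<le> trop_eval w ((f - ?s) * g)"
      using trop_eval_mult[OF w m(5,2)] by (simp add: add.commute)
    finally show ?thesis by (simp only: eq add.commute)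
  qed
  have 2: "v (c * c') + w (u + u') < trop_eval w (?s * (g - ?t))"
  proof -
    have "(v c + w u) + (v c' + w u') < trop_eval w ?s + trop_eval w (g - ?t)"
      using dominated_by_finite[OF f] nm g
      unfolding trop_eval_A_single[OF w m(3)] by (intro ereal_less_add) (auto simp: dominated_by_def)
    also have "\<dots> \<le> trop_eval w (?s * (g - ?t))"
      by (rule trop_eval_mult[OF w m(7,6)])
    finally show ?thesis by (simp only: eq)
  qed
  have "v (c * c') + w (u + u') < min (trop_eval w ((f - ?s) * g)) (trop_eval w (?s * (g - ?t)))"
    using 1 2 by (rule min_less_iff_conj[THEN iffD2, OF conjI])
  also have "\<dots> \<le> trop_eval w ((f - ?s) * g + ?s * (g - ?t))"
    by (intro trop_eval_A_add w A_mult m)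
  also have "(f - ?s) * g + ?s * (g - ?t) = f * g - single (u + u') (c * c')"
    by (simp add: mult_single algebra_simps)
  finally have "v (c * c') + w (u + u') < trop_eval w (f * g - single (u + u') (c * c'))" .
  then show ?thesis
    using m by (auto simp: dominated_by_def intro: A_mult add_S)
qed

lemma power_dominated:
  assumes w: "w \<in> tropical_points S" and f: "dominated_by w f c u"
  shows "\<exists>c u. dominated_by w (f ^ n) c u"
proof (induction n)
  case 0
  have "dominated_by w (single 0 1) 1 0"
    by (rule dominated_by_single) (auto simp: zero_S trop_pointsD[OF w])
  then show ?case
    by auto
next
  case (Suc n)
  then show ?case
    using mult_dominated[OF w f] by (metis power_Suc)
qed

lemma prod_dominated:
  assumes w: "w \<in> tropical_points S" and "\<And>i. i \<in> I \<Longrightarrow> \<exists>c u. dominated_by w (f i) c u"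
  shows "\<exists>c u. dominated_by w (prod f I) c u"
  using assms(2)
proof (induction I rule: infinite_finite_induct)
  case (insert i I)
  then obtain c u c' u' where "dominated_by w (f i) c u" "dominated_by w (prod f I) c' u'"
    by (metis insertCI)
  with mult_dominated[OF w this] show ?case
    using insert by auto
qed (use power_dominated[OF w dominated_by_single[of 0 1], of 0] zero_S trop_pointsD[OF w] in auto)

lemma trop_eval_mult_dominated:
  assumes "w \<in> tropical_points S" "dominated_by w f c u" "dominated_by w g c' u'"
  shows "trop_eval w (f * g) = trop_eval w f + trop_eval w g"
proof -
  have "u \<in> S" "u' \<in> S"
    using assms by (auto simp: dominated_by_def)
  then show ?thesis
    using dominated_by_eval[OF assms(1)] assms mult_dominated[OF assms] trop_pointsD[OF assms(1)]
    by (simp add: v_mult ac_simps)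
qed

section \<open>Berkovich points\<close>

lemma berkovich_pointsD:
  assumes "\<nu> \<in> berkovich_points v S"
  shows "\<nu> (single 0 c) = v c" "f \<in> A \<Longrightarrow> \<nu> f \<noteq> -\<infinity>"
    "f \<in> A \<Longrightarrow> g \<in> A \<Longrightarrow> \<nu> (f * g) = \<nu> f + \<nu> g"
    "f \<in> A \<Longrightarrow> g \<in> A \<Longrightarrow> min (\<nu> f) (\<nu> g) \<le> \<nu> (f + g)"
    "\<nu> \<in> extensional A"
  using assms by (auto simp: berkovich_points_def)

lemma berkovich_simps:
  assumes \<nu>: "\<nu> \<in> berkovich_points v S"
  shows "\<nu> 0 = \<infinity>" "\<nu> 1 = 0" "f \<in> A \<Longrightarrow> \<nu> (- f) = \<nu> f"
proof -
  show "\<nu> 0 = \<infinity>" "\<nu> 1 = 0"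
    using berkovich_pointsD(1)[OF \<nu>, of 0] berkovich_pointsD(1)[OF \<nu>, of 1] by auto
  assume f: "f \<in> A"
  have "\<nu> (single 0 (-1) * f) = v (-1) + \<nu> f"
    using f by (subst berkovich_pointsD(3)[OF \<nu>]) (auto intro: A_single zero_S simp: berkovich_pointsD(1)[OF \<nu>])
  then show "\<nu> (- f) = \<nu> f"
    by (simp add: v_minus_one single_uminus)
qed

definition trop_of :: "(('u \<Rightarrow>\<^sub>0 'k) \<Rightarrow> ereal) \<Rightarrow> 'u \<Rightarrow> ereal" where
  "trop_of \<nu> = (\<lambda>u\<in>S. \<nu> (single u 1))"

lemma trop_of_points:
  assumes \<nu>: "\<nu> \<in> berkovich_points v S"
  shows "trop_of \<nu> \<in> tropical_points S"
  unfolding tropical_points_def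
proof (intro CollectI conjI ballI)
  fix a b assume ab: "a \<in> S" "b \<in> S"
  then have "\<nu> (single a 1 * single b 1) = trop_of \<nu> a + trop_of \<nu> b"
    by (subst berkovich_pointsD(3)[OF \<nu>]) (auto intro: A_single simp: trop_of_def)
  with ab show "trop_of \<nu> (a + b) = trop_of \<nu> a + trop_of \<nu> b"
    by (simp add: mult_single trop_of_def add_S)
qed (use berkovich_simps[OF \<nu>] in \<open>auto simp: trop_of_def zero_S A_single berkovich_pointsD(2)[OF \<nu>]\<close>)

lemma berkovich_single:
  assumes \<nu>: "\<nu> \<in> berkovich_points v S" and u: "u \<in> S"
  shows "\<nu> (single u c) = v c + trop_of \<nu> u"
proof -
  have "\<nu> (single 0 c * single u 1) = v c + trop_of \<nu> u"
    using u by (subst berkovich_pointsD(3)[OF \<nu>])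
      (auto intro: A_single zero_S simp: trop_of_def berkovich_pointsD(1)[OF \<nu>])
  then show ?thesis
    by (simp add: mult_single)
qed

lemma berkovich_sum:
  assumes \<nu>: "\<nu> \<in> berkovich_points v S" and "\<And>i. i \<in> I \<Longrightarrow> f i \<in> A" "\<And>i. i \<in> I \<Longrightarrow> x \<le> \<nu> (f i)"
  shows "x \<le> \<nu> (\<Sum>i\<in>I. f i)"
  using assms(2,3)
proof (induction I rule: infinite_finite_induct)
  case (insert i I)
  have "x \<le> min (\<nu> (f i)) (\<nu> (\<Sum>i\<in>I. f i))"
    using insert by auto
  also have "\<dots> \<le> \<nu> (f i + (\<Sum>i\<in>I. f i))"
    using insert.prems(1) by (intro berkovich_pointsD[OF \<nu>] A_sum) auto
  finally show ?case
    using insert.hyps by simp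
qed (auto simp: berkovich_simps[OF \<nu>])

lemma trop_eval_le_berkovich:
  assumes \<nu>: "\<nu> \<in> berkovich_points v S" and f: "f \<in> A"
  shows "trop_eval (trop_of \<nu>) f \<le> \<nu> f"
proof -
  have "trop_eval (trop_of \<nu>) f \<le> \<nu> (\<Sum>u\<in>keys f. single u (lookup f u))"
    using f by (intro berkovich_sum[OF \<nu>])
      (auto intro!: A_single trop_eval_le simp: A_iff subset_iff berkovich_single[OF \<nu>])
  then show ?thesis
    by (simp add: sum_monomials)
qed

lemma berkovich_eq_of_less:
  assumes \<nu>: "\<nu> \<in> berkovich_points v S" and fg: "f \<in> A" "g \<in> A" and less: "\<nu> g < \<nu> (f - g)"
  shows "\<nu> f = \<nu> g"
proof (rule antisym)
  have "min (\<nu> (f - g)) (\<nu> g) \<le> \<nu> ((f - g) + g)"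
    by (intro berkovich_pointsD[OF \<nu>] A_diff fg)
  then show "\<nu> g \<le> \<nu> f"
    using less by simp
  have "min (\<nu> f) (\<nu> (- (f - g))) \<le> \<nu> (f + - (f - g))"
    by (intro berkovich_pointsD[OF \<nu>] A_diff fg A_uminus)
  then have "min (\<nu> f) (\<nu> (f - g)) \<le> \<nu> g"
    by (simp only: berkovich_simps[OF \<nu>] A_diff fg) simp
  then show "\<nu> f \<le> \<nu> g"
    using less by (auto simp: min_le_iff_disj)
qed

text \<open>The remainder has \<open>\<nu>\<close>-value at least its tropical value, hence strictly
  above that of the leading term. So \<open>\<nu> f\<close> depends on the tropical point alone, and
  all valuations in the fibre agree on \<open>f\<close>.\<close>

lemma berkovich_dominated:
  assumes \<nu>: "\<nu> \<in> berkovich_points v S" and d: "dominated_by (trop_of \<nu>) f c u"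
  shows "\<nu> f = trop_eval (trop_of \<nu>) f"
proof -
  let ?s = "single u c"
  have m: "f \<in> A" "u \<in> S" "?s \<in> A"
    using d by (auto simp: dominated_by_def intro: A_single)
  have "\<nu> ?s < trop_eval (trop_of \<nu>) (f - ?s)"
    using d m by (simp add: dominated_by_def berkovich_single[OF \<nu>])
  also have "\<dots> \<le> \<nu> (f - ?s)"
    by (intro trop_eval_le_berkovich \<nu> A_diff m)
  finally have "\<nu> f = \<nu> ?s"
    by (intro berkovich_eq_of_less[OF \<nu>] m)
  then show ?thesis
    using m by (simp add: berkovich_single[OF \<nu>] dominated_by_eval[OF trop_of_points[OF \<nu>] d])
qed

lemma berkovich_cong_inf:
  assumes \<nu>: "\<nu> \<in> berkovich_points v S" and fg: "f \<in> A" "g \<in> A" and inf: "\<nu> (f - g) = \<infinity>"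
  shows "\<nu> f = \<nu> g"
proof (cases "\<nu> g = \<infinity>")
  case True
  have "min (\<nu> (f - g)) (\<nu> g) \<le> \<nu> ((f - g) + g)"
    by (intro berkovich_pointsD[OF \<nu>] A_diff fg)
  with True inf show ?thesis
    by simp
next
  case False
  then show ?thesis
    using inf by (intro berkovich_eq_of_less \<nu> fg) (simp add: less_le)
qed

end

lemma sum_fun_apply: "(\<Sum>i\<in>I. f i) x = (\<Sum>i\<in>I. f i x)"
  for f :: "'i \<Rightarrow> 'a \<Rightarrow> 'b::comm_monoid_add"
  by (induction I rule: infinite_finite_induct) auto

lemma finite_obtains_min:
  fixes f :: "'a \<Rightarrow> 'b::linorder"
  assumes "finite J" "J \<noteq> {}"
  obtains p where "p \<in> J" "\<And>q. q \<in> J \<Longrightarrow> f p \<le> f q"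
  using arg_min_if_finite(1)[OF assms, of f] arg_min_least[OF assms, of _ f] by blast

section \<open>Generic perturbations\<close>

text \<open>The old avoiding point is moved along a coordinate in which the new normal is nonzero.
  On that line every hyperplane excludes only finitely many parameters, and there are infinitely
  many reals.\<close>

lemma avoid_hyperplanes:
  fixes Z :: "(('e \<Rightarrow> int) \<times> real) set"
  assumes "finite Z" and "finite B" and "\<And>n c. (n, c) \<in> Z \<Longrightarrow> \<exists>b\<in>B. n b \<noteq> 0"
  shows "\<exists>\<alpha>::'e \<Rightarrow> real. \<forall>(n, c)\<in>Z. (\<Sum>b\<in>B. \<alpha> b * of_int (n b)) \<noteq> c"
  using assms(1,3)
proof (induction Z rule: finite_induct)
  case (insert z Z)
  obtain n c where z: "z = (n, c)"
    by (cases z)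
  with insert.prems obtain b0 where b0: "b0 \<in> B" "n b0 \<noteq> 0"
    by blast
  have "\<exists>\<alpha>::'e \<Rightarrow> real. \<forall>(n, c)\<in>Z. (\<Sum>b\<in>B. \<alpha> b * of_int (n b)) \<noteq> c"
    by (rule insert.IH) (meson insert.prems insertI2)
  then obtain \<alpha> :: "'e \<Rightarrow> real" where \<alpha>: "\<And>n c. (n, c) \<in> Z \<Longrightarrow> (\<Sum>b\<in>B. \<alpha> b * of_int (n b)) \<noteq> c"
    by blast
  define val where "val s n = (\<Sum>b\<in>B. (\<alpha>(b0 := \<alpha> b0 + s)) b * of_int (n b))" for s n
  have val: "val s n = (\<Sum>b\<in>B. \<alpha> b * of_int (n b)) + s * of_int (n b0)" for s n
    using b0(1) assms(2) by (simp add: val_def sum.remove[of B b0] algebra_simps)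
  have fin: "finite {s. val s n' = c'}" if "(n', c') \<in> insert z Z" for n' c'
  proof (cases "n' b0 = 0")
    \<comment> \<open>A hyperplane parallel to the line: its equation does not involve
      \<open>s\<close>, it is not the new one, and the old point avoids it already.\<close>
    case True
    with that z b0 have "(n', c') \<in> Z"
      by auto
    with \<alpha> True show ?thesis
      by (auto simp: val)
  next
    case False
    then have "{s. val s n' = c'} \<subseteq> {(c' - (\<Sum>b\<in>B. \<alpha> b * of_int (n' b))) / of_int (n' b0)}"
      by (auto simp: val field_simps)
    then show ?thesis
      by (rule finite_subset) simp
  qed
  have "finite (\<Union>(n', c')\<in>insert z Z. {s. val s n' = c'})"
    using fin insert.hyps(1) by (intro finite_UN_I) auto
  then have "\<exists>s. s \<notin> (\<Union>(n', c')\<in>insert z Z. {s. val s n' = c'})"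
    by (rule ex_new_if_finite[OF infinite_UNIV_char_0])
  then obtain s where "s \<notin> (\<Union>(n', c')\<in>insert z Z. {s. val s n' = c'})" ..
  then show ?case
    by (intro exI[of _ "\<alpha>(b0 := \<alpha> b0 + s)"]) (auto simp: val_def)
qed simp

text \<open>The minimum is taken lexicographically, first for \<open>x\<close>, then for
  \<open>\<alpha>\<close>. Ties in \<open>x\<close> are broken by \<open>t * \<alpha>\<close> for
  every positive \<open>t\<close>; strict gaps persist for small \<open>t\<close> by
  continuity.\<close>

lemma eventually_unique_min:
  fixes x :: "'i \<Rightarrow> ereal" and \<alpha> :: "'i \<Rightarrow> real"
  assumes fin: "finite I" and inj: "inj_on \<alpha> I" and x: "\<And>i. i \<in> I \<Longrightarrow> x i \<noteq> -\<infinity>"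
    and ex: "i \<in> I" "x i \<noteq> \<infinity>"
  obtains i0 where "i0 \<in> I" "x i0 \<noteq> \<infinity>" "\<And>i. i \<in> I \<Longrightarrow> x i0 \<le> x i"
    "\<forall>\<^sub>F t in at_right 0. \<forall>i\<in>I - {i0}. x i0 + ereal (t * \<alpha> i0) < x i + ereal (t * \<alpha> i)"
proof -
  define J where "J = {i \<in> I. \<forall>j\<in>I. x i \<le> x j}"
  obtain k where "k \<in> I" "\<And>j. j \<in> I \<Longrightarrow> x k \<le> x j"
    using finite_obtains_min[of I x] fin ex by blast
  then have "J \<noteq> {}"
    by (auto simp: J_def)
  moreover have "finite J"
    using fin by (simp add: J_def)
  ultimately obtain i0 where i0: "i0 \<in> J" "\<And>j. j \<in> J \<Longrightarrow> \<alpha> i0 \<le> \<alpha> j"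
    using finite_obtains_min[of J \<alpha>] by blast
  then have i0I: "i0 \<in> I" and least: "\<And>i. i \<in> I \<Longrightarrow> x i0 \<le> x i"
    by (auto simp: J_def)
  from least[OF ex(1)] ex(2) x[OF i0I] obtain m where m: "x i0 = ereal m"
    by (cases "x i0") auto
  have "\<forall>\<^sub>F t in at_right 0. x i0 + ereal (t * \<alpha> i0) < x i + ereal (t * \<alpha> i)"
    if i: "i \<in> I - {i0}" for i
  proof (cases "x i = x i0")
    case True
    with i least have "i \<in> J"
      by (auto simp: J_def)
    with i0(2)[of i] inj i i0I have "\<alpha> i0 < \<alpha> i"
      by (metis DiffE inj_on_contraD insertI1 less_eq_real_def)
    with True m show ?thesis
      by (auto simp: eventually_at_right_field intro!: exI[of _ 1])
  next
    case False
    with least[of i] i have less: "x i0 < x i"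
      by auto
    show ?thesis
    proof (cases "x i")
      case (real y)
      have "((\<lambda>t. (y + t * \<alpha> i) - (m + t * \<alpha> i0)) \<longlongrightarrow> (y + 0 * \<alpha> i) - (m + 0 * \<alpha> i0)) (at_right 0)"
        by (intro tendsto_intros)
      then have "\<forall>\<^sub>F t in at_right 0. 0 < (y + t * \<alpha> i) - (m + t * \<alpha> i0)"
        using less real m by (intro order_tendstoD(1)) auto
      then show ?thesis
        by (simp add: real m)
    qed (use less m in auto)
  qed
  then have "\<forall>\<^sub>F t in at_right 0. \<forall>i\<in>I - {i0}. x i0 + ereal (t * \<alpha> i0) < x i + ereal (t * \<alpha> i)"
    using fin by (simp add: eventually_ball_finite_distrib)
  with that i0I least m show thesis
    by simp
qed

section \<open>Bases of a space of linear forms\<close>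

definition linear_subspace :: "('e \<Rightarrow> 'k::field) set \<Rightarrow> bool" where
  "linear_subspace L \<longleftrightarrow> 0 \<in> L \<and> (\<forall>x\<in>L. \<forall>y\<in>L. x + y \<in> L) \<and> (\<forall>x\<in>L. \<forall>c. (\<lambda>e. c * x e) \<in> L)"

lemma linear_subspace_sum:
  assumes "linear_subspace L" "\<And>i. i \<in> I \<Longrightarrow> f i \<in> L"
  shows "(\<Sum>i\<in>I. f i) \<in> L"
  using assms(2) by (induction I rule: infinite_finite_induct)
    (use assms(1) in \<open>auto simp: linear_subspace_def\<close>)

lemma linear_subspace_diff:
  assumes L: "linear_subspace L" and "x \<in> L" "y \<in> L"
  shows "x - y \<in> L"
proof -
  have "(\<lambda>e. (-1) * y e) \<in> L"
    using assms unfolding linear_subspace_def by blast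
  then have "x + (\<lambda>e. (-1) * y e) \<in> L"
    using assms unfolding linear_subspace_def by blast
  moreover have "x + (\<lambda>e. (-1) * y e) = x - y"
    by (simp add: fun_eq_iff)
  ultimately show ?thesis
    by (simp only:)
qed

text \<open>
  Modulo the relations \<open>L\<close>, the coordinates \<open>x\<^sub>b\<close> with \<open>b \<in> B\<close> form a basis of the space of linear
  forms, and \<open>x\<^sub>e = \<Sum>\<^sub>b C\<^sub>e\<^sub>b x\<^sub>b\<close>.
\<close>

definition basis_matrix :: "'e set \<Rightarrow> ('e \<Rightarrow> 'k::field) set \<Rightarrow> 'e set \<Rightarrow> ('e \<Rightarrow> 'e \<Rightarrow> 'k) \<Rightarrow> bool" where
  "basis_matrix E L B C \<longleftrightarrow> B \<subseteq> E \<and>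
     (\<forall>b\<in>B. \<forall>b'\<in>B. C b b' = (if b = b' then 1 else 0)) \<and>
     (\<forall>e\<in>E. (\<lambda>x. (if x = e then 1 else 0) - (if x \<in> B then C e x else 0)) \<in> L) \<and>
     (\<forall>l\<in>L. \<forall>b\<in>B. (\<Sum>e\<in>E. l e * C e b) = 0)"

text \<open>The difference of the two rows for \<open>e\<close> lies in \<open>L\<close> and is
  supported on \<open>B\<close>. Pairing it with the columns of \<open>C\<close> gives back its
  entries, while elements of \<open>L\<close> pair to 0. Hence an arbitrarily chosen matrix for
  \<open>B\<close> inherits the bounds found by pivoting.\<close>

lemma basis_matrix_unique:
  assumes "finite E" and L: "linear_subspace L" and C: "basis_matrix E L B C" and C': "basis_matrix E L B C'"
    and e: "e \<in> E" and b: "b \<in> B"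
  shows "C e b = C' e b"
proof -
  define d where "d = (\<lambda>x. if x \<in> B then C' e x - C e x else 0)"
  have "(\<lambda>x. (if x = e then 1 else 0) - (if x \<in> B then C e x else 0)) -
      (\<lambda>x. (if x = e then 1 else 0) - (if x \<in> B then C' e x else 0)) \<in> L"
    using C C' e by (intro linear_subspace_diff[OF L]) (auto simp: basis_matrix_def)
  also have "(\<lambda>x. (if x = e then 1 else 0) - (if x \<in> B then C e x else 0)) -
      (\<lambda>x. (if x = e then 1 else 0) - (if x \<in> B then C' e x else 0)) = d"
    by (auto simp: d_def fun_eq_iff)
  finally have "(\<Sum>x\<in>E. d x * C x b) = 0"
    using C b by (auto simp: basis_matrix_def)
  moreover have "(\<Sum>x\<in>E. d x * C x b) = (\<Sum>x\<in>{b}. d x * C x b)"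
    using assms(1) C b by (intro sum.mono_neutral_right) (auto simp: basis_matrix_def d_def)
  ultimately show ?thesis
    using C b by (auto simp: basis_matrix_def d_def)
qed

section \<open>Gaussian elimination with pivots of least weight\<close>

context valued_field
begin

text \<open>Here \<open>E - B\<close> is the set of pivot columns and \<open>R e\<close> the reduced
  row with pivot \<open>e\<close>. The pivot of a row is a column of least weight
  \<open>v (l0 e) + w e\<close>, so once its entry is scaled to 1 it bounds the whole row from
  below; clearing the other pivot columns preserves the bound by the ultrametric inequality.\<close>

lemma pivoting:
  assumes "finite E" and "linear_subspace L" and "\<And>l e. l \<in> L \<Longrightarrow> e \<notin> E \<Longrightarrow> l e = 0"
    and w: "\<And>e. w e \<noteq> (-\<infinity>::ereal)"
  shows "\<exists>B R. B \<subseteq> E \<and> (\<forall>e\<in>E - B. R e \<in> L \<and> (\<forall>e'\<in>E - B. R e e' = (if e' = e then 1 else 0)) \<and>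
      (\<forall>b\<in>B. w e \<le> v (R e b) + w b)) \<and> (\<forall>l\<in>L. (\<forall>e\<in>E - B. l e = 0) \<longrightarrow> l = 0)"
  using assms(1-3)
proof (induction E arbitrary: L rule: finite_psubset_induct)
  case (psubset E)
  note L = psubset.prems(1)
  show ?case
  proof (cases "L \<subseteq> {0}")
    case True
    then show ?thesis
      by (intro exI[of _ E]) blast
  next
    case False
    then obtain l0 where l0: "l0 \<in> L" "l0 \<noteq> 0"
      by auto
    define J where "J = {e \<in> E. l0 e \<noteq> 0}"
    have "J \<noteq> {}"
      using l0 psubset.prems(2)[OF l0(1)] by (auto simp: J_def fun_eq_iff)
    moreover have "finite J"
      using psubset.hyps by (simp add: J_def)
    ultimately obtain p where p: "p \<in> J" "\<And>f. f \<in> J \<Longrightarrow> v (l0 p) + w p \<le> v (l0 f) + w f"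
      using finite_obtains_min[of J "\<lambda>e. v (l0 e) + w e"] by blast
    define l where "l = (\<lambda>e. inverse (l0 p) * l0 e)"
    have lL: "l \<in> L"
      using L l0 by (simp add: l_def linear_subspace_def)
    have pE: "p \<in> E" and lp: "l p = 1"
      using p(1) by (auto simp: J_def l_def)
    have lw: "w p \<le> v (l f) + w f" for f
    proof (cases "f \<in> J")
      case True
      have "l0 f = l0 p * l f"
        using p(1) by (simp add: l_def J_def)
      then have le: "v (l0 p) + w p \<le> v (l0 p) + (v (l f) + w f)"
        using p(2)[OF True] by (simp add: v_mult ac_simps)
      obtain y where "v (l0 p) = ereal y"
        using p(1) v_nminf[of "l0 p"] v_inf_iff[of "l0 p"] by (cases "v (l0 p)") (auto simp: J_def)
      with le show ?thesis
        using ereal_add_le_add_iff[of "v (l0 p)"] by auto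
    next
      case False
      then have "l f = 0"
        using psubset.prems(2)[OF lL, of f] by (cases "f \<in> E") (auto simp: J_def l_def)
      then show ?thesis
        using w by simp
    qed
    define L' where "L' = {x \<in> L. x p = 0}"
    have L': "linear_subspace L'"
      using L by (auto simp: L'_def linear_subspace_def)
    have "\<exists>B R. B \<subseteq> E - {p} \<and> (\<forall>e\<in>E - {p} - B. R e \<in> L' \<and>
      (\<forall>e'\<in>E - {p} - B. R e e' = (if e' = e then 1 else 0)) \<and>
      (\<forall>b\<in>B. w e \<le> v (R e b) + w b)) \<and> (\<forall>l\<in>L'. (\<forall>e\<in>E - {p} - B. l e = 0) \<longrightarrow> l = 0)"
      by (rule psubset.IH) (use pE L' psubset.prems(2) in \<open>auto simp: L'_def\<close>)
    then obtain B R where B: "B \<subseteq> E - {p}" and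
      R': "\<forall>e\<in>E - {p} - B. R e \<in> L' \<and>
      (\<forall>e'\<in>E - {p} - B. R e e' = (if e' = e then 1 else 0)) \<and> (\<forall>b\<in>B. w e \<le> v (R e b) + w b)"
      and ind: "\<forall>l\<in>L'. (\<forall>e\<in>E - {p} - B. l e = 0) \<longrightarrow> l = 0"
      by (elim exE conjE) (rule that)
    have R: "R e \<in> L'" "e' \<in> E - {p} - B \<Longrightarrow> R e e' = (if e' = e then 1 else 0)"
      "b \<in> B \<Longrightarrow> w e \<le> v (R e b) + w b" if "e \<in> E - {p} - B" for e e' b
      using R' that by auto
    let ?D = "E - {p} - B"
    have EB: "E - B = insert p ?D"
      using pE B by auto
    \<comment> \<open>Clears the columns of the pivots found by the induction. The entry at
      \<open>p\<close> stays 1 because the rows \<open>R e\<close> lie in \<open>L'\<close> and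
      vanish there, so these rows need no correction either.\<close>
    define m where "m = l - (\<Sum>e\<in>?D. (\<lambda>x. l e * R e x))"
    have finD: "finite ?D"
      using psubset.hyps by simp
    have m_apply: "m x = l x - (\<Sum>e\<in>?D. l e * R e x)" for x
      by (simp add: m_def sum_fun_apply)
    have mL: "m \<in> L"
      unfolding m_def using L R(1) lL
      by (intro linear_subspace_diff linear_subspace_sum) (auto simp: linear_subspace_def L'_def)
    have mp: "m p = 1"
      using R(1) lp by (simp add: m_apply L'_def)
    have mD: "m e' = 0" if "e' \<in> ?D" for e'
    proof -
      have "(\<Sum>e\<in>?D. l e * R e e') = (\<Sum>e\<in>?D. if e = e' then l e else 0)"
        using that R(2) by (intro sum.cong) auto
      also have "\<dots> = l e'"
        using that finD by simp
      finally show ?thesis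
        by (simp add: m_apply)
    qed
    have mB: "w p \<le> v (m b) + w b" if b: "b \<in> B" for b
    proof -
      have "w p \<le> v (l e * R e b) + w b" if "e \<in> ?D" for e
      proof -
        have "w p \<le> v (l e) + w e"
          by (rule lw)
        also have "\<dots> \<le> v (l e) + (v (R e b) + w b)"
          by (intro add_left_mono R(3) that b)
        finally show ?thesis
          by (simp add: v_mult ac_simps)
      qed
      \<comment> \<open>The ultrametric inequality for this sum of scalars is obtained by viewing
        them as coefficients of one monomial with exponent \<open>b\<close>.\<close>
      have *: "w p \<le> trop_eval w (single b (- (\<Sum>e\<in>?D. l e * R e b)))"
      proof -
        have "w p \<le> trop_eval w (\<Sum>e\<in>?D. single b (- (l e * R e b)))"
          using w that \<open>\<And>e. e \<in> ?D \<Longrightarrow> w p \<le> v (l e * R e b) + w b\<close>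
          by (intro trop_eval_sum) (auto simp: trop_eval_single)
        moreover have "(\<Sum>e\<in>?D. single b (- (l e * R e b))) =
            single b (- (\<Sum>e\<in>?D. l e * R e b))"
          by (rule poly_mapping_eqI) (simp add: lookup_sum lookup_single when_def sum_negf)
        ultimately show ?thesis
          by simp
      qed
      have "w p \<le> min (trop_eval w (single b (l b)))
          (trop_eval w (single b (- (\<Sum>e\<in>?D. l e * R e b))))"
        using * lw[of b] w by (simp add: trop_eval_single)
      also have "\<dots> \<le> trop_eval w (single b (l b) +
          single b (- (\<Sum>e\<in>?D. l e * R e b)))"
        using w by (intro trop_eval_add) auto
      also have "\<dots> = v (m b) + w b"
        using w by (simp add: single_add[symmetric] m_apply trop_eval_single)
      finally show ?thesis .
    qed
    show ?thesis
    proof (intro exI[of _ B] exI[of _ "R(p := m)"] conjI ballI impI)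
      fix x assume x: "x \<in> L" "\<forall>e\<in>E - B. x e = 0"
      then show "x = 0"
        using EB by (intro ind[rule_format]) (auto simp: L'_def)
    next
      fix e assume "e \<in> E - B"
      then show "(R(p := m)) e \<in> L"
        using mL R(1) by (auto simp: EB L'_def)
      fix e' assume "e' \<in> E - B"
      with \<open>e \<in> E - B\<close> show "(R(p := m)) e e' = (if e' = e then 1 else 0)"
        unfolding EB using mp mD R(1,2) by (auto simp: L'_def)
    next
      fix e b assume "e \<in> E - B" "b \<in> B"
      then show "w e \<le> v ((R(p := m)) e b) + w b"
        unfolding EB using mB R(3) by auto
    qed (use B in auto)
  qed
qed

text \<open>The reduced rows are solved for their pivot coordinates, hence the sign in
  \<open>C\<close>. The columns of \<open>C\<close> annihilate \<open>L\<close> because an element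
  of \<open>L\<close> minus the matching combination of rows vanishes at all pivots and is therefore
  0.\<close>

lemma ex_basis_matrix:
  assumes fin: "finite E" and L: "linear_subspace L" and supp: "\<And>l e. l \<in> L \<Longrightarrow> e \<notin> E \<Longrightarrow> l e = 0"
    and w: "\<And>e. w e \<noteq> (-\<infinity>::ereal)"
  obtains B C where "basis_matrix E L B C" "\<And>e b. e \<in> E \<Longrightarrow> b \<in> B \<Longrightarrow> w e \<le> v (C e b) + w b"
proof -
  have "\<exists>B R. B \<subseteq> E \<and> (\<forall>e\<in>E - B. R e \<in> L \<and> (\<forall>e'\<in>E - B. R e e' = (if e' = e then 1 else 0)) \<and>
      (\<forall>b\<in>B. w e \<le> v (R e b) + w b)) \<and> (\<forall>l\<in>L. (\<forall>e\<in>E - B. l e = 0) \<longrightarrow> l = 0)"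
    by (rule pivoting) (use assms in auto)
  then obtain B R where B: "B \<subseteq> E" and
      R': "\<forall>e\<in>E - B. R e \<in> L \<and> (\<forall>e'\<in>E - B. R e e' = (if e' = e then 1 else 0)) \<and>
      (\<forall>b\<in>B. w e \<le> v (R e b) + w b)"
      and ind: "\<forall>l\<in>L. (\<forall>e\<in>E - B. l e = 0) \<longrightarrow> l = 0"
    by (elim exE conjE) (rule that)
  have R: "R e \<in> L" "e' \<in> E - B \<Longrightarrow> R e e' = (if e' = e then 1 else 0)"
    "b \<in> B \<Longrightarrow> w e \<le> v (R e b) + w b" if "e \<in> E - B" for e e' b
    using R' that by auto
  define C where "C e b = (if e \<in> B then (if e = b then 1 else 0) else - R e b)" for e b
  have "basis_matrix E L B C"
    unfolding basis_matrix_def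
  proof (intro conjI ballI)
    fix e assume e: "e \<in> E"
    show "(\<lambda>x. (if x = e then 1 else 0) - (if x \<in> B then C e x else 0)) \<in> L"
    proof (cases "e \<in> B")
      case True
      then have "(\<lambda>x. (if x = e then 1 else 0) - (if x \<in> B then C e x else 0)) = 0"
        by (auto simp: fun_eq_iff C_def)
      then show ?thesis
        using L by (simp add: linear_subspace_def)
    next
      case False
      then have "(\<lambda>x. (if x = e then 1 else 0) - (if x \<in> B then C e x else 0)) x = R e x" for x
        using e R(2)[of e x] supp[OF R(1), of e x] by (cases "x \<in> E") (auto simp: C_def)
      then have "(\<lambda>x. (if x = e then 1 else 0) - (if x \<in> B then C e x else 0)) = R e"
        by blast
      then show ?thesis
        using R(1) e False by simp
    qed
  next
    fix l b assume l: "l \<in> L" and b: "b \<in> B"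
    define d where "d = l - (\<Sum>e\<in>E - B. (\<lambda>x. l e * R e x))"
    have d_apply: "d x = l x - (\<Sum>e\<in>E - B. l e * R e x)" for x
      by (simp add: d_def sum_fun_apply)
    have "d \<in> L"
      unfolding d_def using L R(1) l
      by (intro linear_subspace_diff linear_subspace_sum) (auto simp: linear_subspace_def)
    moreover have "d e' = 0" if "e' \<in> E - B" for e'
    proof -
      have "(\<Sum>e\<in>E - B. l e * R e e') = (\<Sum>e\<in>E - B. if e = e' then l e else 0)"
        using that R(2) by (intro sum.cong) auto
      also have "\<dots> = l e'"
        using that fin by simp
      finally show ?thesis
        by (simp add: d_apply)
    qed
    ultimately have "d = 0"
      using ind by blast
    then have "l b = (\<Sum>e\<in>E - B. l e * R e b)"
      using d_apply[of b] by simp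
    moreover have "(\<Sum>e\<in>E. l e * C e b) = (\<Sum>e\<in>B. l e * C e b) + (\<Sum>e\<in>E - B. l e * C e b)"
      using fin B by (simp add: sum.subset_diff add.commute)
    moreover have "(\<Sum>e\<in>B. l e * C e b) = (\<Sum>e\<in>B. if e = b then l e else 0)"
      by (intro sum.cong) (auto simp: C_def)
    moreover have "(\<Sum>e\<in>E - B. l e * C e b) = - (\<Sum>e\<in>E - B. l e * R e b)"
      by (simp add: C_def sum_negf[symmetric])
    moreover have "finite B"
      using fin B finite_subset by blast
    ultimately show "(\<Sum>e\<in>E. l e * C e b) = 0"
      using b by simp
  qed (use B in \<open>auto simp: C_def\<close>)
  moreover have "w e \<le> v (C e b) + w b" if "e \<in> E" "b \<in> B" for e b
    using that R(3)[of e b] w[of b] by (auto simp: C_def)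
  ultimately show thesis
    by (rule that)
qed

end

section \<open>Leading terms of sums, products and powers\<close>

context valued_monoid
begin

lemma trop_eval_A_sum_less:
  assumes w: "w \<in> tropical_points S" and "\<And>i. i \<in> I \<Longrightarrow> f i \<in> A" "\<And>i. i \<in> I \<Longrightarrow> x < trop_eval w (f i)"
    and "x < \<infinity>"
  shows "x < trop_eval w (\<Sum>i\<in>I. f i)"
  using assms(2,3)
proof (induction I rule: infinite_finite_induct)
  case (insert i I)
  have "x < min (trop_eval w (f i)) (trop_eval w (\<Sum>i\<in>I. f i))"
    using insert by auto
  also have "\<dots> \<le> trop_eval w (f i + (\<Sum>i\<in>I. f i))"
    using insert.prems(1) by (intro trop_eval_A_add w A_sum) auto
  finally show ?case
    using insert.hyps by simp
qed (use assms(4) in auto)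

lemma sum_dominated:
  assumes w: "w \<in> tropical_points S" and I: "finite I" "i0 \<in> I" and g: "\<And>i. i \<in> I \<Longrightarrow> g i \<in> S"
    and fin: "v (c i0) + w (g i0) \<noteq> \<infinity>"
    and less: "\<And>i. i \<in> I - {i0} \<Longrightarrow> v (c i0) + w (g i0) < v (c i) + w (g i)"
  shows "dominated_by w (\<Sum>i\<in>I. single (g i) (c i)) (c i0) (g i0)"
proof -
  have "dominated_by w (single (g i0) (c i0) +
      (\<Sum>i\<in>I - {i0}. single (g i) (c i))) (c i0) (g i0)"
    using g I fin less
    by (intro add_dominated[OF w] dominated_by_single A_sum A_single trop_eval_A_sum_less[OF w])
      (auto simp: trop_eval_A_single[OF w])
  then show ?thesis
    using I by (simp add: sum.remove)
qed

lemma trop_eval_prod_dominated: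
  assumes w: "w \<in> tropical_points S" and "finite I" "\<And>i. i \<in> I \<Longrightarrow> \<exists>c u. dominated_by w (f i) c u"
  shows "trop_eval w (prod f I) = (\<Sum>i\<in>I. trop_eval w (f i))"
  using assms(2,3)
proof (induction I rule: finite_induct)
  case empty
  then show ?case
    using trop_eval_A_single[OF w zero_S, of 1] trop_pointsD(2)[OF w] by simp
next
  case (insert i I)
  obtain c u c' u' where "dominated_by w (f i) c u" "dominated_by w (prod f I) c' u'"
    using insert.prems prod_dominated[OF w, of I f] by (metis insertCI)
  then show ?case
    using insert trop_eval_mult_dominated[OF w] by simp
qed

lemma trop_eval_power_dominated:
  assumes w: "w \<in> tropical_points S" and "dominated_by w f c u"
  shows "trop_eval w (f ^ n) = (\<Sum>i<n. trop_eval w f)"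
  using trop_eval_prod_dominated[OF w, of "{..<n}" "\<lambda>_. f"] assms(2) by auto

lemma trop_eval_one: "w \<in> tropical_points S \<Longrightarrow> trop_eval w 1 = 0"
  using trop_eval_A_single[of w 0 1] zero_S trop_pointsD(2) by simp

lemma trop_eval_prod_ge:
  assumes w: "w \<in> tropical_points S" and "\<And>i. i \<in> I \<Longrightarrow> f i \<in> A"
  shows "(\<Sum>i\<in>I. trop_eval w (f i)) \<le> trop_eval w (prod f I)"
  using assms(2)
proof (induction I rule: infinite_finite_induct)
  case (insert i I)
  have "(\<Sum>i\<in>insert i I. trop_eval w (f i)) \<le> trop_eval w (f i) + trop_eval w (prod f I)"
    using insert by (simp add: add_left_mono)
  also have "\<dots> \<le> trop_eval w (f i * prod f I)"
    using insert.prems by (intro trop_eval_mult[OF w] A_prod) auto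
  finally show ?case
    using insert.hyps by simp
qed (auto simp: trop_eval_one[OF w])

lemma trop_eval_power_ge:
  assumes w: "w \<in> tropical_points S" and "f \<in> A"
  shows "(\<Sum>i<n. trop_eval w f) \<le> trop_eval w (f ^ n)"
  using trop_eval_prod_ge[OF w, of "{..<n}" "\<lambda>_. f"] assms(2) by simp

lemma trop_point_sum:
  assumes w: "w \<in> tropical_points S" and "\<And>i. i \<in> I \<Longrightarrow> g i \<in> S"
  shows "(\<Sum>i\<in>I. g i) \<in> S" "w (\<Sum>i\<in>I. g i) = (\<Sum>i\<in>I. w (g i))"
  using assms(2)
  by (induction I rule: infinite_finite_induct) (auto simp: zero_S add_S trop_pointsD[OF w])

end

section \<open>Charts of the Lawrence toric variety\<close>

text \<open>
  A chart given by a maximal cone with rays \<open>\<rho>\<^sub>e\<^sup>+\<close> (\<open>e \<in> P\<close>) and \<open>\<rho>\<^sub>e\<^sup>-\<close> (\<open>e \<in> Q\<close>): the maps \<open>p e\<close> and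
  \<open>q e\<close> are the pairings with \<open>\<rho>\<^sub>e\<^sup>+\<close> and \<open>\<rho>\<^sub>e\<^sup>-\<close>, and \<open>X e\<close> is the exponent of the coordinate \<open>x\<^sub>e\<close>.
\<close>

locale lawrence_chart = valued_monoid v S for v :: "'k::field \<Rightarrow> ereal" and S :: "'u::ab_group_add set" +
  fixes U :: "'u set" and E P Q :: "'e set" and p q :: "'e \<Rightarrow> 'u \<Rightarrow> int" and X :: "'e \<Rightarrow> 'u"
    and L :: "('e \<Rightarrow> 'k) set"
  assumes finE: "finite E"
    and U_zero: "0 \<in> U" and U_add: "\<And>a b. a \<in> U \<Longrightarrow> b \<in> U \<Longrightarrow> a + b \<in> U"
    and U_uminus: "\<And>a. a \<in> U \<Longrightarrow> - a \<in> U"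
    and p_add: "\<And>e a b. e \<in> E \<Longrightarrow> a \<in> U \<Longrightarrow> b \<in> U \<Longrightarrow> p e (a + b) = p e a + p e b"
    and q_add: "\<And>e a b. e \<in> E \<Longrightarrow> a \<in> U \<Longrightarrow> b \<in> U \<Longrightarrow> q e (a + b) = q e a + q e b"
    and pq_inj: "\<And>a b. a \<in> U \<Longrightarrow> b \<in> U \<Longrightarrow> (\<And>e. e \<in> E \<Longrightarrow> p e a = p e b \<and> q e a = q e b) \<Longrightarrow> a = b"
    and X_U: "\<And>e. e \<in> E \<Longrightarrow> X e \<in> U"
    and p_X: "\<And>e f. e \<in> E \<Longrightarrow> f \<in> E \<Longrightarrow> p e (X f) = (if e = f then 1 else 0)"
    and q_X: "\<And>e f. e \<in> E \<Longrightarrow> f \<in> E \<Longrightarrow> q e (X f) = (if e = f then 1 else 0)"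
    and PQ: "P \<union> Q = E"
    and S_eq: "S = {u \<in> U. (\<forall>e\<in>P. 0 \<le> p e u) \<and> (\<forall>e\<in>Q. 0 \<le> q e u)}"
    and L: "linear_subspace L" and L_supp: "\<And>l e. l \<in> L \<Longrightarrow> e \<notin> E \<Longrightarrow> l e = 0"
begin

lemma U_diff: "a \<in> U \<Longrightarrow> b \<in> U \<Longrightarrow> a - b \<in> U"
  using U_add[of a "- b"] U_uminus by simp

lemma p_zero: "e \<in> E \<Longrightarrow> p e 0 = 0" and q_zero: "e \<in> E \<Longrightarrow> q e 0 = 0"
  using p_add[of e 0 0] q_add[of e 0 0] U_zero by auto

lemma p_diff: "e \<in> E \<Longrightarrow> a \<in> U \<Longrightarrow> b \<in> U \<Longrightarrow> p e (a - b) = p e a - p e b"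
  using p_add[of e "a - b" b] U_diff[of a b] by simp

lemma q_diff: "e \<in> E \<Longrightarrow> a \<in> U \<Longrightarrow> b \<in> U \<Longrightarrow> q e (a - b) = q e a - q e b"
  using q_add[of e "a - b" b] U_diff[of a b] by simp

lemma U_sum: "(\<And>i. i \<in> I \<Longrightarrow> g i \<in> U) \<Longrightarrow> sum g I \<in> U"
  by (induction I rule: infinite_finite_induct) (auto intro: U_add U_zero)

lemma p_sum: "e \<in> E \<Longrightarrow> (\<And>i. i \<in> I \<Longrightarrow> g i \<in> U) \<Longrightarrow> p e (sum g I) = (\<Sum>i\<in>I. p e (g i))"
  by (induction I rule: infinite_finite_induct) (auto simp: p_zero p_add U_sum)

lemma q_sum: "e \<in> E \<Longrightarrow> (\<And>i. i \<in> I \<Longrightarrow> g i \<in> U) \<Longrightarrow> q e (sum g I) = (\<Sum>i\<in>I. q e (g i))"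
  by (induction I rule: infinite_finite_induct) (auto simp: q_zero q_add U_sum)

lemma S_U: "u \<in> S \<Longrightarrow> u \<in> U"
  by (simp add: S_eq)

lemma P_E: "e \<in> P \<Longrightarrow> e \<in> E" and Q_E: "e \<in> Q \<Longrightarrow> e \<in> E"
  using PQ by auto

text \<open>The exponent of the product of all x_e to the powers \<open>k e\<close>. Repeated sums
  stand in for multiples, so that a tropical point applied termwise gives a sum of the same shape,
  infinite values included.\<close>

definition xs :: "('e \<Rightarrow> nat) \<Rightarrow> 'u" where
  "xs k = (\<Sum>e\<in>E. \<Sum>i<k e. X e)"

lemma xs_U: "xs k \<in> U"
  unfolding xs_def by (intro U_sum X_U)

lemma p_xs: "e \<in> E \<Longrightarrow> p e (xs k) = int (k e)" and q_xs: "e \<in> E \<Longrightarrow> q e (xs k) = int (k e)"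
  unfolding xs_def using finE
  by (simp_all add: p_sum q_sum U_sum X_U p_X q_X if_distrib sum.delta cong: sum.cong if_cong)

lemma xs_S: "xs k \<in> S"
  using xs_U P_E Q_E by (auto simp: S_eq p_xs q_xs)

lemma xs_add: "xs (\<lambda>e. k e + l e) = xs k + xs l"
  by (rule pq_inj) (auto simp: xs_U U_add p_xs q_xs p_add q_add)

lemma X_eq_xs: "e \<in> E \<Longrightarrow> X e = xs (\<lambda>f. if f = e then 1 else 0)"
  by (rule pq_inj) (auto simp: xs_U X_U p_xs q_xs p_X q_X)

lemma X_S: "e \<in> E \<Longrightarrow> X e \<in> S"
  using xs_S by (simp add: X_eq_xs)

lemma X_inj: "inj_on X E"
proof (rule inj_onI)
  fix e f assume "e \<in> E" "f \<in> E" "X e = X f"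
  then show "e = f"
    using p_X[of e e] p_X[of e f] by (auto split: if_splits)
qed

lemma single_xs:
  "single (xs k) (1::'k) = (\<Prod>e\<in>E. single (X e) 1 ^ k e)"
proof -
  have pow: "single u (1::'k) ^ n = single (\<Sum>i<n. u) 1" for u :: 'u and n
    by (induction n) (simp_all add: mult_single add.commute)
  have "(\<Prod>e\<in>I. single (X e) 1 ^ k e) =
      single (\<Sum>e\<in>I. \<Sum>i<k e. X e) (1::'k)" for I
    by (induction I rule: infinite_finite_induct) (simp_all add: pow mult_single)
  then show ?thesis
    by (simp add: xs_def)
qed

lemma trop_xs:
  assumes w: "w \<in> tropical_points S"
  shows "w (xs k) = (\<Sum>e\<in>E. \<Sum>i<k e. w (X e))"
proof -
  have "(\<Sum>i<k e. X e) \<in> S" "w (\<Sum>i<k e. X e) = (\<Sum>i<k e. w (X e))" if "e \<in> E" for e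
    using trop_point_sum[OF w, of "{..<k e}" "\<lambda>_. X e"] X_S that by auto
  then show ?thesis
    unfolding xs_def by (subst trop_point_sum(2)[OF w]) auto
qed

text \<open>The largest exponents \<open>k\<close> with \<open>u - \<Sum>\<^sub>e k\<^sub>e X\<^sub>e \<in> S\<close>.\<close>

definition kap :: "'u \<Rightarrow> 'e \<Rightarrow> nat" where
  "kap u e = nat (if e \<in> P then if e \<in> Q then min (p e u) (q e u) else p e u else q e u)"

definition base :: "'u \<Rightarrow> 'u" where
  "base u = u - xs (kap u)"

lemma kap_int:
  assumes "u \<in> S" "e \<in> E"
  shows "int (kap u e) = (if e \<in> P then if e \<in> Q then min (p e u) (q e u) else p e u else q e u)"
  using assms PQ by (auto simp: kap_def S_eq)

lemma base_xs: "base u + xs (kap u) = u"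
  by (simp add: base_def)

lemma base_S:
  assumes u: "u \<in> S"
  shows "base u \<in> S"
proof -
  have "0 \<le> p e u - int (kap u e)" if "e \<in> P" for e
    using that P_E kap_int[OF u, of e] by auto
  moreover have "0 \<le> q e u - int (kap u e)" if "e \<in> Q" for e
    using that Q_E kap_int[OF u, of e] by auto
  ultimately show ?thesis
    using u P_E Q_E by (auto simp: S_eq base_def U_diff xs_U p_diff q_diff p_xs q_xs)
qed

lemma kap_add_xs:
  assumes u: "u \<in> S" and e: "e \<in> E"
  shows "kap (u + xs k) e = kap u e + k e"
proof -
  have "int (kap (u + xs k) e) = int (kap u e) + int (k e)"
    using e u by (subst (1 2) kap_int) (auto intro: add_S xs_S simp: p_add q_add S_U xs_U p_xs q_xs)
  then show ?thesis
    by linarith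
qed

text \<open>This is the rank-one statement for graded pieces. At equal degrees \<open>p\<close>,
  \<open>q\<close> and their minimum change by the same amount, so \<open>kap\<close> records
  exactly the offset that \<open>base\<close> subtracts.\<close>

lemma base_eqI:
  assumes u: "u \<in> S" "u' \<in> S" and deg: "\<And>e. e \<in> E \<Longrightarrow> p e u - q e u = p e u' - q e u'"
  shows "base u = base u'"
proof (rule pq_inj)
  fix e assume e: "e \<in> E"
  have "int (kap u e) - int (kap u' e) = p e u - p e u'"
    using deg[OF e] by (simp add: kap_int[OF _ e] u min_def)
  then show "p e (base u) = p e (base u') \<and> q e (base u) = q e (base u')"
    using e deg[OF e] u by (simp add: base_def p_diff q_diff S_U xs_U p_xs q_xs)
qed (use u base_S S_U in auto)

lemma base_add_xs:
  assumes "u \<in> S"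
  shows "base (u + xs k) = base u"
  using assms by (intro base_eqI) (auto intro: add_S xs_S simp: p_add q_add S_U xs_U p_xs q_xs)

lemma kap_X: "e \<in> E \<Longrightarrow> f \<in> E \<Longrightarrow> kap (X e) f = (if f = e then 1 else 0)"
  using kap_add_xs[OF zero_S, of f "\<lambda>f. if f = e then 1 else 0"] PQ
  by (auto simp: X_eq_xs kap_def p_zero q_zero)

definition lin :: "('e \<Rightarrow> 'k) \<Rightarrow> 'u \<Rightarrow>\<^sub>0 'k" where
  "lin l = (\<Sum>e\<in>E. single (X e) (l e))"

lemma lin_A: "lin l \<in> A"
  unfolding lin_def by (intro A_sum A_single X_S)

definition H :: "(('u \<Rightarrow>\<^sub>0 'k) \<Rightarrow> ereal) set" where
  "H = {\<nu> \<in> berkovich_points v S. \<forall>l\<in>L. \<nu> (lin l) = \<infinity>}"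

end

section \<open>Normal forms\<close>

locale lawrence_basis = lawrence_chart v S U E P Q p q X L
  for v :: "'k::field \<Rightarrow> ereal" and S :: "'u::ab_group_add set" and U E P Q p q
    and X :: "'e \<Rightarrow> 'u" and L +
  fixes B :: "'e set" and C :: "'e \<Rightarrow> 'e \<Rightarrow> 'k"
  assumes basis: "basis_matrix E L B C"
begin

lemma B_E: "b \<in> B \<Longrightarrow> b \<in> E" and B_subset: "B \<subseteq> E"
  using basis by (auto simp: basis_matrix_def)

lemma finB: "finite B"
  using finE B_subset by (rule finite_subset[rotated])

definition lf :: "'e \<Rightarrow> 'u \<Rightarrow>\<^sub>0 'k" where
  "lf e = (\<Sum>b\<in>B. single (X b) (C e b))"

lemma lf_A: "lf e \<in> A"
  unfolding lf_def by (intro A_sum A_single X_S B_E)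

lemma lf_basis:
  assumes "b \<in> B"
  shows "lf b = single (X b) 1"
proof -
  have "lf b = (\<Sum>b'\<in>B. if b' = b then single (X b) 1 else 0)"
    unfolding lf_def using assms basis by (intro sum.cong) (auto simp: basis_matrix_def)
  then show ?thesis
    using assms finB by simp
qed

definition lfs :: "('e \<Rightarrow> nat) \<Rightarrow> 'u \<Rightarrow>\<^sub>0 'k" where
  "lfs k = (\<Prod>e\<in>E. lf e ^ k e)"

lemma lfs_A: "lfs k \<in> A"
  unfolding lfs_def by (intro A_prod A_power lf_A)

lemma lfs_add: "lfs (\<lambda>e. k e + l e) = lfs k * lfs l"
  by (simp add: lfs_def power_add prod.distrib)

lemma lfs_cong: "(\<And>e. e \<in> E \<Longrightarrow> k e = l e) \<Longrightarrow> lfs k = lfs l"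
  by (simp add: lfs_def)

lemma lfs_zero: "lfs (\<lambda>_. 0) = 1"
  by (simp add: lfs_def)

lemma lfs_delta:
  assumes "e \<in> E"
  shows "lfs (\<lambda>f. if f = e then 1 else 0) = lf e"
proof -
  have "lfs (\<lambda>f. if f = e then 1 else 0) = (\<Prod>f\<in>E. if f = e then lf f else 1)"
    unfolding lfs_def by (intro prod.cong) auto
  then show ?thesis
    using assms finE by simp
qed

text \<open>The monomial is split into the lowest one of its degree and a product of coordinates;
  only the latter is rewritten in the basis.\<close>

definition nmono :: "'u \<Rightarrow> 'u \<Rightarrow>\<^sub>0 'k" where
  "nmono u = single (base u) 1 * lfs (kap u)"

lemma nmono_A: "u \<in> S \<Longrightarrow> nmono u \<in> A"
  unfolding nmono_def by (intro A_mult A_single base_S lfs_A)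

lemma nmono_add_xs:
  assumes "u \<in> S"
  shows "nmono (u + xs k) = lfs k * nmono u"
proof -
  have "lfs (kap (u + xs k)) = lfs (\<lambda>e. kap u e + k e)"
    using assms by (intro lfs_cong) (simp add: kap_add_xs)
  then show ?thesis
    using assms by (simp add: nmono_def base_add_xs lfs_add ac_simps)
qed

lemma nmono_zero: "nmono 0 = 1"
proof -
  have "lfs (kap 0) = lfs (\<lambda>_. 0)"
    using PQ by (intro lfs_cong) (auto simp: kap_def p_zero q_zero)
  moreover have "base 0 = 0"
    using base_add_xs[OF zero_S, of "kap 0"] PQ xs_def
    by (auto simp: base_def kap_def p_zero q_zero)
  ultimately show ?thesis
    by (simp add: nmono_def lfs_zero)
qed

lemma nmono_X: "e \<in> E \<Longrightarrow> nmono (X e) = lf e"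
  using nmono_add_xs[OF zero_S, of "\<lambda>f. if f = e then 1 else 0"]
  by (simp add: nmono_zero X_eq_xs[symmetric] lfs_delta)

definition nf :: "('u \<Rightarrow>\<^sub>0 'k) \<Rightarrow> 'u \<Rightarrow>\<^sub>0 'k" where
  "nf f = (\<Sum>u\<in>keys f. single 0 (lookup f u) * nmono u)"

lemma nf_superset:
  assumes "finite T" "keys f \<subseteq> T"
  shows "nf f = (\<Sum>u\<in>T. single 0 (lookup f u) * nmono u)"
  unfolding nf_def using assms by (intro sum.mono_neutral_left) (auto simp: in_keys_iff)

lemma nf_zero: "nf 0 = 0"
  by (simp add: nf_def)

lemma nf_single: "nf (single u c) = single 0 c * nmono u"
  by (subst nf_superset[of "{u}"]) auto

lemma nf_add: "nf (f + g) = nf f + nf g"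
proof -
  let ?T = "keys f \<union> keys g"
  have "nf h = (\<Sum>u\<in>?T. single 0 (lookup h u) * nmono u)"
    if "keys h \<subseteq> ?T" for h
    using that by (intro nf_superset) auto
  from this[of "f + g"] this[of f] this[of g] show ?thesis
    using keys_add[of f g] by (simp add: lookup_add single_add distrib_right sum.distrib)
qed

lemma nf_sum: "nf (\<Sum>i\<in>I. f i) = (\<Sum>i\<in>I. nf (f i))"
  by (induction I rule: infinite_finite_induct) (auto simp: nf_zero nf_add)

lemma nf_cmult: "nf (single 0 c * f) = single 0 c * nf f"
proof -
  have "single 0 c * f =
      (\<Sum>u\<in>keys f. single u (c * lookup f u))"
    by (subst (1) sum_monomials[symmetric]) (simp add: sum_distrib_left mult_single)
  moreover have "single 0 (c * d) * nmono u =
      single 0 c * (single 0 d * nmono u)" for u d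
    by (simp add: mult.assoc[symmetric] mult_single)
  ultimately show ?thesis
    by (simp add: nf_sum nf_single nf_def[of f] sum_distrib_left)
qed

lemma nf_A: "f \<in> A \<Longrightarrow> nf f \<in> A"
  unfolding nf_def by (intro A_sum A_mult A_single nmono_A zero_S) (auto simp: A_iff)

lemma nf_xs_mult:
  assumes f: "f \<in> A"
  shows "nf (single (xs k) 1 * f) = lfs k * nf f"
proof -
  have "single (xs k) 1 * f =
      (\<Sum>u\<in>keys f. single (u + xs k) (lookup f u))"
    by (subst (1) sum_monomials[symmetric]) (simp add: sum_distrib_left mult_single add.commute)
  moreover have "nmono (u + xs k) = lfs k * nmono u" if "u \<in> keys f" for u
    using that f by (intro nmono_add_xs) (auto simp: A_iff)
  ultimately show ?thesis
    by (simp only:) (simp add: nf_sum nf_single nf_def[of f] sum_distrib_left mult.left_commute cong: sum.cong)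
qed

text \<open>\<open>lf e\<close> involves only coordinates x_b with \<open>b\<close> in
  \<open>B\<close>, which the rewriting leaves fixed, so it can be pulled out of
  \<open>nf\<close>.\<close>

lemma nf_lf_mult:
  assumes f: "f \<in> A"
  shows "nf (lf e * f) = lf e * nf f"
proof -
  have "nf (single (X b) c * f) = single (X b) c * nf f" if b: "b \<in> B" for b c
  proof -
    have "single (X b) c * f = single 0 c * (single (X b) 1 * f)"
      by (simp add: mult.assoc[symmetric] mult_single)
    moreover have "nf (single (X b) 1 * f) = single (X b) 1 * nf f"
      using nf_xs_mult[OF f, of "\<lambda>f. if f = b then 1 else 0"] b B_E[OF b]
      by (simp add: X_eq_xs[symmetric] lfs_delta lf_basis)
    moreover have "single (X b) c * nf f = single 0 c * (single (X b) 1 * nf f)"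
      by (simp add: mult.assoc[symmetric] mult_single)
    ultimately show ?thesis
      by (simp add: nf_cmult)
  qed
  then show ?thesis
    by (simp add: lf_def sum_distrib_right nf_sum)
qed

lemma nf_lfs_mult:
  assumes f: "f \<in> A"
  shows "nf (lfs k * f) = lfs k * nf f"
proof -
  have pow: "nf (lf e ^ n * g) = lf e ^ n * nf g" if "g \<in> A" for e n g
    using that
    by (induction n) (simp_all add: mult.assoc nf_lf_mult A_mult A_power lf_A)
  have "nf ((\<Prod>e\<in>I. lf e ^ k e) * f) = (\<Prod>e\<in>I. lf e ^ k e) * nf f" for I
    by (induction I rule: infinite_finite_induct)
      (use f in \<open>simp_all add: mult.assoc pow A_mult A_prod A_power lf_A\<close>)
  then show ?thesis
    by (simp add: lfs_def)
qed

text \<open>The sum of two bases need not be a base, since opposite degrees combine to powers of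
  coordinates. The outer \<open>nf\<close> takes care of these: all linear factors are pulled out
  first, and what remains is the normal form of a single monomial.\<close>

lemma nf_nmono_mult:
  assumes u: "u \<in> S" and u': "u' \<in> S"
  shows "nf (nmono u * nmono u') = nmono (u + u')"
proof -
  have "nmono u * nmono u' = lfs (kap u) * (lfs (kap u') * single (base u + base u') 1)"
  proof -
    have "single (base u + base u') (1::'k) = single (base u) 1 * single (base u') 1"
      by (simp add: mult_single)
    then show ?thesis
      by (simp only: nmono_def ac_simps)
  qed
  then have "nf (nmono u * nmono u') = lfs (kap u) * (lfs (kap u') * nmono (base u + base u'))"
    using u u' by (simp add: nf_lfs_mult A_mult lfs_A A_single base_S add_S nf_single)
  also have "\<dots> = nmono ((base u + base u') + xs (kap u') + xs (kap u))"
    using u u' by (simp add: nmono_add_xs base_S add_S xs_S)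
  also have "(base u + base u') + xs (kap u') + xs (kap u) = (base u + xs (kap u)) + (base u' + xs (kap u'))"
    by (simp add: ac_simps)
  finally show ?thesis
    by (simp add: base_xs)
qed

lemma nf_mult:
  assumes f: "f \<in> A" and g: "g \<in> A"
  shows "nf (nf f * nf g) = nf (f * g)"
proof -
  have "nf f * nf g = (\<Sum>a\<in>keys f. \<Sum>b\<in>keys g.
      single 0 (lookup f a * lookup g b) * (nmono a * nmono b))"
  proof -
    have "(single 0 x * nmono a) * (single 0 y * nmono b) =
        single 0 (x * y) * (nmono a * nmono b)" for x y a b
    proof -
      have "single (0::'u) (x * y) = single 0 x * single 0 y"
        by (simp add: mult_single)
      then show ?thesis
        by (simp only: ac_simps)
    qed
    then show ?thesis
      by (simp only: nf_def sum_product)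
  qed
  moreover have "f * g = (\<Sum>a\<in>keys f. \<Sum>b\<in>keys g.
      single (a + b) (lookup f a * lookup g b))"
    by (subst (1 2) sum_monomials[symmetric]) (simp add: sum_product mult_single)
  ultimately show ?thesis
    using f g by (simp add: nf_sum nf_cmult nf_single nf_nmono_mult A_keysD cong: sum.cong)
qed

text \<open>Exponents of normal monomials: no x_e with \<open>e\<close> outside \<open>B\<close>
  divides them.\<close>

definition SB :: "'u set" where
  "SB = {u \<in> S. \<forall>e\<in>E - B. kap u e = 0}"

definition XB :: "'u set" where
  "XB = {xs k | k. \<forall>e\<in>E - B. k e = 0}"

lemma keys_lfs: "keys (lfs k) \<subseteq> XB"
proof -
  \<comment> \<open>Closure of the polynomials with exponents in \<open>XB\<close> under sums,
    products and powers then comes from the general facts on monoid algebras.\<close>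
  interpret XB: valued_monoid v XB
  proof
    show "0 \<in> XB"
      unfolding XB_def by (intro CollectI exI[of _ "\<lambda>_. 0"]) (simp add: xs_def)
    fix a b assume "a \<in> XB" "b \<in> XB"
    then obtain k l where "a = xs k" "b = xs l" "\<forall>e\<in>E - B. k e = 0" "\<forall>e\<in>E - B. l e = 0"
      by (auto simp: XB_def)
    then show "a + b \<in> XB"
      unfolding XB_def by (intro CollectI exI[of _ "\<lambda>e. k e + l e"]) (simp add: xs_add)
  qed
  have "X b \<in> XB" if "b \<in> B" for b
    unfolding XB_def using that B_E[OF that] by (intro CollectI exI conjI) (rule X_eq_xs, auto)
  then have "lfs k \<in> XB.A"
    unfolding lfs_def lf_def by (intro XB.A_prod XB.A_power XB.A_sum XB.A_single)
  then show ?thesis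
    by (simp add: XB.A_iff)
qed

lemma keys_nmono:
  assumes "u \<in> S"
  shows "keys (nmono u) \<subseteq> SB"
proof
  fix a assume "a \<in> keys (nmono u)"
  then obtain k where k: "a = base u + xs k" "\<forall>e\<in>E - B. k e = 0"
    using keys_mult[of "single (base u) 1" "lfs (kap u)"] keys_lfs[of "kap u"]
    by (fastforce simp: nmono_def XB_def)
  have "kap (base u) e = 0" if "e \<in> E" for e
    using kap_add_xs[OF base_S[OF assms] that, of "kap u"] by (simp add: base_xs)
  with k show "a \<in> SB"
    using assms by (auto simp: SB_def kap_add_xs base_S add_S xs_S)
qed

lemma keys_nf:
  assumes "f \<in> A"
  shows "keys (nf f) \<subseteq> SB"
proof -
  have "keys (single 0 c * nmono u) \<subseteq> SB" if "u \<in> keys f" for u c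
    using that assms keys_nmono[of u] keys_mult[of "single 0 c" "nmono u"]
    by (fastforce simp: A_iff split: if_splits)
  then show ?thesis
    unfolding nf_def using keys_sum by fastforce
qed

lemma H_X_minus_lf:
  assumes \<nu>: "\<nu> \<in> H"
  shows "e \<in> E \<Longrightarrow> \<nu> (single (X e) 1 - lf e) = \<infinity>"
proof -
  assume e: "e \<in> E"
  let ?l = "\<lambda>x. (if x = e then 1 else 0) - (if x \<in> B then C e x else 0)"
  have "?l \<in> L"
    using basis e by (auto simp: basis_matrix_def)
  with \<nu> have "\<nu> (lin ?l) = \<infinity>"
    unfolding H_def by blast
  moreover have "lin ?l = (\<Sum>x\<in>E. if x = e then single (X x) 1 else 0) -
      (\<Sum>x\<in>E. if x \<in> B then single (X x) (C e x) else 0)"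
    unfolding lin_def sum_subtractf[symmetric] by (intro sum.cong) (auto simp: single_diff)
  moreover have "(\<Sum>x\<in>E. if x = e then single (X x) (1::'k) else 0) = single (X e) 1"
    using finE e by simp
  moreover have "(\<Sum>x\<in>E. if x \<in> B then single (X x) (C e x) else 0) = lf e"
    unfolding lf_def using finE B_subset by (simp add: sum.inter_restrict[symmetric] Int_absorb1)
  ultimately show ?thesis
    by simp
qed

text \<open>The kernel of \<open>\<nu>\<close> contains every x_e - \<open>lf e\<close>, and
  congruence modulo it is compatible with sums and products, so rewriting stays within a congruence
  class.\<close>

lemma H_nf:
  assumes \<nu>H: "\<nu> \<in> H" and f: "f \<in> A"
  shows "\<nu> (nf f) = \<nu> f"
proof -
  have \<nu>: "\<nu> \<in> berkovich_points v S"
    using \<nu>H by (simp add: H_def)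
  define eqv where "eqv a b \<longleftrightarrow> a \<in> A \<and> b \<in> A \<and> \<nu> (a - b) = \<infinity>" for a b
  have eqv_refl: "eqv a a" if "a \<in> A" for a
    using that by (simp add: eqv_def berkovich_simps[OF \<nu>])
  have eqv_add: "eqv (a + c) (b + d)" if "eqv a b" "eqv c d" for a b c d
  proof -
    have "min (\<nu> (a - b)) (\<nu> (c - d)) \<le> \<nu> ((a - b) + (c - d))"
      using that by (intro berkovich_pointsD[OF \<nu>] A_diff) (auto simp: eqv_def)
    moreover have "(a - b) + (c - d) = (a + c) - (b + d)"
      by simp
    ultimately show ?thesis
      using that by (simp add: eqv_def A_add)
  qed
  have eqv_mult: "eqv (a * c) (b * d)" if ab: "eqv a b" and cd: "eqv c d" for a b c d
  proof -
    have m: "a \<in> A" "b \<in> A" "c \<in> A" "d \<in> A" "a - b \<in> A" "c - d \<in> A"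
      using ab cd by (auto simp: eqv_def A_diff)
    have "min (\<nu> ((a - b) * c)) (\<nu> (b * (c - d))) \<le> \<nu> ((a - b) * c + b * (c - d))"
      by (intro berkovich_pointsD[OF \<nu>] A_mult m)
    moreover have "\<nu> ((a - b) * c) = \<infinity>" "\<nu> (b * (c - d)) = \<infinity>"
      using ab cd by (simp_all add: berkovich_pointsD(3)[OF \<nu>] m eqv_def)
    moreover have "(a - b) * c + b * (c - d) = a * c - b * d"
      by (simp add: algebra_simps)
    ultimately show ?thesis
      using m by (simp add: eqv_def A_mult)
  qed
  have eqv_power: "eqv (a ^ n) (b ^ n)" if "eqv a b" for a b n
    using that by (induction n) (auto intro: eqv_mult eqv_refl)
  have eqv_prod: "eqv (prod g I) (prod h I)" if "\<And>i. i \<in> I \<Longrightarrow> eqv (g i) (h i)" for g h and I :: "'e set"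
    using that by (induction I rule: infinite_finite_induct) (auto intro: eqv_mult eqv_refl)
  have eqv_sum: "eqv (sum g I) (sum h I)" if "\<And>i. i \<in> I \<Longrightarrow> eqv (g i) (h i)" for g h and I :: "'u set"
    using that by (induction I rule: infinite_finite_induct) (auto intro: eqv_add eqv_refl)
  have eqv_lf: "eqv (lf e) (single (X e) 1)" if "e \<in> E" for e
    using H_X_minus_lf[OF \<nu>H that] berkovich_simps(3)[OF \<nu>, of "single (X e) 1 - lf e"] that
    by (simp add: eqv_def lf_A A_single X_S A_diff)
  have eqv_nmono: "eqv (nmono u) (single u 1)" if u: "u \<in> S" for u
  proof -
    have "eqv (nmono u) (single (base u) 1 * single (xs (kap u)) 1)"
      unfolding nmono_def single_xs lfs_def
      by (intro eqv_mult eqv_prod eqv_power eqv_lf eqv_refl A_single base_S u)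
    then show ?thesis
      by (simp add: mult_single base_xs)
  qed
  have "eqv (nf f) (\<Sum>u\<in>keys f. single 0 (lookup f u) * single u 1)"
    unfolding nf_def using f by (intro eqv_sum eqv_mult eqv_refl eqv_nmono A_single zero_S) (auto simp: A_iff)
  then have "eqv (nf f) f"
    by (simp add: mult_single sum_monomials)
  then show ?thesis
    by (intro berkovich_cong_inf[OF \<nu>]) (auto simp: eqv_def)
qed

end

section \<open>Perturbed tropical points\<close>

context valued_monoid
begin

text \<open>Since \<open>\<alpha>\<close> is real, infinite values stay infinite and the ray never
  leaves the boundary stratum of \<open>w\<close>.\<close>

definition shift :: "('u \<Rightarrow> real) \<Rightarrow> ('u \<Rightarrow> ereal) \<Rightarrow> real \<Rightarrow> 'u \<Rightarrow> ereal" where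
  "shift \<alpha> w t = (\<lambda>u\<in>S. w u + ereal (t * \<alpha> u))"

lemma shift_points:
  assumes w: "w \<in> tropical_points S" and \<alpha>: "\<And>a b. a \<in> S \<Longrightarrow> b \<in> S \<Longrightarrow> \<alpha> (a + b) = \<alpha> a + \<alpha> b"
  shows "shift \<alpha> w t \<in> tropical_points S"
proof -
  have "\<alpha> 0 = 0"
    using \<alpha>[of 0 0] zero_S by simp
  moreover have "w u + w u' + ereal (t * (\<alpha> u + \<alpha> u')) =
      w u + ereal (t * \<alpha> u) + (w u' + ereal (t * \<alpha> u'))" for u u'
  proof -
    have "ereal (t * (\<alpha> u + \<alpha> u')) = ereal (t * \<alpha> u) + ereal (t * \<alpha> u')"
      by (simp add: distrib_left)
    then show ?thesis
      by (simp only: ac_simps)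
  qed
  ultimately show ?thesis
    using trop_pointsD[OF w] \<alpha> by (auto simp: tropical_points_def shift_def zero_S add_S)
qed

lemma tendsto_shift:
  assumes w: "w \<in> tropical_points S" and u: "u \<in> S"
  shows "((\<lambda>t. shift \<alpha> w t u) \<longlongrightarrow> w u) (at_right 0)"
proof -
  have "((\<lambda>t. t * \<alpha> u) \<longlongrightarrow> 0 * \<alpha> u) (at_right 0)"
    by (intro tendsto_intros)
  then have "((\<lambda>t. w u + ereal (t * \<alpha> u)) \<longlongrightarrow> w u + ereal 0) (at_right 0)"
    using trop_pointsD(1)[OF w u] by (intro tendsto_add_ereal_nonneg tendsto_intros) (auto simp: zero_ereal_def)
  then show ?thesis
    using u by (simp add: shift_def zero_ereal_def[symmetric])
qed

lemma tendsto_trop_eval: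
  assumes f: "f \<in> A" and w: "\<And>u. u \<in> S \<Longrightarrow> w u \<noteq> -\<infinity>" and lim: "\<And>u. u \<in> S \<Longrightarrow> ((\<lambda>t. W t u) \<longlongrightarrow> w u) net"
  shows "((\<lambda>t. trop_eval (W t) f) \<longlongrightarrow> trop_eval w f) net"
  unfolding trop_eval_def using f
  by (intro tendsto_INF_finite tendsto_add_ereal_nonneg tendsto_const lim w) (auto simp: A_iff)

lemma trop_eval_inf_iff:
  assumes "f \<in> A" "w \<in> tropical_points S"
  shows "trop_eval w f = \<infinity> \<longleftrightarrow> (\<forall>u\<in>keys f. w u = \<infinity>)"
proof -
  have "trop_eval w f = \<infinity> \<longleftrightarrow> \<infinity> \<le> trop_eval w f"
    by simp
  also have "\<dots> \<longleftrightarrow> (\<forall>u\<in>keys f. w u = \<infinity>)"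
    unfolding le_trop_eval_iff by (auto simp: in_keys_iff)
  finally show ?thesis .
qed

lemma shift_inf_iff: "u \<in> S \<Longrightarrow> shift \<alpha> w t u = \<infinity> \<longleftrightarrow> w u = \<infinity>"
  by (simp add: shift_def)

lemma trop_eval_shift_inf_iff:
  assumes "f \<in> A" "w \<in> tropical_points S" "shift \<alpha> w t \<in> tropical_points S"
  shows "trop_eval (shift \<alpha> w t) f = \<infinity> \<longleftrightarrow> trop_eval w f = \<infinity>"
  using assms A_keysD[OF assms(1)] by (simp add: trop_eval_inf_iff shift_inf_iff cong: ball_cong)

text \<open>Injectivity of \<open>\<alpha>\<close> on the support breaks all ties between terms of
  least value.\<close>

lemma eventually_shift_dominated:
  assumes w: "w \<in> tropical_points S" and \<alpha>: "\<And>a b. a \<in> S \<Longrightarrow> b \<in> S \<Longrightarrow> \<alpha> (a + b) = \<alpha> a + \<alpha> b"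
    and f: "f \<in> A" and fin: "trop_eval w f \<noteq> \<infinity>" and inj: "inj_on \<alpha> (keys f)"
  shows "\<forall>\<^sub>F t in at_right 0. \<exists>c u. dominated_by (shift \<alpha> w t) f c u"
proof -
  obtain u1 where u1: "u1 \<in> keys f" "v (lookup f u1) + w u1 \<noteq> \<infinity>"
    using trop_eval_attained[OF fin] fin by metis
  obtain u0 where u0: "u0 \<in> keys f" "v (lookup f u0) + w u0 \<noteq> \<infinity>" and
    ev: "\<forall>\<^sub>F t in at_right 0. \<forall>u\<in>keys f - {u0}.
      (v (lookup f u0) + w u0) + ereal (t * \<alpha> u0) < (v (lookup f u) + w u) + ereal (t * \<alpha> u)"
    by (rule eventually_unique_min[where I = "keys f" and \<alpha> = \<alpha> and i = u1
          and x = "\<lambda>u. v (lookup f u) + w u"])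
      (use f inj u1 trop_pointsD(1)[OF w] in \<open>auto simp: A_iff\<close>)
  from ev show ?thesis
  proof eventually_elim
    case (elim t)
    have "dominated_by (shift \<alpha> w t)
        (\<Sum>u\<in>keys f. single u (lookup f u)) (lookup f u0) u0"
      using f u0 elim
      by (intro sum_dominated[where g = "\<lambda>u. u"] shift_points w \<alpha>) (auto simp: A_iff shift_def subset_iff ac_simps)
    then show ?case
      by (auto simp: sum_monomials)
  qed
qed

end

section \<open>Multiplicativity of the normal form value at good points\<close>

context lawrence_basis
begin

text \<open>For such \<open>w\<close> the monomial valuation of \<open>K[x\<^sub>b | b \<in> B]\<close> with weights \<open>w\<close> takes the value \<open>w\<close> at every \<open>x\<^sub>e\<close>.\<close>

definition good :: "('u \<Rightarrow> ereal) \<Rightarrow> bool" where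
  "good w \<longleftrightarrow> w \<in> tropical_points S \<and> (\<forall>e\<in>E. trop_eval w (lf e) = w (X e))"

lemma goodD: "good w \<Longrightarrow> w \<in> tropical_points S" "good w \<Longrightarrow> e \<in> E \<Longrightarrow> trop_eval w (lf e) = w (X e)"
  by (auto simp: good_def)

lemma trop_base_kap:
  assumes w: "w \<in> tropical_points S" and u: "u \<in> S"
  shows "w u = w (base u) + (\<Sum>e\<in>E. \<Sum>i<kap u e. w (X e))"
proof -
  have "w (base u + xs (kap u)) = w (base u) + w (xs (kap u))"
    by (intro trop_pointsD[OF w] base_S u xs_S)
  then show ?thesis
    by (simp add: base_xs trop_xs[OF w])
qed

text \<open>At a good point the substituted form \<open>lf e\<close> has the same value as x_e, and
  values of products are superadditive.\<close>

lemma trop_eval_nmono_ge: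
  assumes w: "good w" and u: "u \<in> S"
  shows "w u \<le> trop_eval w (nmono u)"
proof -
  note wt = goodD(1)[OF w]
  have "w u = w (base u) + (\<Sum>e\<in>E. \<Sum>i<kap u e. trop_eval w (lf e))"
    using trop_base_kap[OF wt u] goodD(2)[OF w] by simp
  also have "\<dots> \<le> trop_eval w (single (base u) 1) + (\<Sum>e\<in>E. trop_eval w (lf e ^ kap u e))"
    by (intro add_mono sum_mono trop_eval_power_ge wt lf_A) (simp add: trop_eval_A_single wt base_S u)
  also have "\<dots> \<le> trop_eval w (single (base u) 1) + trop_eval w (lfs (kap u))"
    unfolding lfs_def by (intro add_left_mono trop_eval_prod_ge wt A_power lf_A)
  also have "\<dots> \<le> trop_eval w (nmono u)"
    unfolding nmono_def by (intro trop_eval_mult wt A_single base_S u lfs_A)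
  finally show ?thesis .
qed

lemma trop_eval_nf_ge:
  assumes w: "good w" and f: "f \<in> A"
  shows "trop_eval w f \<le> trop_eval w (nf f)"
  unfolding nf_def
proof (rule trop_eval_A_sum)
  note wt = goodD(1)[OF w]
  fix u assume u: "u \<in> keys f"
  then have uS: "u \<in> S"
    using f by (auto simp: A_iff)
  show "single 0 (lookup f u) * nmono u \<in> A"
    by (intro A_mult A_single zero_S nmono_A uS)
  have "trop_eval w f \<le> v (lookup f u) + w u"
    by (rule trop_eval_le[OF u])
  also have "\<dots> \<le> trop_eval w (single 0 (lookup f u)) + trop_eval w (nmono u)"
    using trop_eval_nmono_ge[OF w uS] by (intro add_mono) (simp_all add: trop_eval_A_single wt zero_S trop_pointsD[OF wt])
  also have "\<dots> \<le> trop_eval w (single 0 (lookup f u) * nmono u)"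
    by (intro trop_eval_mult wt A_single zero_S nmono_A uS)
  finally show "trop_eval w f \<le> trop_eval w (single 0 (lookup f u) * nmono u)" .
qed (rule goodD[OF w])

lemma trop_eval_nf_mult_ge:
  assumes w: "good w" and f: "f \<in> A" and g: "g \<in> A"
  shows "trop_eval w (nf f) + trop_eval w (nf g) \<le> trop_eval w (nf (f * g))"
proof -
  have "trop_eval w (nf f) + trop_eval w (nf g) \<le> trop_eval w (nf f * nf g)"
    by (intro trop_eval_mult goodD[OF w] nf_A f g)
  also have "\<dots> \<le> trop_eval w (nf (nf f * nf g))"
    by (intro trop_eval_nf_ge w A_mult nf_A f g)
  finally show ?thesis
    by (simp add: nf_mult f g)
qed

text \<open>Only coordinates of finite value are constrained: where \<open>w (X e)\<close> is
  \<infinity>, goodness gives \<open>lf e\<close> the value \<infinity>, which excludes a dominant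
  term.\<close>

definition generic :: "('u \<Rightarrow> ereal) \<Rightarrow> bool" where
  "generic w \<longleftrightarrow> good w \<and> (\<forall>e\<in>E. w (X e) \<noteq> \<infinity> \<longrightarrow> (\<exists>c u. dominated_by w (lf e) c u))"

text \<open>All factors of \<open>nmono u\<close> have a leading term, and the values of such
  factors add up exactly.\<close>

lemma nmono_generic:
  assumes w: "generic w" and u: "u \<in> S" and fin: "w u \<noteq> \<infinity>"
  shows "\<exists>c a. dominated_by w (nmono u) c a" "trop_eval w (nmono u) = w u"
proof -
  have gw: "good w"
    using w by (simp add: generic_def)
  note wt = goodD(1)[OF gw]
  \<comment> \<open>If \<open>w u\<close> is finite, every coordinate that actually divides the
    monomial has finite value, so genericity applies to it.\<close>
  have finX: "w (X e) \<noteq> \<infinity>" if "e \<in> E" "kap u e \<noteq> 0" for e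
  proof
    assume "w (X e) = \<infinity>"
    then have "(\<Sum>i<kap u e. w (X e)) = \<infinity>"
      using that by (subst sum_Pinfty) auto
    then have "(\<Sum>e\<in>E. \<Sum>i<kap u e. w (X e)) = \<infinity>"
      using that(1) finE by (subst sum_Pinfty) auto
    with fin show False
      using trop_base_kap[OF wt u] by simp
  qed
  have pow: "(\<exists>c a. dominated_by w (lf e ^ kap u e) c a) \<and>
      trop_eval w (lf e ^ kap u e) = (\<Sum>i<kap u e. w (X e))" if e: "e \<in> E" for e
  proof (cases "kap u e = 0")
    case True
    then show ?thesis
      using dominated_by_single[OF zero_S, of 1 w] trop_pointsD(2)[OF wt] by (auto simp: trop_eval_one[OF wt])
  next
    case False
    with finX e w obtain c a where d: "dominated_by w (lf e) c a"
      by (auto simp: generic_def)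
    show ?thesis
      using power_dominated[OF wt d] trop_eval_power_dominated[OF wt d] goodD(2)[OF gw e] by simp
  qed
  have "w (base u) \<noteq> \<infinity>"
    using fin trop_base_kap[OF wt u] by auto
  then have d1: "dominated_by w (single (base u) 1) 1 (base u)"
    by (intro dominated_by_single base_S u) simp
  obtain c a where d2: "dominated_by w (lfs (kap u)) c a"
    using prod_dominated[OF wt, of E "\<lambda>e. lf e ^ kap u e"] pow by (auto simp: lfs_def)
  show "\<exists>c a. dominated_by w (nmono u) c a"
    unfolding nmono_def using mult_dominated[OF wt d1 d2] by blast
  have "trop_eval w (nmono u) = w (base u) + trop_eval w (lfs (kap u))"
    unfolding nmono_def using trop_eval_mult_dominated[OF wt d1 d2]
    by (simp add: trop_eval_A_single wt base_S u)
  also have "trop_eval w (lfs (kap u)) = (\<Sum>e\<in>E. \<Sum>i<kap u e. w (X e))"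
    unfolding lfs_def using pow finE by (subst trop_eval_prod_dominated[OF wt]) auto
  finally show "trop_eval w (nmono u) = w u"
    by (simp add: trop_base_kap[OF wt u])
qed

text \<open>The leading monomial of \<open>nf f * nf g\<close> is rewritten to a polynomial with a
  leading term of the same value, and by goodness rewriting does not lower the value of the
  remainder. So nothing can cancel that leading term.\<close>

lemma nf_mult_generic:
  assumes w: "generic w" and f: "f \<in> A" and g: "g \<in> A"
    and df: "dominated_by w (nf f) c u" and dg: "dominated_by w (nf g) c' u'"
  shows "trop_eval w (nf (f * g)) = trop_eval w (nf f) + trop_eval w (nf g)"
proof -
  have gw: "good w"
    using w by (simp add: generic_def)
  note wt = goodD(1)[OF gw]
  let ?s = "single (u + u') (c * c')"
  have d: "dominated_by w (nf f * nf g) (c * c') (u + u')"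
    by (rule mult_dominated[OF wt df dg])
  then have uS: "u + u' \<in> S" and FA: "nf f * nf g \<in> A"
    by (auto simp: dominated_by_def)
  have fin: "v (c * c') + w (u + u') \<noteq> \<infinity>"
    using dominated_by_finite[OF d] .
  obtain c0 a where d0: "dominated_by w (nmono (u + u')) c0 a"
    using nmono_generic(1)[OF w uS] fin by auto
  have val: "v c0 + w a = w (u + u')"
    using dominated_by_eval[OF wt d0] nmono_generic(2)[OF w uS] fin by auto
  have eq: "v (c * c' * c0) + w (0 + a) = v (c * c') + w (u + u')"
    by (simp add: v_mult val[symmetric] ac_simps)
  have "dominated_by w (single 0 (c * c')) (c * c') 0"
    using fin trop_pointsD(2)[OF wt] by (intro dominated_by_single zero_S) auto
  then have d1: "dominated_by w (nf ?s) (c * c' * c0) (0 + a)"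
    unfolding nf_single by (intro mult_dominated wt d0)
  have "v (c * c' * c0) + w (0 + a) < trop_eval w (nf f * nf g - ?s)"
    using d unfolding eq by (simp add: dominated_by_def)
  also have "\<dots> \<le> trop_eval w (nf (nf f * nf g - ?s))"
    by (intro trop_eval_nf_ge gw A_diff FA A_single uS)
  finally have "dominated_by w (nf ?s + nf (nf f * nf g - ?s)) (c * c' * c0) (0 + a)"
    by (intro add_dominated wt d1 nf_A A_diff FA A_single uS)
  then have "dominated_by w (nf (f * g)) (c * c' * c0) (0 + a)"
    by (simp add: nf_add[symmetric] nf_mult f g)
  then have "trop_eval w (nf (f * g)) = v (c * c') + w (u + u')"
    using dominated_by_eval[OF wt] eq by simp
  then show ?thesis
    using dominated_by_eval[OF wt d] trop_eval_mult_dominated[OF wt df dg] by simp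
qed

text \<open>The degrees determine the base, and the only other data of a normal exponent are the
  powers of the x_b. A direction that separates these data is therefore injective on normal
  exponents.\<close>

lemma SB_eqI:
  assumes "u \<in> SB" "u' \<in> SB" "\<And>e. e \<in> E \<Longrightarrow> p e u - q e u = p e u' - q e u'"
    "\<And>b. b \<in> B \<Longrightarrow> kap u b = kap u' b"
  shows "u = u'"
proof -
  have "base u = base u'"
    using assms by (intro base_eqI) (auto simp: SB_def)
  moreover have "kap u e = kap u' e" if "e \<in> E" for e
    using assms that by (cases "e \<in> B") (auto simp: SB_def)
  then have "xs (kap u) = xs (kap u')"
    by (simp add: xs_def)
  ultimately show ?thesis
    using base_xs by metis
qed

text \<open>
  A direction which keeps \<open>w\<close> good must assign to \<open>X e\<close> the value at a basis element attaining the
  minimum in \<open>trop_eval w (lf e)\<close>; all other choices are free and hence can be made generic.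
\<close>

lemma ex_generic_direction:
  assumes gw: "good w" and T: "finite T" "T \<subseteq> SB"
  obtains \<alpha> where "\<And>a b. a \<in> U \<Longrightarrow> b \<in> U \<Longrightarrow> \<alpha> (a + b) = \<alpha> a + \<alpha> b" "inj_on \<alpha> T"
    "\<forall>\<^sub>F t in at_right 0. generic (shift \<alpha> w t)"
proof -
  note wt = goodD(1)[OF gw]
  \<comment> \<open>Constraints on the weights of the x_b: they have to separate the exponents in
    \<open>T\<close> of equal degree and, through the exponents \<open>X b\<close>, take distinct
    values on \<open>B\<close>, so that ties in \<open>lf e\<close> can be broken.\<close>
  define Z1 :: "(('e \<Rightarrow> int) \<times> real) set" where "Z1 = (\<lambda>(u, u'). ((\<lambda>b. int (kap u b) - int (kap u' b)), 0)) `
    {(u, u') \<in> (T \<union> X ` B) \<times> (T \<union> X ` B). \<exists>b\<in>B. kap u b \<noteq> kap u' b}"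
  have "finite Z1"
    unfolding Z1_def using T finB
    by (intro finite_imageI finite_subset[OF _ finite_cartesian_product[of "T \<union> X ` B" "T \<union> X ` B"]]) auto
  moreover have "\<exists>b\<in>B. n b \<noteq> 0" if "(n, c) \<in> Z1" for n c
    using that by (auto simp: Z1_def)
  ultimately obtain \<alpha>1 :: "'e \<Rightarrow> real" where \<alpha>1: "\<forall>(n, c)\<in>Z1. (\<Sum>b\<in>B. \<alpha>1 b * of_int (n b)) \<noteq> c"
    using avoid_hyperplanes[of Z1 B] finB by blast
  have sep1: "(\<Sum>b\<in>B. \<alpha>1 b * (real (kap u b) - real (kap u' b))) \<noteq> 0"
    if "u \<in> T \<union> X ` B" "u' \<in> T \<union> X ` B" "b \<in> B" "kap u b \<noteq> kap u' b" for u u' b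
  proof -
    have "((\<lambda>b. int (kap u b) - int (kap u' b)), 0) \<in> Z1"
      unfolding Z1_def using that by (intro image_eqI[of _ _ "(u, u')"]) auto
    with \<alpha>1 show ?thesis
      by fastforce
  qed
  have sumX: "(\<Sum>b\<in>B. \<alpha>1 b * real (kap (X b1) b)) = \<alpha>1 b1" if "b1 \<in> B" for b1
  proof -
    have "(\<Sum>b\<in>B. \<alpha>1 b * real (kap (X b1) b)) = (\<Sum>b\<in>B. if b = b1 then \<alpha>1 b else 0)"
      using that by (intro sum.cong) (auto simp: kap_X B_E)
    then show ?thesis
      using that finB by simp
  qed
  have inj1: "inj_on \<alpha>1 B"
  proof (rule inj_onI, rule ccontr)
    fix b1 b2 assume b: "b1 \<in> B" "b2 \<in> B" "\<alpha>1 b1 = \<alpha>1 b2" "b1 \<noteq> b2"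
    then have "(\<Sum>b\<in>B. \<alpha>1 b * (real (kap (X b1) b) - real (kap (X b2) b))) \<noteq> 0"
      by (intro sep1[of _ _ b1]) (auto simp: kap_X B_E)
    with b show False
      by (simp add: right_diff_distrib sum_subtractf sumX)
  qed
  \<comment> \<open>The index at which the minimum of \<open>lf e\<close> is attained and which wins
    all ties under \<open>\<alpha>1\<close>.\<close>
  define minb where "minb e b \<longleftrightarrow> b \<in> B \<and> v (C e b) + w (X b) = w (X e) \<and>
      (\<forall>\<^sub>F t in at_right 0. \<forall>b'\<in>B - {b}. v (C e b) + w (X b) + ereal (t * \<alpha>1 b) < v (C e b') + w (X b') + ereal (t * \<alpha>1 b'))" for e b
  have minb_ex: "\<exists>b. minb e b"
    if e: "e \<in> E" and fin: "w (X e) \<noteq> \<infinity>" for e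
  proof -
    have "\<exists>b1\<in>B. v (C e b1) + w (X b1) \<noteq> \<infinity>"
    proof (rule ccontr)
      assume "\<not> ?thesis"
      then have "\<infinity> \<le> trop_eval w (lf e)"
        unfolding lf_def by (intro trop_eval_A_sum wt A_single X_S B_E) (auto simp: trop_eval_A_single wt X_S B_E)
      with fin goodD(2)[OF gw e] show False
        by simp
    qed
    then obtain b1 where b1: "b1 \<in> B" "v (C e b1) + w (X b1) \<noteq> \<infinity>"
      by blast
    obtain b where b: "b \<in> B" "v (C e b) + w (X b) \<noteq> \<infinity>"
      and le: "\<And>b'. b' \<in> B \<Longrightarrow> v (C e b) + w (X b) \<le> v (C e b') + w (X b')"
      and ev: "\<forall>\<^sub>F t in at_right 0. \<forall>b'\<in>B - {b}. v (C e b) + w (X b) + ereal (t * \<alpha>1 b) < v (C e b') + w (X b') + ereal (t * \<alpha>1 b')"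
      by (rule eventually_unique_min[where I = B and \<alpha> = \<alpha>1 and x = "\<lambda>b. v (C e b) + w (X b)" and i = b1])
        (use finB inj1 b1 trop_pointsD(1)[OF wt X_S[OF B_E]] in auto)
    have "v (C e b) + w (X b) \<le> trop_eval w (lf e)"
      unfolding lf_def using le by (intro trop_eval_A_sum wt A_single X_S B_E) (auto simp: trop_eval_A_single wt X_S B_E)
    moreover have "trop_eval w (lf e) \<le> v (C e b) + w (X b)"
    proof -
      have "lookup (lf e) (X b) = (\<Sum>b'\<in>B. if b' = b then C e b' else 0)"
        unfolding lf_def lookup_sum using b X_inj B_E
        by (intro sum.cong) (auto simp: lookup_single when_def inj_on_def)
      then have look: "lookup (lf e) (X b) = C e b"
        using b finB by simp
      have "X b \<in> keys (lf e)"
        using b(2) by (auto simp: in_keys_iff look)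
      from trop_eval_le[OF this, of w] show ?thesis
        by (simp add: look)
    qed
    ultimately have "v (C e b) + w (X b) = w (X e)"
      using goodD(2)[OF gw e] by simp
    with b(1) ev have "minb e b"
      unfolding minb_def by (intro conjI)
    then show ?thesis ..
  qed
  define br where "br e = (SOME b. minb e b)" for e
  have minb_br: "minb e (br e)" if "e \<in> E" "w (X e) \<noteq> \<infinity>" for e
    unfolding br_def by (rule someI_ex[OF minb_ex[OF that]])
  have br: "\<And>e. e \<in> E \<Longrightarrow> w (X e) \<noteq> \<infinity> \<Longrightarrow> br e \<in> B"
    "\<And>e. e \<in> E \<Longrightarrow> w (X e) \<noteq> \<infinity> \<Longrightarrow> v (C e (br e)) + w (X (br e)) = w (X e)"
    "\<And>e. e \<in> E \<Longrightarrow> w (X e) \<noteq> \<infinity> \<Longrightarrow> \<forall>\<^sub>F t in at_right 0. \<forall>b'\<in>B - {br e}.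
      v (C e (br e)) + w (X (br e)) + ereal (t * \<alpha>1 (br e)) < v (C e b') + w (X b') + ereal (t * \<alpha>1 b')"
    using minb_br unfolding minb_def by (blast, blast, blast)
  \<comment> \<open>The value at \<open>X e\<close> is forced to be that of the winning index. Where
    \<open>w (X e)\<close> is \<infinity>, the shifted value at \<open>X e\<close> is \<infinity>
    anyway and 0 serves as a default.\<close>
  define \<alpha>2 where "\<alpha>2 e = (if e \<in> B then \<alpha>1 e else if w (X e) = \<infinity> then 0 else \<alpha>1 (br e))" for e
  have \<alpha>2: "\<alpha>2 e = \<alpha>1 (br e)" if e: "e \<in> E" "w (X e) \<noteq> \<infinity>" for e
  proof (cases "e \<in> B")
    case True
    \<comment> \<open>In a unit row the only entry of finite valuation is the diagonal one, so the
      winning index is \<open>e\<close> itself and both clauses of \<open>\<alpha>2\<close>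
      agree.\<close>
    have "C e (br e) \<noteq> 0"
      using br(2)[OF e] e(2) by auto
    then have "br e = e"
      using True br(1)[OF e] basis by (auto simp: basis_matrix_def split: if_splits)
    then show ?thesis
      using True by (simp add: \<alpha>2_def)
  qed (use e in \<open>simp add: \<alpha>2_def\<close>)
  \<comment> \<open>The direction will be the sum of \<open>off\<close>, which has the required
    values at the \<open>X e\<close>, and a linear function of the degree, which vanishes at every
    \<open>X e\<close> and can be chosen freely.\<close>
  define deg where "deg u e = p e u - q e u" for u e
  define off where "off u = (\<Sum>e\<in>E. \<alpha>2 e * of_int (q e u))" for u
  \<comment> \<open>With \<open>off\<close> fixed, these constraints let the degree part separate
    exponents of different degrees.\<close>
  define Z2 :: "(('e \<Rightarrow> int) \<times> real) set" where "Z2 = (\<lambda>(u, u'). ((\<lambda>e. deg u e - deg u' e), off u' - off u)) `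
    {(u, u') \<in> T \<times> T. \<exists>e\<in>E. deg u e \<noteq> deg u' e}"
  have "finite Z2"
    unfolding Z2_def using T by (intro finite_imageI finite_subset[OF _ finite_cartesian_product]) auto
  moreover have "\<exists>b\<in>E. n b \<noteq> 0" if "(n, c) \<in> Z2" for n c
    using that by (auto simp: Z2_def)
  ultimately obtain \<theta> :: "'e \<Rightarrow> real" where \<theta>: "\<forall>(n, c)\<in>Z2. (\<Sum>b\<in>E. \<theta> b * of_int (n b)) \<noteq> c"
    using avoid_hyperplanes[of Z2 E] finE by blast
  have sep2: "(\<Sum>b\<in>E. \<theta> b * (of_int (deg u b) - of_int (deg u' b))) \<noteq> off u' - off u"
    if "u \<in> T" "u' \<in> T" "e \<in> E" "deg u e \<noteq> deg u' e" for u u' e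
  proof -
    have "((\<lambda>e. deg u e - deg u' e), off u' - off u) \<in> Z2"
      unfolding Z2_def using that by (intro image_eqI[of _ _ "(u, u')"]) auto
    with \<theta> show ?thesis
      by fastforce
  qed
  define \<alpha> where "\<alpha> u = off u + (\<Sum>e\<in>E. \<theta> e * of_int (deg u e))" for u
  have \<alpha>_add: "\<alpha> (a + b) = \<alpha> a + \<alpha> b" if "a \<in> U" "b \<in> U" for a b
    using that by (simp add: \<alpha>_def off_def deg_def p_add q_add sum.distrib[symmetric] algebra_simps cong: sum.cong)
  have \<alpha>X: "\<alpha> (X e) = \<alpha>2 e" if "e \<in> E" for e
  proof -
    have "off (X e) = (\<Sum>f\<in>E. if f = e then \<alpha>2 f else 0)"
      unfolding off_def using that by (intro sum.cong) (auto simp: q_X)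
    moreover have "(\<Sum>f\<in>E. \<theta> f * of_int (deg (X e) f)) = 0"
      using that by (intro sum.neutral) (auto simp: deg_def p_X q_X)
    ultimately show ?thesis
      using that finE by (simp add: \<alpha>_def)
  qed
  have "inj_on \<alpha> T"
  proof (rule inj_onI, rule ccontr)
    fix u u' assume u: "u \<in> T" "u' \<in> T" and eq: "\<alpha> u = \<alpha> u'" and ne: "u \<noteq> u'"
    have uSB: "u \<in> SB" "u' \<in> SB" and uS: "u \<in> S" "u' \<in> S"
      using u T by (auto simp: SB_def)
    show False
    proof (cases "\<exists>e\<in>E. deg u e \<noteq> deg u' e")
      case True
      then obtain e where "e \<in> E" "deg u e \<noteq> deg u' e"
        by blast
      from sep2[OF u this] eq show False
        by (simp add: \<alpha>_def right_diff_distrib sum_subtractf)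
    next
      case False
      then have deg: "\<And>e. e \<in> E \<Longrightarrow> p e u - q e u = p e u' - q e u'"
        by (auto simp: deg_def)
      then obtain b where b: "b \<in> B" "kap u b \<noteq> kap u' b"
        using SB_eqI[OF uSB] ne by blast
      \<comment> \<open>At equal degrees \<open>q\<close> and \<open>kap\<close> change by the same
        amount, so the constraints from \<open>Z1\<close> apply to \<open>off\<close>.\<close>
      have qk: "of_int (q e u) - of_int (q e u') = real (kap u e) - real (kap u' e)" if "e \<in> E" for e
      proof -
        have "int (kap u e) - int (kap u' e) = q e u - q e u'"
          using deg[OF that] by (simp add: kap_int[OF _ that] uS min_def)
        then have "real_of_int (int (kap u e) - int (kap u' e)) = real_of_int (q e u - q e u')"
          by (simp only:)
        then show ?thesis
          by simp
      qed
      have "0 = off u - off u'"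
        using eq False by (simp add: \<alpha>_def)
      also have "\<dots> = (\<Sum>e\<in>E. \<alpha>2 e * (of_int (q e u) - of_int (q e u')))"
        by (simp add: off_def right_diff_distrib sum_subtractf)
      also have "\<dots> = (\<Sum>e\<in>E. \<alpha>2 e * (real (kap u e) - real (kap u' e)))"
        by (intro sum.cong) (auto simp: qk)
      also have "\<dots> = (\<Sum>e\<in>B. \<alpha>2 e * (real (kap u e) - real (kap u' e)))"
        using finE B_subset uSB by (intro sum.mono_neutral_right) (auto simp: SB_def)
      also have "\<dots> = (\<Sum>e\<in>B. \<alpha>1 e * (real (kap u e) - real (kap u' e)))"
        by (intro sum.cong) (auto simp: \<alpha>2_def)
      finally show False
        using sep1[of u u' b] u b by simp
    qed
  qed
  moreover have "\<forall>\<^sub>F t in at_right 0. generic (shift \<alpha> w t)"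
  proof -
    have "\<forall>\<^sub>F t in at_right 0. \<forall>e\<in>{e \<in> E. w (X e) \<noteq> \<infinity>}. \<forall>b'\<in>B - {br e}.
      v (C e (br e)) + w (X (br e)) + ereal (t * \<alpha>1 (br e)) < v (C e b') + w (X b') + ereal (t * \<alpha>1 b')"
      using finE br(3) by (subst eventually_ball_finite_distrib) auto
    then show ?thesis
    proof eventually_elim
      case (elim t)
      let ?w = "shift \<alpha> w t"
      have w't: "?w \<in> tropical_points S"
        using \<alpha>_add by (intro shift_points wt) (auto simp: S_U)
      have sX: "?w (X b) = w (X b) + ereal (t * \<alpha>1 b)" if "b \<in> B" for b
        using that by (simp add: shift_def X_S B_E \<alpha>X \<alpha>2_def)
      have dom: "dominated_by ?w (lf e) (C e (br e)) (X (br e))" if e: "e \<in> E" "w (X e) \<noteq> \<infinity>" for e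
        unfolding lf_def
      proof (rule sum_dominated[where g = X and c = "C e"])
        show "v (C e (br e)) + ?w (X (br e)) \<noteq> \<infinity>"
          using br(1,2)[OF e] e(2) by (auto simp: sX)
        fix b' assume "b' \<in> B - {br e}"
        with elim e br(1)[OF e] show "v (C e (br e)) + ?w (X (br e)) < v (C e b') + ?w (X b')"
          by (simp add: sX ac_simps)
      qed (use br(1)[OF e] finB X_S B_E w't in auto)
      have "trop_eval ?w (lf e) = ?w (X e)" if e: "e \<in> E" for e
      proof (cases "w (X e) = \<infinity>")
        case True
        then have "trop_eval ?w (lf e) = \<infinity>"
          using goodD(2)[OF gw e] by (simp add: trop_eval_shift_inf_iff lf_A wt w't)
        then show ?thesis
          using True e by (simp add: shift_def X_S)
      next
        case False
        have "trop_eval ?w (lf e) = v (C e (br e)) + (w (X (br e)) + ereal (t * \<alpha>1 (br e)))"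
          using dominated_by_eval[OF w't dom[OF e False]] br(1)[OF e False] by (simp add: sX)
        also have "\<dots> = w (X e) + ereal (t * \<alpha>2 e)"
          using br(2)[OF e False] \<alpha>2[OF e False] by (simp add: add.assoc[symmetric])
        finally show ?thesis
          using e by (simp add: shift_def X_S \<alpha>X)
      qed
      with w't have "good ?w"
        by (simp add: good_def)
      moreover have "\<exists>c u. dominated_by ?w (lf e) c u" if "e \<in> E" "?w (X e) \<noteq> \<infinity>" for e
        using dom[of e] that by (auto simp: shift_inf_iff X_S)
      ultimately show ?case
        by (simp add: generic_def)
    qed
  qed
  ultimately show thesis
    using that[of \<alpha>] \<alpha>_add by blast
qed

text \<open>Equality at generic points, where both factors have leading terms, passes to the limit.
  If a factor has value \<infinity>, superadditivity alone suffices.\<close>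

lemma trop_eval_nf_mult:
  assumes w: "good w" and f: "f \<in> A" and g: "g \<in> A"
  shows "trop_eval w (nf (f * g)) = trop_eval w (nf f) + trop_eval w (nf g)"
proof (cases "trop_eval w (nf f) = \<infinity> \<or> trop_eval w (nf g) = \<infinity>")
  case True
  then show ?thesis
    using trop_eval_nf_mult_ge[OF w f g] by auto
next
  case False
  note wt = goodD(1)[OF w]
  obtain \<alpha> where \<alpha>: "\<And>a b. a \<in> U \<Longrightarrow> b \<in> U \<Longrightarrow> \<alpha> (a + b) = \<alpha> a + \<alpha> b"
    and inj: "inj_on \<alpha> (keys (nf f) \<union> keys (nf g))"
    and gen: "\<forall>\<^sub>F t in at_right 0. generic (shift \<alpha> w t)"
    by (rule ex_generic_direction[OF w, of "keys (nf f) \<union> keys (nf g)"])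
      (use keys_nf f g in auto)
  have dom: "\<forall>\<^sub>F t in at_right 0. \<exists>c u. dominated_by (shift \<alpha> w t) (nf h) c u" if "h = f \<or> h = g" for h
    using that False f g inj \<alpha> S_U
    by (intro eventually_shift_dominated wt nf_A) (auto intro: inj_on_subset)
  from dom[OF disjI1[OF refl]] dom[OF disjI2[OF refl]] gen
  have "\<forall>\<^sub>F t in at_right 0. trop_eval (shift \<alpha> w t) (nf (f * g)) =
      trop_eval (shift \<alpha> w t) (nf f) + trop_eval (shift \<alpha> w t) (nf g)"
    by eventually_elim (auto intro: nf_mult_generic f g)
  moreover have lim: "((\<lambda>t. trop_eval (shift \<alpha> w t) h) \<longlongrightarrow> trop_eval w h) (at_right 0)" if "h \<in> A" for h
    using that by (intro tendsto_trop_eval tendsto_shift wt trop_pointsD(1)[OF wt])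
  have "((\<lambda>t. trop_eval (shift \<alpha> w t) (nf f) + trop_eval (shift \<alpha> w t) (nf g)) \<longlongrightarrow>
      trop_eval w (nf f) + trop_eval w (nf g)) (at_right 0)"
    by (intro tendsto_add_ereal_nonneg lim nf_A f g trop_eval_A_nminf wt)
  ultimately have "((\<lambda>t. trop_eval (shift \<alpha> w t) (nf (f * g))) \<longlongrightarrow>
      trop_eval w (nf f) + trop_eval w (nf g)) (at_right 0)"
    by (simp add: filterlim_cong[OF refl refl])
  then show ?thesis
    using tendsto_unique[OF trivial_limit_at_right_real lim[OF nf_A[OF A_mult[OF f g]]]] by blast
qed

text \<open>Again a limit of the equality at generic points; no support has to be separated, hence
  the empty set of exponents.\<close>

lemma trop_eval_nmono:
  assumes w: "good w" and u: "u \<in> S"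
  shows "trop_eval w (nmono u) = w u"
proof (cases "w u = \<infinity>")
  case True
  then show ?thesis
    using trop_eval_nmono_ge[OF w u] by simp
next
  case False
  note wt = goodD(1)[OF w]
  obtain \<alpha> where \<alpha>: "\<And>a b. a \<in> U \<Longrightarrow> b \<in> U \<Longrightarrow> \<alpha> (a + b) = \<alpha> a + \<alpha> b"
    and gen: "\<forall>\<^sub>F t in at_right 0. generic (shift \<alpha> w t)"
    by (rule ex_generic_direction[OF w, of "{}"]) auto
  from gen have "\<forall>\<^sub>F t in at_right 0. shift \<alpha> w t u = trop_eval (shift \<alpha> w t) (nmono u)"
    by eventually_elim (use False u in \<open>simp add: nmono_generic shift_inf_iff\<close>)
  then have "((\<lambda>t. trop_eval (shift \<alpha> w t) (nmono u)) \<longlongrightarrow> w u) (at_right 0)"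
    by (rule Lim_transform_eventually[OF tendsto_shift[OF wt u]])
  moreover have "((\<lambda>t. trop_eval (shift \<alpha> w t) (nmono u)) \<longlongrightarrow> trop_eval w (nmono u)) (at_right 0)"
    by (intro tendsto_trop_eval tendsto_shift wt trop_pointsD(1)[OF wt] nmono_A u)
  ultimately show ?thesis
    using tendsto_unique[OF trivial_limit_at_right_real] by blast
qed

definition monomial_val :: "('u \<Rightarrow> ereal) \<Rightarrow> ('u \<Rightarrow>\<^sub>0 'k) \<Rightarrow> ereal" where
  "monomial_val w = (\<lambda>f\<in>A. trop_eval w (nf f))"

text \<open>Multiplicativity is \<open>trop_eval_nf_mult\<close>. A linear form from
  \<open>L\<close> is killed because its normal form has the coefficients
  \<open>\<Sum>e\<in>E. l e * C e b\<close>, which vanish.\<close>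

lemma monomial_val_H:
  assumes w: "good w"
  shows "monomial_val w \<in> H" "trop_of (monomial_val w) = w"
proof -
  note wt = goodD(1)[OF w]
  have "monomial_val w (single 0 c) = v c" for c
    by (simp add: monomial_val_def A_single zero_S nf_single nmono_zero trop_eval_A_single wt trop_pointsD[OF wt])
  moreover have "monomial_val w (lin l) = \<infinity>" if l: "l \<in> L" for l
  proof -
    have "nf (lin l) = (\<Sum>e\<in>E. single 0 (l e) * lf e)"
      by (simp add: lin_def nf_sum nf_single nmono_X)
    also have "\<dots> = (\<Sum>e\<in>E. \<Sum>b\<in>B. single (X b) (l e * C e b))"
      by (simp add: lf_def sum_distrib_left mult_single)
    also have "\<dots> = (\<Sum>b\<in>B. \<Sum>e\<in>E. single (X b) (l e * C e b))"
      by (rule sum.swap)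
    also have "\<dots> = (\<Sum>b\<in>B. single (X b) (\<Sum>e\<in>E. l e * C e b))"
      by (intro sum.cong refl poly_mapping_eqI) (simp add: lookup_sum lookup_single when_def)
    also have "\<dots> = 0"
      using basis l by (intro sum.neutral) (auto simp: basis_matrix_def)
    finally show ?thesis
      by (simp add: monomial_val_def lin_A)
  qed
  moreover have "min (monomial_val w f) (monomial_val w g) \<le> monomial_val w (f + g)" if "f \<in> A" "g \<in> A" for f g
    using that trop_eval_A_add[OF wt nf_A nf_A] by (simp add: monomial_val_def A_add nf_add)
  ultimately show "monomial_val w \<in> H"
    unfolding H_def berkovich_points_def
    using trop_eval_A_nminf[OF wt nf_A] trop_eval_nf_mult[OF w]
    by (auto simp: monomial_val_def A_mult)
  show "trop_of (monomial_val w) = w"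
    using wt by (auto simp: trop_of_def monomial_val_def tropical_points_def extensional_def fun_eq_iff
        A_single nf_single trop_eval_nmono[OF w])
qed

text \<open>Only one inequality has to be assumed. The other holds for every valuation on the
  variety: the tropical value of \<open>lf e\<close> is at most \<open>\<nu> (lf e)\<close>, which
  is the value of x_e.\<close>

lemma good_of_trop:
  assumes \<nu>: "\<nu> \<in> H" and le: "\<And>e b. e \<in> E \<Longrightarrow> b \<in> B \<Longrightarrow> trop_of \<nu> (X e) \<le> v (C e b) + trop_of \<nu> (X b)"
  shows "good (trop_of \<nu>)"
proof -
  have b: "\<nu> \<in> berkovich_points v S"
    using \<nu> by (simp add: H_def)
  note wt = trop_of_points[OF b]
  have "trop_eval (trop_of \<nu>) (lf e) = trop_of \<nu> (X e)" if e: "e \<in> E" for e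
  proof (rule antisym)
    show "trop_of \<nu> (X e) \<le> trop_eval (trop_of \<nu>) (lf e)"
      unfolding lf_def using le e
      by (intro trop_eval_A_sum wt A_single X_S B_E) (auto simp: trop_eval_A_single wt X_S B_E)
    have "trop_eval (trop_of \<nu>) (lf e) \<le> \<nu> (lf e)"
      by (rule trop_eval_le_berkovich[OF b lf_A])
    also have "\<dots> = \<nu> (single (X e) 1)"
      using H_nf[OF \<nu> A_single[OF X_S[OF e], of 1]] e by (simp add: nf_single nmono_X)
    finally show "trop_eval (trop_of \<nu>) (lf e) \<le> trop_of \<nu> (X e)"
      using e by (simp add: trop_of_def X_S)
  qed
  with wt show ?thesis
    by (simp add: good_def)
qed

end

section \<open>The section on a chart\<close>

context lawrence_chart
begin

definition bases :: "'e set set" where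
  "bases = {B. \<exists>C. basis_matrix E L B C}"

text \<open>Any choice will do, since \<open>basis_matrix_unique\<close> determines the relevant
  entries.\<close>

definition mat :: "'e set \<Rightarrow> 'e \<Rightarrow> 'e \<Rightarrow> 'k" where
  "mat B = (SOME C. basis_matrix E L B C)"

lemma finite_bases: "finite bases"
  by (rule finite_subset[of _ "Pow E"]) (auto simp: bases_def basis_matrix_def finE)

lemma basis_locale:
  assumes "B \<in> bases"
  shows "lawrence_basis v S U E P Q p q X L B (mat B)"
proof
  show "basis_matrix E L B (mat B)"
    unfolding mat_def using assms by (auto simp: bases_def intro: someI_ex[of "basis_matrix E L B"])
qed

abbreviation nfB :: "'e set \<Rightarrow> ('u \<Rightarrow>\<^sub>0 'k) \<Rightarrow> 'u \<Rightarrow>\<^sub>0 'k" where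
  "nfB B \<equiv> lawrence_basis.nf E P Q p q X B (mat B)"

abbreviation goodB :: "'e set \<Rightarrow> ('u \<Rightarrow> ereal) \<Rightarrow> bool" where
  "goodB B \<equiv> lawrence_basis.good v S E X B (mat B)"

definition sec :: "('u \<Rightarrow> ereal) \<Rightarrow> ('u \<Rightarrow>\<^sub>0 'k) \<Rightarrow> ereal" where
  "sec w = (\<lambda>f\<in>A. SUP B\<in>bases. trop_eval w (nfB B f))"

lemma trop_eval_nfB_le:
  assumes \<nu>: "\<nu> \<in> H" and B: "B \<in> bases" and f: "f \<in> A"
  shows "trop_eval (trop_of \<nu>) (nfB B f) \<le> \<nu> f"
proof -
  interpret lawrence_basis v S U E P Q p q X L B "mat B"
    by (rule basis_locale[OF B])
  show ?thesis
    using trop_eval_le_berkovich[of \<nu> "nf f"] H_nf[OF \<nu> f] \<nu> nf_A[OF f] by (simp add: H_def)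
qed

lemma sec_le:
  assumes "\<nu> \<in> H" "f \<in> A"
  shows "sec (trop_of \<nu>) f \<le> \<nu> f"
  using assms trop_eval_nfB_le by (auto simp: sec_def intro: SUP_least)

text \<open>\<open>monomial_val w\<close> is itself a point of the fibre over \<open>w\<close>, so
  it bounds the normal forms for all other bases from above.\<close>

lemma sec_good:
  assumes B: "B \<in> bases" and w: "goodB B w" and f: "f \<in> A"
  shows "sec w f = trop_eval w (nfB B f)"
proof (rule antisym)
  interpret lawrence_basis v S U E P Q p q X L B "mat B"
    by (rule basis_locale[OF B])
  show "sec w f \<le> trop_eval w (nf f)"
    using sec_le[OF monomial_val_H(1)[OF w] f] f by (simp add: monomial_val_H(2)[OF w]) (simp add: monomial_val_def)
  show "trop_eval w (nf f) \<le> sec w f"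
    using f B by (auto simp: sec_def intro: SUP_upper)
qed

lemma sec_monomial_val:
  assumes B: "B \<in> bases" and w: "goodB B w"
  shows "sec w \<in> H" "trop_of (sec w) = w"
proof -
  interpret lawrence_basis v S U E P Q p q X L B "mat B"
    by (rule basis_locale[OF B])
  have "sec w = monomial_val w"
    using sec_good[OF B w] by (auto simp: fun_eq_iff monomial_val_def) (simp add: sec_def)
  then show "sec w \<in> H" "trop_of (sec w) = w"
    using monomial_val_H[OF w] by simp_all
qed

text \<open>Pivoting with the values of the x_e as weights gives one half of goodness and
  \<open>good_of_trop\<close> the other. The default 0 outside \<open>E\<close> merely keeps the
  weights away from -\<infinity>.\<close>

lemma ex_good_basis:
  assumes \<nu>: "\<nu> \<in> H"
  obtains B where "B \<in> bases" "goodB B (trop_of \<nu>)"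
proof -
  have b: "\<nu> \<in> berkovich_points v S"
    using \<nu> by (simp add: H_def)
  define w where "w e = (if e \<in> E then trop_of \<nu> (X e) else 0)" for e
  have "w e \<noteq> -\<infinity>" for e
    using trop_pointsD(1)[OF trop_of_points[OF b] X_S] by (simp add: w_def)
  then obtain B C where BC: "basis_matrix E L B C"
    and le: "\<And>e b. e \<in> E \<Longrightarrow> b \<in> B \<Longrightarrow> w e \<le> v (C e b) + w b"
    using ex_basis_matrix[of E L w] finE L L_supp by metis
  then have B: "B \<in> bases"
    by (auto simp: bases_def)
  interpret lawrence_basis v S U E P Q p q X L B "mat B"
    by (rule basis_locale[OF B])
  have "good (trop_of \<nu>)"
  proof (rule good_of_trop[OF \<nu>])
    fix e b assume "e \<in> E" "b \<in> B"
    then show "trop_of \<nu> (X e) \<le> v (mat B e b) + trop_of \<nu> (X b)"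
      using le[of e b] basis_matrix_unique[OF finE L BC basis] B_E by (simp add: w_def)
  qed
  with B that show thesis
    by blast
qed

definition T :: "('u \<Rightarrow> ereal) set" where
  "T = trop_of ` H"

lemma sec_H: "w \<in> T \<Longrightarrow> sec w \<in> H" and trop_of_sec: "w \<in> T \<Longrightarrow> trop_of (sec w) = w"
  using ex_good_basis sec_monomial_val by (auto simp: T_def) metis+

lemma T_trop: "w \<in> T \<Longrightarrow> w \<in> tropical_points S"
  by (auto simp: T_def H_def intro: trop_of_points)

lemma topspace_tropical_chart: "topspace (tropical_chart S) = tropical_points S"
  by (auto simp: tropical_chart_def tropical_points_def PiE_def)

lemma continuous_sec:
  "continuous_map (subtopology (tropical_chart S) T) (berkovich_chart v S) sec"
proof -
  let ?X = "subtopology (tropical_chart S) T"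
  have top: "topspace ?X = T"
    using T_trop by (auto simp: topspace_tropical_chart)
  have "continuous_map ?X euclidean (\<lambda>w. sec w f)" if f: "f \<in> A" for f
    unfolding continuous_map_atin limitin_canonical_iff
  proof
    fix w0 assume w0: "w0 \<in> topspace ?X"
    have "((\<lambda>w. w u) \<longlongrightarrow> w0 u) (atin ?X w0)" if u: "u \<in> S" for u
    proof -
      have "continuous_map (tropical_chart S) euclidean (\<lambda>w. w u)"
        unfolding tropical_chart_def using u
        by (intro continuous_map_from_subtopology continuous_map_product_projection)
      then have "continuous_map ?X euclidean (\<lambda>w. w u)"
        by (rule continuous_map_from_subtopology)
      with w0 show ?thesis
        unfolding continuous_map_atin limitin_canonical_iff by blast
    qed
    moreover have "w0 u \<noteq> -\<infinity>" if "u \<in> S" for u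
      using trop_pointsD(1)[OF T_trop that] w0 top by simp
    moreover have "nfB B f \<in> A" if "B \<in> bases" for B
      using lawrence_basis.nf_A[OF basis_locale[OF that] f] .
    ultimately show "((\<lambda>w. sec w f) \<longlongrightarrow> sec w0 f) (atin ?X w0)"
      using f by (auto simp: sec_def intro!: tendsto_SUP_finite finite_bases tendsto_trop_eval)
  qed
  moreover have "sec w \<in> berkovich_points v S" if "w \<in> T" for w
    using sec_H[OF that] by (simp add: H_def)
  ultimately show ?thesis
    unfolding berkovich_chart_def continuous_map_in_subtopology continuous_map_componentwise
    using top by (auto simp: sec_def)
qed

text \<open>
  At generic points near \<open>w\<close> every valuation in the fibre takes the value \<open>trop_eval\<close> of the normal
  form of \<open>f\<close>, because a single monomial is dominant.
\<close>

lemma fibre_near_sec: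
  assumes w: "w \<in> T" and f: "f \<in> A" and less: "sec w f < y"
    and N: "openin (subtopology (tropical_chart S) T) N" "w \<in> N"
  shows "\<exists>w'\<in>N. \<forall>\<nu>\<in>H. trop_of \<nu> = w' \<longrightarrow> \<nu> f < y"
proof -
  obtain B where B: "B \<in> bases" and gw: "goodB B w"
    using w ex_good_basis by (auto simp: T_def)
  interpret lawrence_basis v S U E P Q p q X L B "mat B"
    by (rule basis_locale[OF B])
  note wt = goodD(1)[OF gw]
  have eq: "sec w f = trop_eval w (nf f)"
    by (rule sec_good[OF B gw f])
  obtain \<alpha> where \<alpha>: "\<And>a b. a \<in> U \<Longrightarrow> b \<in> U \<Longrightarrow> \<alpha> (a + b) = \<alpha> a + \<alpha> b"
    and inj: "inj_on \<alpha> (keys (nf f))"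
    and gen: "\<forall>\<^sub>F t in at_right 0. generic (shift \<alpha> w t)"
    by (rule ex_generic_direction[OF gw, of "keys (nf f)"]) (use keys_nf f in auto)
  have dom: "\<forall>\<^sub>F t in at_right 0. \<exists>c u. dominated_by (shift \<alpha> w t) (nf f) c u"
    using less f inj \<alpha> S_U eq by (intro eventually_shift_dominated wt nf_A) auto
  have "((\<lambda>t. trop_eval (shift \<alpha> w t) (nf f)) \<longlongrightarrow> trop_eval w (nf f)) (at_right 0)"
    by (intro tendsto_trop_eval tendsto_shift wt trop_pointsD(1)[OF wt] nf_A f)
  then have small: "\<forall>\<^sub>F t in at_right 0. trop_eval (shift \<alpha> w t) (nf f) < y"
    using less eq by (intro order_tendstoD) auto
  have inT: "\<forall>\<^sub>F t in at_right 0. shift \<alpha> w t \<in> T"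
    using gen by eventually_elim (use monomial_val_H in \<open>force simp: generic_def T_def\<close>)
  \<comment> \<open>Pointwise convergence is convergence in the product topology, so the perturbed
    points eventually enter the given neighbourhood.\<close>
  have "limitin (product_topology (\<lambda>_. euclidean) S) (shift \<alpha> w) w (at_right 0)"
    unfolding limitin_componentwise limitin_canonical_iff using wt tendsto_shift[OF wt]
    by (auto simp: shift_def tropical_points_def)
  moreover obtain N' where N': "openin (product_topology (\<lambda>_. euclidean) S) N'" "N = N' \<inter> (tropical_points S \<inter> T)"
    using N(1) unfolding tropical_chart_def subtopology_subtopology openin_subtopology by blast
  ultimately have "\<forall>\<^sub>F t in at_right 0. shift \<alpha> w t \<in> N'"
    using N(2) unfolding limitin_def by blast
  with inT have inN: "\<forall>\<^sub>F t in at_right 0. shift \<alpha> w t \<in> N"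
    by eventually_elim (use N'(2) T_trop in auto)
  from inN small dom have "\<forall>\<^sub>F t in at_right 0. shift \<alpha> w t \<in> N \<and>
      (\<forall>\<nu>\<in>H. trop_of \<nu> = shift \<alpha> w t \<longrightarrow> \<nu> f < y)"
  proof eventually_elim
    case (elim t)
    have "\<nu> f < y" if \<nu>: "\<nu> \<in> H" and tr: "trop_of \<nu> = shift \<alpha> w t" for \<nu>
    proof -
      have b: "\<nu> \<in> berkovich_points v S"
        using \<nu> by (simp add: H_def)
      obtain c u where "dominated_by (trop_of \<nu>) (nf f) c u"
        using elim(3) tr by auto
      from berkovich_dominated[OF b this] H_nf[OF \<nu> f] elim(2) tr show ?thesis
        by simp
    qed
    with elim(1) show ?case
      by blast
  qed
  then obtain t where "shift \<alpha> w t \<in> N" "\<forall>\<nu>\<in>H. trop_of \<nu> = shift \<alpha> w t \<longrightarrow> \<nu> f < y"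
    using eventually_happens'[OF trivial_limit_at_right_real] by blast
  then show ?thesis
    by blast
qed

end

section \<open>Gluing along open embeddings\<close>

lemma topspace_quotient_space: "topspace (quotient_space X r) = topspace X // r"
proof
  show "topspace (quotient_space X r) \<subseteq> topspace X // r"
    using openin_topspace[of "quotient_space X r"] unfolding openin_quotient_space by blast
  have "{x \<in> topspace X. r `` {x} \<in> topspace X // r} = topspace X"
    by (auto simp: quotient_def)
  then have "openin (quotient_space X r) (topspace X // r)"
    by (simp add: openin_quotient_space)
  then show "topspace X // r \<subseteq> topspace (quotient_space X r)"
    by (rule openin_subset)
qed

text \<open>The axiom \<open>meet\<close> plays the role of the cocycle condition: two subcharts of
  one chart overlap only inside charts below both. It reduces the generated equivalence relation to
  a single common lower chart.\<close>

locale open_gluing =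
  fixes I :: "'i set" and below :: "'i \<Rightarrow> 'i \<Rightarrow> bool" and D :: "'i \<Rightarrow> 'f set"
    and X :: "'i \<Rightarrow> ('f \<Rightarrow> 'v) topology"
  assumes below_refl: "i \<in> I \<Longrightarrow> below i i"
    and below_trans: "i \<in> I \<Longrightarrow> j \<in> I \<Longrightarrow> k \<in> I \<Longrightarrow> below i j \<Longrightarrow> below j k \<Longrightarrow> below i k"
    and D_mono: "i \<in> I \<Longrightarrow> j \<in> I \<Longrightarrow> below i j \<Longrightarrow> D j \<subseteq> D i"
    and chart_ext: "i \<in> I \<Longrightarrow> x \<in> topspace (X i) \<Longrightarrow> x \<in> extensional (D i)"
    and chart_cont: "i \<in> I \<Longrightarrow> j \<in> I \<Longrightarrow> below i j \<Longrightarrow> continuous_map (X i) (X j) (\<lambda>x. restrict x (D j))"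
    and chart_inj: "i \<in> I \<Longrightarrow> j \<in> I \<Longrightarrow> below i j \<Longrightarrow> inj_on (\<lambda>x. restrict x (D j)) (topspace (X i))"
    and chart_open: "i \<in> I \<Longrightarrow> j \<in> I \<Longrightarrow> below i j \<Longrightarrow> open_map (X i) (X j) (\<lambda>x. restrict x (D j))"
    and meet: "i \<in> I \<Longrightarrow> j \<in> I \<Longrightarrow> k \<in> I \<Longrightarrow> below j i \<Longrightarrow> below k i \<Longrightarrow>
      y \<in> topspace (X j) \<Longrightarrow> z \<in> topspace (X k) \<Longrightarrow> restrict y (D i) = restrict z (D i) \<Longrightarrow>
      \<exists>l\<in>I. below l j \<and> below l k \<and> (\<exists>x\<in>topspace (X l). restrict x (D i) = restrict y (D i))"
begin

abbreviation rel :: "(('i \<times> ('f \<Rightarrow> 'v)) \<times> ('i \<times> ('f \<Rightarrow> 'v))) set" where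
  "rel \<equiv> glue_rel I below D X"

definition common :: "'i \<Rightarrow> ('f \<Rightarrow> 'v) \<Rightarrow> 'i \<Rightarrow> ('f \<Rightarrow> 'v) \<Rightarrow> bool" where
  "common i x j y \<longleftrightarrow> i \<in> I \<and> j \<in> I \<and>
     (\<exists>k\<in>I. below k i \<and> below k j \<and> (\<exists>z\<in>topspace (X k). restrict z (D i) = x \<and> restrict z (D j) = y))"

lemma restrict_chart:
  "i \<in> I \<Longrightarrow> j \<in> I \<Longrightarrow> below i j \<Longrightarrow> x \<in> topspace (X i) \<Longrightarrow> restrict x (D j) \<in> topspace (X j)"
  using chart_cont[of i j] by (auto simp: continuous_map_def Pi_iff)

lemma restrict_self: "i \<in> I \<Longrightarrow> x \<in> topspace (X i) \<Longrightarrow> restrict x (D i) = x"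
  using chart_ext by (rule extensional_restrict)

lemma restrict_twice:
  "i \<in> I \<Longrightarrow> j \<in> I \<Longrightarrow> below i j \<Longrightarrow> restrict (restrict x (D i)) (D j) = restrict x (D j)"
  using D_mono[of i j] by (simp add: restrict_restrict Int_absorb1)

lemma common_refl: "i \<in> I \<Longrightarrow> x \<in> topspace (X i) \<Longrightarrow> common i x i x"
  unfolding common_def using below_refl restrict_self by blast

lemma common_step_up:
  assumes c: "common i x j y" and j': "j' \<in> I" "below j j'"
  shows "common i x j' (restrict y (D j'))"
  using c j' below_trans restrict_twice[of j j'] unfolding common_def by metis

text \<open>\<open>meet\<close> supplies a chart below both the old common chart and
  \<open>j'\<close>; injectivity of the restrictions into \<open>j\<close> shows that its point
  restricts to both given ones.\<close>

lemma common_step_down: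
  assumes c: "common i x j y" and j': "j' \<in> I" "below j' j" and y': "y' \<in> topspace (X j')" "y = restrict y' (D j)"
  shows "common i x j' y'"
proof -
  from c obtain k z where kz: "i \<in> I" "j \<in> I" "k \<in> I" "below k i" "below k j" "z \<in> topspace (X k)"
    "restrict z (D i) = x" "restrict z (D j) = y"
    by (auto simp: common_def)
  then obtain l x0 where l: "l \<in> I" "below l k" "below l j'" "x0 \<in> topspace (X l)"
    "restrict x0 (D j) = restrict z (D j)"
    using meet[of j k j' z y'] j' y' by auto
  have "restrict x0 (D k) = z"
    using inj_onD[OF chart_inj[of k j], of "restrict x0 (D k)" z] kz l restrict_chart[of l k x0]
    by (simp add: restrict_twice del: restrict_restrict)
  then have "restrict x0 (D i) = x"
    using restrict_twice[of k i x0] kz by simp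
  moreover have "restrict x0 (D j') = y'"
    using inj_onD[OF chart_inj[of j' j], of "restrict x0 (D j')" y'] kz l restrict_chart[of l j' x0] j' y'
    by (simp add: restrict_twice del: restrict_restrict)
  moreover have "below l i"
    using below_trans[of l k i] kz l by blast
  ultimately show ?thesis
    using kz l j' unfolding common_def by blast
qed

text \<open>Induction along a chain of identifications: having a common lower chart survives a step
  up by restriction and a step down by \<open>meet\<close>.\<close>

lemma rel_iff_common:
  assumes i: "i \<in> I" and x: "x \<in> topspace (X i)"
  shows "((i, x), (j, y)) \<in> rel \<longleftrightarrow> common i x j y"
proof
  define R where "R = {((i, x), (j, restrict x (D j))) | i j x. i \<in> I \<and> j \<in> I \<and> below i j \<and> x \<in> topspace (X i)}"
  have rel_R: "rel = (R \<union> R\<inverse>)\<^sup>*"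
    by (simp add: glue_rel_def R_def Let_def)
  show "common i x j y" if "((i, x), (j, y)) \<in> rel"
  proof -
    have "common i x (fst b) (snd b)" if "((i, x), b) \<in> (R \<union> R\<inverse>)\<^sup>*" for b
      using that
    proof (induction rule: rtrancl_induct)
      case base
      then show ?case
        using common_refl[OF i x] by simp
    next
      case (step b c)
      from step.hyps(2) show ?case
      proof
        assume "(b, c) \<in> R"
        then obtain j' y j'' where "b = (j', y)" "c = (j'', restrict y (D j''))" "j'' \<in> I" "below j' j''"
          unfolding R_def by blast
        then show ?thesis
          using step.IH common_step_up[of i x j' y j''] by (simp only: fst_conv snd_conv)
      next
        assume "(b, c) \<in> R\<inverse>"
        then obtain j' y j'' where "c = (j', y)" "b = (j'', restrict y (D j''))" "j' \<in> I" "below j' j''"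
          "y \<in> topspace (X j')"
          unfolding R_def by blast
        then show ?thesis
          using step.IH common_step_down[of i x j'' "restrict y (D j'')" j' y] by (simp only: fst_conv snd_conv)
      qed
    qed
    from this[of "(j, y)"] that show ?thesis
      by (simp add: rel_R)
  qed
  assume "common i x j y"
  then obtain k z where "i \<in> I" "j \<in> I" "k \<in> I" "below k i" "below k j" "z \<in> topspace (X k)"
    "restrict z (D i) = x" "restrict z (D j) = y"
    by (auto simp: common_def)
  then have "((k, z), (i, x)) \<in> R" "((k, z), (j, y)) \<in> R"
    unfolding R_def by blast+
  then have "((i, x), (k, z)) \<in> R \<union> R\<inverse>" "((k, z), (j, y)) \<in> R \<union> R\<inverse>"
    by auto
  then show "((i, x), (j, y)) \<in> rel"
    unfolding rel_R by (meson r_into_rtrancl rtrancl_trans)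
qed

lemma equiv_rel: "sym rel" "trans rel" "refl rel"
  by (auto simp: glue_rel_def Let_def sym_Un_converse sym_rtrancl trans_rtrancl refl_rtrancl)

definition pt :: "'i \<Rightarrow> ('f \<Rightarrow> 'v) \<Rightarrow> ('i \<times> ('f \<Rightarrow> 'v)) set" where
  "pt i x = rel `` {(i, x)}"

abbreviation glued :: "('i \<times> ('f \<Rightarrow> 'v)) set topology" where
  "glued \<equiv> glued_space I below D X"

lemma pt_self: "(i, x) \<in> pt i x"
  using equiv_rel(3) by (auto simp: pt_def refl_on_def)

lemma mem_pt_iff: "i \<in> I \<Longrightarrow> x \<in> topspace (X i) \<Longrightarrow> (j, y) \<in> pt i x \<longleftrightarrow> common i x j y"
  by (simp add: pt_def rel_iff_common)

lemma common_chart: "common i x j y \<Longrightarrow> j \<in> I \<and> y \<in> topspace (X j)"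
  using restrict_chart by (auto simp: common_def)

lemma pt_eq_iff:
  assumes "i \<in> I" "x \<in> topspace (X i)"
  shows "pt i x = pt j y \<longleftrightarrow> common i x j y"
proof -
  have "pt i x = pt j y \<longleftrightarrow> ((i, x), (j, y)) \<in> rel"
    unfolding pt_def using equiv_class_eq_iff[of UNIV rel] equiv_rel by (simp add: equiv_def)
  then show ?thesis
    by (simp add: rel_iff_common assms)
qed

lemma pt_restrict:
  assumes "i \<in> I" "j \<in> I" "below i j" "x \<in> topspace (X i)"
  shows "pt j (restrict x (D j)) = pt i x"
  using assms pt_eq_iff[of i x j "restrict x (D j)"] below_refl restrict_self[of i x]
  by (auto simp: common_def)

lemma pt_inj:
  assumes "i \<in> I" "x \<in> topspace (X i)" "pt i x = pt i y"
  shows "x = y"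
  using assms by (auto simp: pt_eq_iff common_def)

lemma topspace_glued: "topspace glued = {pt i x | i x. i \<in> I \<and> x \<in> topspace (X i)}"
  unfolding glued_space_def topspace_quotient_space quotient_def pt_def by (auto; blast)

lemma openin_glued:
  "openin glued W \<longleftrightarrow> W \<subseteq> topspace glued \<and> (\<forall>i\<in>I. openin (X i) {x \<in> topspace (X i). pt i x \<in> W})"
proof -
  have "{x. (i, x) \<in> Sigma I (topspace \<circ> X) \<and> rel `` {(i, x)} \<in> W} = {x \<in> topspace (X i). pt i x \<in> W}" if "i \<in> I" for i
    using that by (auto simp: pt_def)
  then show ?thesis
    unfolding glued_space_def openin_quotient_space topspace_quotient_space openin_sum_topology by auto
qed

text \<open>In another chart the trace of the image is a union, over the common lower charts, of
  images under open maps of preimages of \<open>V\<close>.\<close>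

lemma pt_open:
  assumes i: "i \<in> I" and V: "openin (X i) V"
  shows "openin glued (pt i ` V)"
  unfolding openin_glued
proof (intro conjI ballI)
  show "pt i ` V \<subseteq> topspace glued"
    using i openin_subset[OF V] by (auto simp: topspace_glued)
  fix j assume j: "j \<in> I"
  have "{y \<in> topspace (X j). pt j y \<in> pt i ` V} =
      (\<Union>k\<in>{k \<in> I. below k i \<and> below k j}. (\<lambda>z. restrict z (D j)) ` {z \<in> topspace (X k). restrict z (D i) \<in> V})"
    (is "?L = ?R")
  proof
    show "?L \<subseteq> ?R"
    proof
      fix y assume "y \<in> ?L"
      then obtain x where x: "x \<in> V" "pt i x = pt j y"
        by auto
      then have "common i x j y"
        using pt_eq_iff[of i x j y] i openin_subset[OF V] by blast
      with x show "y \<in> ?R"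
        by (auto simp: common_def)
    qed
    show "?R \<subseteq> ?L"
    proof
      fix y assume "y \<in> ?R"
      then obtain k z where z: "k \<in> I" "below k i" "below k j" "z \<in> topspace (X k)" "restrict z (D i) \<in> V"
        "y = restrict z (D j)"
        by auto
      then have "pt j y = pt i (restrict z (D i))"
        using i j by (simp add: pt_restrict)
      with z i j show "y \<in> ?L"
        by (auto simp: restrict_chart)
    qed
  qed
  moreover have "openin (X j) ((\<lambda>z. restrict z (D j)) ` {z \<in> topspace (X k). restrict z (D i) \<in> V})"
    if "k \<in> I" "below k i" "below k j" for k
    using chart_open[of k j] openin_continuous_map_preimage[OF chart_cont[of k i] V] that i j
    unfolding open_map_def by blast
  ultimately show "openin (X j) {y \<in> topspace (X j). pt j y \<in> pt i ` V}"
    by (auto intro!: openin_Union)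
qed

end

section \<open>Localization embeds charts\<close>

text \<open>
  Charts of a face are localizations: functions on \<open>D\<close> which are determined by their restrictions to
  \<open>D'\<close>, as \<open>sh\<close> (multiplication by the inverted element \<open>t\<close>) moves every element of \<open>D\<close> into \<open>D'\<close>.
\<close>

locale localization =
  fixes D D' :: "'f set" and sh :: "'f \<Rightarrow> 'f" and t :: 'f and P P' :: "('f \<Rightarrow> ereal) set"
  assumes P_ext: "P \<subseteq> extensional D" and P'_ext: "P' \<subseteq> extensional D'"
    and D'_D: "D' \<subseteq> D" and t: "t \<in> D'" and sh_D: "d \<in> D \<Longrightarrow> sh d \<in> D"
    and sh_ev: "d \<in> D \<Longrightarrow> \<exists>n. (sh ^^ n) d \<in> D'"
    and sh_val: "x \<in> P \<Longrightarrow> d \<in> D \<Longrightarrow> x (sh d) = x t + x d"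
    and t_fin: "x \<in> P \<Longrightarrow> x t \<noteq> \<infinity>"
    and P'_nminf: "x \<in> P' \<Longrightarrow> d \<in> D' \<Longrightarrow> x d \<noteq> -\<infinity>"
    and restrict_P': "x \<in> P \<Longrightarrow> restrict x D' \<in> P'"
    and extend_P: "x \<in> P' \<Longrightarrow> x t \<noteq> \<infinity> \<Longrightarrow> \<exists>y\<in>P. restrict y D' = x"
begin

abbreviation chart :: "('f \<Rightarrow> ereal) topology" where
  "chart \<equiv> subtopology (product_topology (\<lambda>_. euclidean) D) P"

abbreviation chart' :: "('f \<Rightarrow> ereal) topology" where
  "chart' \<equiv> subtopology (product_topology (\<lambda>_. euclidean) D') P'"

lemma topspace_charts: "topspace chart = P" "topspace chart' = P'"
  using P_ext P'_ext by (auto simp: PiE_def)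

text \<open>\<open>d\<close> is a fraction whose denominator is the \<open>n\<close>-th power of
  \<open>t\<close>, so its value is that of the numerator minus \<open>n\<close> times the finite
  value of \<open>t\<close>.\<close>

lemma val_eq:
  assumes x: "x \<in> P" and d: "d \<in> D"
  shows "x d = x ((sh ^^ n) d) + ereal (- (real n * real_of_ereal (x t)))"
proof -
  have "x t \<noteq> -\<infinity>"
    using P'_nminf[OF restrict_P'[OF x] t] t by simp
  with t_fin[OF x] obtain c where c: "x t = ereal c"
    by (cases "x t") auto
  have "(sh ^^ n) d \<in> D \<and> x ((sh ^^ n) d) = x d + ereal (real n * c)"
  proof (induction n)
    case (Suc n)
    then show ?case
      using sh_val[OF x, of "(sh ^^ n) d"] c by (cases "x d") (auto simp: sh_D algebra_simps)
  qed (use d in simp)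
  then show ?thesis
    using c by (cases "x d") auto
qed

lemma restrict_inj: "inj_on (\<lambda>x. restrict x D') P"
proof (rule inj_onI)
  fix x y assume x: "x \<in> P" and y: "y \<in> P" and eq: "restrict x D' = restrict y D'"
  then have eq': "x d = y d" if "d \<in> D'" for d
    using that by (metis restrict_apply')
  show "x = y"
  proof
    fix d
    show "x d = y d"
    proof (cases "d \<in> D")
      case True
      then obtain n where n: "(sh ^^ n) d \<in> D'"
        using sh_ev by blast
      show ?thesis
        using val_eq[OF x True, of n] val_eq[OF y True, of n] eq'[OF n] eq'[OF t] by simp
    next
      case False
      then show ?thesis
        using extensional_arb[OF subsetD[OF P_ext]] x y by metis
    qed
  qed
qed

lemma restrict_continuous: "continuous_map chart chart' (\<lambda>x. restrict x D')"
proof -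
  have "continuous_map chart (product_topology (\<lambda>_. euclidean) D') (\<lambda>x. restrict x D')"
    unfolding continuous_map_componentwise using D'_D
    by (auto intro!: continuous_map_from_subtopology continuous_map_product_projection)
  then show ?thesis
    using restrict_P' by (auto simp: continuous_map_in_subtopology)
qed

text \<open>On the open locus where \<open>t\<close> has finite value the restriction has a
  continuous inverse \<open>g\<close>, given by the formula of \<open>val_eq\<close>. The image of
  \<open>V\<close> is the preimage of \<open>V\<close> under \<open>g\<close>.\<close>

lemma restrict_open: "open_map chart chart' (\<lambda>x. restrict x D')"
  unfolding open_map_def
proof (intro allI impI)
  fix V assume V: "openin chart V"
  define N where "N d = (SOME n. (sh ^^ n) d \<in> D')" for d
  have N: "(sh ^^ N d) d \<in> D'" if "d \<in> D" for d
    unfolding N_def by (rule someI_ex[OF sh_ev[OF that]])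
  define g where "g x = (\<lambda>d\<in>D. x ((sh ^^ N d) d) + ereal (- (real (N d) * real_of_ereal (x t))))" for x
  have gr: "g (restrict y D') = y" if y: "y \<in> P" for y
  proof
    fix d
    show "g (restrict y D') d = y d"
      using N[of d] t val_eq[OF y, of d "N d"] P_ext y by (cases "d \<in> D") (auto simp: g_def extensional_def)
  qed
  define O' where "O' = {x \<in> topspace chart'. x t \<in> - {\<infinity>}}"
  have O': "openin chart' O'"
    unfolding O'_def
  proof (rule openin_continuous_map_preimage)
    show "continuous_map chart' euclidean (\<lambda>x. x t)"
      using t by (intro continuous_map_from_subtopology continuous_map_product_projection)
    show "openin euclidean (- {\<infinity>::ereal})"
      by (simp add: open_Compl)
  qed
  have O'P: "\<exists>y\<in>P. restrict y D' = x" if "x \<in> O'" for x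
    using that extend_P topspace_charts by (auto simp: O'_def)
  let ?Y = "subtopology chart' O'"
  have topY: "topspace ?Y = O'"
    using openin_subset[OF O'] by auto
  have "continuous_map ?Y euclidean (\<lambda>x. g x d)" if d: "d \<in> D" for d
    unfolding continuous_map_atin limitin_canonical_iff
  proof
    fix x0 assume x0: "x0 \<in> topspace ?Y"
    have proj: "((\<lambda>x. x e) \<longlongrightarrow> x0 e) (atin ?Y x0)" if e: "e \<in> D'" for e
    proof -
      have "continuous_map ?Y euclidean (\<lambda>x. x e)"
        using e by (intro continuous_map_from_subtopology continuous_map_product_projection)
      with x0 show ?thesis
        unfolding continuous_map_atin limitin_canonical_iff by blast
    qed
    have x0P: "x0 \<in> P'" "x0 t \<noteq> \<infinity>"
      using x0 topY topspace_charts by (auto simp: O'_def)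
    have "x0 t \<noteq> -\<infinity>"
      by (rule P'_nminf[OF x0P(1) t])
    with x0P(2) have "x0 t = ereal (real_of_ereal (x0 t))"
      by (cases "x0 t") auto
    then have "((\<lambda>x. real_of_ereal (x t)) \<longlongrightarrow> real_of_ereal (x0 t)) (atin ?Y x0)"
      using proj[OF t] by (metis lim_real_of_ereal)
    then have "((\<lambda>x. - (real (N d) * real_of_ereal (x t))) \<longlongrightarrow>
        - (real (N d) * real_of_ereal (x0 t))) (atin ?Y x0)"
      by (intro tendsto_minus tendsto_mult_left)
    then have "((\<lambda>x. ereal (- (real (N d) * real_of_ereal (x t)))) \<longlongrightarrow>
        ereal (- (real (N d) * real_of_ereal (x0 t)))) (atin ?Y x0)"
      by (rule tendsto_ereal)
    then have "((\<lambda>x. x ((sh ^^ N d) d) + ereal (- (real (N d) * real_of_ereal (x t)))) \<longlongrightarrow>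
        x0 ((sh ^^ N d) d) + ereal (- (real (N d) * real_of_ereal (x0 t)))) (atin ?Y x0)"
      using P'_nminf[OF x0P(1) N[OF d]] by (intro tendsto_add_ereal_nonneg proj N d) auto
    then show "((\<lambda>x. g x d) \<longlongrightarrow> g x0 d) (atin ?Y x0)"
      using d by (simp add: g_def)
  qed
  then have "continuous_map ?Y (product_topology (\<lambda>_. euclidean) D) g"
    unfolding continuous_map_componentwise by (auto simp: g_def)
  moreover have "g x \<in> P" if "x \<in> O'" for x
    using O'P[OF that] gr by auto
  ultimately have "continuous_map ?Y chart g"
    using topY by (auto simp: continuous_map_in_subtopology)
  then have "openin ?Y {x \<in> topspace ?Y. g x \<in> V}"
    using V by (rule openin_continuous_map_preimage)
  then have "openin chart' {x \<in> O'. g x \<in> V}"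
    unfolding topY by (simp only: openin_open_subtopology[OF O'])
  moreover have "{x \<in> O'. g x \<in> V} = (\<lambda>x. restrict x D') ` V"
  proof
    show "{x \<in> O'. g x \<in> V} \<subseteq> (\<lambda>x. restrict x D') ` V"
      using O'P gr by force
    have "V \<subseteq> P"
      using openin_subset[OF V] topspace_charts by simp
    then show "(\<lambda>x. restrict x D') ` V \<subseteq> {x \<in> O'. g x \<in> V}"
      using gr t_fin restrict_P' t by (auto simp: O'_def topspace_charts(2))
  qed
  ultimately show "openin chart' ((\<lambda>x. restrict x D') ` V)"
    by simp
qed

end

section \<open>Faces of finitely generated cones\<close>

lemma dual_lattice_zero: "0 \<in> carrier (dual_lattice G)"
  and dual_lattice_add: "u \<in> carrier (dual_lattice G) \<Longrightarrow> u' \<in> carrier (dual_lattice G) \<Longrightarrow>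
    u + u' \<in> carrier (dual_lattice G)"
  and dual_lattice_uminus: "u \<in> carrier (dual_lattice G) \<Longrightarrow> - u \<in> carrier (dual_lattice G)"
  by (auto simp: dual_lattice_def hom_def)

lemma lattice_point_add:
  assumes "u \<in> carrier (dual_lattice G)" "u' \<in> carrier (dual_lattice G)"
  shows "lattice_point G n (u + u') = lattice_point G n u + lattice_point G n u'"
  using assms by (simp add: lattice_point_def dual_lattice_add)

definition finite_cone :: "('a, 'b) monoid_scheme \<Rightarrow> (('a \<Rightarrow> int) \<Rightarrow> real) set \<Rightarrow> bool" where
  "finite_cone G \<sigma> \<longleftrightarrow> (\<exists>R. finite R \<and> \<sigma> = cone_over G R)"

lemma cone_over_add:
  assumes "x \<in> cone_over G R" "u \<in> carrier (dual_lattice G)" "u' \<in> carrier (dual_lattice G)"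
  shows "x (u + u') = x u + x u'"
  using assms by (auto simp: cone_over_def lattice_point_add distrib_left sum.distrib)

lemma cone_over_apply:
  "u \<in> carrier (dual_lattice G) \<Longrightarrow> (\<Sum>n\<in>R. c n * lattice_point G n u) = (\<Sum>n\<in>R. c n * of_int (u n))"
  by (simp add: lattice_point_def)

lemma lattice_point_in_cone_over:
  assumes "finite R" "n \<in> R"
  shows "lattice_point G n \<in> cone_over G R"
  unfolding cone_over_def
proof (intro CollectI exI[of _ "\<lambda>m. if m = n then 1 else 0"] conjI)
  show "lattice_point G n = (\<lambda>u. \<Sum>m\<in>R. (if m = n then 1 else 0) * lattice_point G m u)"
    using assms by (auto simp: if_distrib[of "\<lambda>c. c * _"] sum.delta cong: if_cong)
qed auto

lemma dual_monoid_cone_over: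
  assumes "finite R"
  shows "dual_monoid G (cone_over G R) = {u \<in> carrier (dual_lattice G). \<forall>n\<in>R. 0 \<le> u n}"
proof -
  have "0 \<le> u n" if "u \<in> dual_monoid G (cone_over G R)" "n \<in> R" for u n
    using that lattice_point_in_cone_over[OF assms, of n G]
    by (force simp: dual_monoid_def lattice_point_def)
  moreover have "u \<in> dual_monoid G (cone_over G R)" if "u \<in> carrier (dual_lattice G)" "\<forall>n\<in>R. 0 \<le> u n" for u
    using that by (auto simp: dual_monoid_def cone_over_def lattice_point_def intro!: sum_nonneg)
  ultimately show ?thesis
    by (auto simp: dual_monoid_def)
qed

lemma face_cone_over:
  assumes R: "finite R" and u: "u \<in> dual_monoid G (cone_over G R)"
  shows "{x \<in> cone_over G R. x u = 0} = cone_over G {n \<in> R. u n = 0}"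
proof
  have uU: "u \<in> carrier (dual_lattice G)" and un: "\<And>n. n \<in> R \<Longrightarrow> 0 \<le> u n"
    using u R by (auto simp: dual_monoid_cone_over)
  show "{x \<in> cone_over G R. x u = 0} \<subseteq> cone_over G {n \<in> R. u n = 0}"
  proof
    fix x assume x: "x \<in> {x \<in> cone_over G R. x u = 0}"
    then obtain c where c: "\<forall>n\<in>R. 0 \<le> c n" "x = (\<lambda>u. \<Sum>n\<in>R. c n * lattice_point G n u)"
      by (auto simp: cone_over_def)
    then have "(\<Sum>n\<in>R. c n * of_int (u n)) = 0"
      using x uU by (simp add: cone_over_apply)
    then have "\<forall>n\<in>R. c n * of_int (u n) = 0"
      using R c un by (subst (asm) sum_nonneg_eq_0_iff) auto
    then have z: "c n = 0" if "n \<in> R" "u n \<noteq> 0" for n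
      using that by auto
    have "x = (\<lambda>u'. \<Sum>n\<in>{n \<in> R. u n = 0}. c n * lattice_point G n u')"
      unfolding c(2) using R z by (intro ext sum.mono_neutral_right) auto
    with c(1) show "x \<in> cone_over G {n \<in> R. u n = 0}"
      unfolding cone_over_def by (intro CollectI exI[of _ c]) auto
  qed
  show "cone_over G {n \<in> R. u n = 0} \<subseteq> {x \<in> cone_over G R. x u = 0}"
  proof
    fix x assume "x \<in> cone_over G {n \<in> R. u n = 0}"
    then obtain c where c: "\<forall>n\<in>{n \<in> R. u n = 0}. 0 \<le> c n"
      "x = (\<lambda>u'. \<Sum>n\<in>{n \<in> R. u n = 0}. c n * lattice_point G n u')"
      by (auto simp: cone_over_def)
    have "x u = 0"
      unfolding c(2) by (intro sum.neutral) (auto simp: lattice_point_def)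
    moreover have "x = (\<lambda>u'. \<Sum>n\<in>R. (if u n = 0 then c n else 0) * lattice_point G n u')"
      unfolding c(2) using R by (intro ext sum.mono_neutral_cong_left) auto
    then have "x \<in> cone_over G R"
      unfolding cone_over_def using c(1) by (intro CollectI exI[of _ "\<lambda>n. if u n = 0 then c n else 0"]) auto
    ultimately show "x \<in> {x \<in> cone_over G R. x u = 0}"
      by simp
  qed
qed

lemma finite_cone_face:
  assumes "finite_cone G \<sigma>" "cone_face G \<tau> \<sigma>"
  shows "finite_cone G \<tau>"
proof -
  obtain R u where "finite R" "\<sigma> = cone_over G R" "u \<in> dual_monoid G \<sigma>" "\<tau> = {x \<in> \<sigma>. x u = 0}"
    using assms by (auto simp: finite_cone_def cone_face_def)
  then show ?thesis
    unfolding finite_cone_def by (intro exI[of _ "{n \<in> R. u n = 0}"]) (simp add: face_cone_over)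
qed

lemma finite_cone_add:
  "finite_cone G \<sigma> \<Longrightarrow> x \<in> \<sigma> \<Longrightarrow> u \<in> carrier (dual_lattice G) \<Longrightarrow> u' \<in> carrier (dual_lattice G) \<Longrightarrow>
    x (u + u') = x u + x u'"
  by (auto simp: finite_cone_def intro: cone_over_add)

lemma dual_monoid_add:
  "finite_cone G \<sigma> \<Longrightarrow> u \<in> dual_monoid G \<sigma> \<Longrightarrow> u' \<in> dual_monoid G \<sigma> \<Longrightarrow> u + u' \<in> dual_monoid G \<sigma>"
  by (auto simp: dual_monoid_def dual_lattice_add finite_cone_add)

lemma finite_cone_zero_apply: "finite_cone G \<sigma> \<Longrightarrow> x \<in> \<sigma> \<Longrightarrow> x 0 = 0"
  using finite_cone_add[of G \<sigma> x 0 0] dual_lattice_zero[of G] by simp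

lemma dual_monoid_zero: "finite_cone G \<sigma> \<Longrightarrow> 0 \<in> dual_monoid G \<sigma>"
  by (auto simp: dual_monoid_def dual_lattice_zero finite_cone_zero_apply)

lemma cone_face_refl: "finite_cone G \<sigma> \<Longrightarrow> cone_face G \<sigma> \<sigma>"
  unfolding cone_face_def by (intro bexI[of _ 0] dual_monoid_zero) (auto simp: finite_cone_zero_apply)

lemma dual_monoid_face: "cone_face G \<tau> \<sigma> \<Longrightarrow> dual_monoid G \<sigma> \<subseteq> dual_monoid G \<tau>"
  by (auto simp: dual_monoid_def cone_face_def)

lemma funpow_plus_in: "((\<lambda>b. u + b) ^^ n) a \<in> A" if "a \<in> A" "\<And>b. b \<in> A \<Longrightarrow> u + b \<in> A"
  for u a :: "'u::plus"
  by (induction n) (use that in auto)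

lemma funpow_plus_value: "f (((\<lambda>b. u + b) ^^ n) a) = real n * f u + f a"
  if "a \<in> A" "\<And>b. b \<in> A \<Longrightarrow> u + b \<in> A" "\<And>b. b \<in> A \<Longrightarrow> f (u + b) = f u + f b"
  for u a :: "'u::plus" and f :: "'u \<Rightarrow> real"
  by (induction n) (use that funpow_plus_in[of a A u] in \<open>simp_all add: algebra_simps\<close>)

text \<open>Passing to the face inverts \<open>u\<close>: on generators off the face
  \<open>u\<close> is at least 1 by integrality, so adding it often enough makes any exponent
  nonnegative there.\<close>

lemma face_localization:
  assumes \<sigma>: "finite_cone G \<sigma>" and u: "u \<in> dual_monoid G \<sigma>" and \<tau>: "\<tau> = {x \<in> \<sigma>. x u = 0}"
  shows "- u \<in> dual_monoid G \<tau>"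
    and "a \<in> dual_monoid G \<tau> \<Longrightarrow> \<exists>n. ((\<lambda>b. u + b) ^^ n) a \<in> dual_monoid G \<sigma>"
proof -
  obtain R where R: "finite R" "\<sigma> = cone_over G R"
    using \<sigma> by (auto simp: finite_cone_def)
  have uU: "u \<in> carrier (dual_lattice G)" and un: "\<And>n. n \<in> R \<Longrightarrow> 0 \<le> u n"
    using u R by (auto simp: dual_monoid_cone_over)
  have S\<tau>: "dual_monoid G \<tau> = {u' \<in> carrier (dual_lattice G). \<forall>n\<in>R. u n = 0 \<longrightarrow> 0 \<le> u' n}"
    using R u by (auto simp: \<tau> face_cone_over dual_monoid_cone_over)
  show "- u \<in> dual_monoid G \<tau>"
    by (simp add: S\<tau> dual_lattice_uminus uU)
  assume a: "a \<in> dual_monoid G \<tau>"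
  define m where "m = nat (\<Sum>n\<in>R. \<bar>a n\<bar>)"
  have am: "- a n \<le> int m" if "n \<in> R" for n
  proof -
    have "\<bar>a n\<bar> \<le> (\<Sum>n\<in>R. \<bar>a n\<bar>)"
      using R that by (intro member_le_sum) auto
    then show ?thesis
      by (simp add: m_def)
  qed
  have val: "((\<lambda>b. u + b) ^^ m) a n = int m * u n + a n" for n m
    by (induction m) (simp_all add: algebra_simps)
  have "((\<lambda>b. u + b) ^^ m) a \<in> carrier (dual_lattice G)" for m
    by (rule funpow_plus_in) (use a uU S\<tau> in \<open>auto intro: dual_lattice_add\<close>)
  moreover have "0 \<le> int m * u n + a n" if "n \<in> R" for n
  proof (cases "u n = 0")
    case True
    then show ?thesis
      using a that by (simp add: S\<tau>)
  next
    case False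
    then have "int m * 1 \<le> int m * u n"
      using un[OF that] by (intro mult_left_mono) auto
    then show ?thesis
      using am[OF that] by simp
  qed
  ultimately have "((\<lambda>b. u + b) ^^ m) a \<in> dual_monoid G \<sigma>"
    using R by (simp add: dual_monoid_cone_over val)
  then show "\<exists>n. ((\<lambda>b. u + b) ^^ n) a \<in> dual_monoid G \<sigma>" ..
qed

text \<open>The witness is \<open>u\<close> plus a translate of \<open>u'\<close> by a multiple of
  \<open>u\<close> that lies in the dual monoid of \<open>\<sigma>\<close>. The additional
  \<open>u\<close> forces \<open>x u = 0\<close> even if that multiple is 0.\<close>

lemma cone_face_trans:
  assumes \<sigma>: "finite_cone G \<sigma>" and "cone_face G \<tau> \<sigma>" "cone_face G \<rho> \<tau>"
  shows "cone_face G \<rho> \<sigma>"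
proof -
  obtain u u' where u: "u \<in> dual_monoid G \<sigma>" and \<tau>: "\<tau> = {x \<in> \<sigma>. x u = 0}"
    and u': "u' \<in> dual_monoid G \<tau>" and \<rho>: "\<rho> = {x \<in> \<tau>. x u' = 0}"
    using assms by (auto simp: cone_face_def)
  obtain n where n: "((\<lambda>b. u + b) ^^ n) u' \<in> dual_monoid G \<sigma>" (is "?a \<in> _")
    using face_localization(2)[OF \<sigma> u \<tau> u'] by blast
  have uU: "u \<in> carrier (dual_lattice G)" "u' \<in> carrier (dual_lattice G)" "?a \<in> carrier (dual_lattice G)"
    using u u' n by (auto simp: dual_monoid_def)
  have val: "x (((\<lambda>b. u + b) ^^ n) u') = real n * x u + x u'" if "x \<in> \<sigma>" for x n
    by (rule funpow_plus_value[OF uU(2)])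
      (erule dual_lattice_add[OF uU(1)], erule finite_cone_add[OF \<sigma> that uU(1)])
  have "x u = 0 \<and> x u' = 0" if x: "x \<in> \<sigma>" "x (u + ?a) = 0" for x
  proof -
    have "0 \<le> x u" "0 \<le> x ?a"
      using u n x by (auto simp: dual_monoid_def)
    then have "x u = 0" "x ?a = 0"
      using x(2) finite_cone_add[OF \<sigma> x(1) uU(1,3)] by auto
    then show ?thesis
      using val[OF x(1)] by auto
  qed
  moreover have "x (u + ?a) = 0" if "x \<in> \<sigma>" "x u = 0" "x u' = 0" for x
    using that finite_cone_add[OF \<sigma> that(1) uU(1,3)] val[OF that(1)] by simp
  ultimately have "\<rho> = {x \<in> \<sigma>. x (u + ?a) = 0}"
    by (auto simp: \<rho> \<tau>)
  moreover have "u + ?a \<in> dual_monoid G \<sigma>"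
    by (intro dual_monoid_add \<sigma> u n)
  ultimately show ?thesis
    unfolding cone_face_def by blast
qed

section \<open>Toric gluing\<close>

text \<open>
  The common features of the Berkovich charts and the tropical charts: a chart consists of functions
  on \<open>Dm S\<close>, where \<open>mon u\<close> is the monomial with exponent \<open>u\<close> and \<open>mul u\<close> is multiplication by it.
\<close>

locale toric_charts =
  fixes Dm :: "'u::ab_group_add set \<Rightarrow> 'f set" and Pt :: "'u set \<Rightarrow> ('f \<Rightarrow> ereal) set"
    and mon :: "'u \<Rightarrow> 'f" and mul :: "'u \<Rightarrow> 'f \<Rightarrow> 'f"
  assumes Pt_ext: "Pt S \<subseteq> extensional (Dm S)"
    and Pt_nminf: "x \<in> Pt S \<Longrightarrow> d \<in> Dm S \<Longrightarrow> x d \<noteq> -\<infinity>"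
    and Dm_mono: "S \<subseteq> S' \<Longrightarrow> Dm S \<subseteq> Dm S'"
    and Pt_restrict: "0 \<in> S \<Longrightarrow> (\<And>a b. a \<in> S \<Longrightarrow> b \<in> S \<Longrightarrow> a + b \<in> S) \<Longrightarrow> S \<subseteq> S' \<Longrightarrow>
      x \<in> Pt S' \<Longrightarrow> restrict x (Dm S) \<in> Pt S"
    and mon_Dm: "u \<in> S \<Longrightarrow> mon u \<in> Dm S"
    and mul_Dm: "(\<And>a b. a \<in> S \<Longrightarrow> b \<in> S \<Longrightarrow> a + b \<in> S) \<Longrightarrow> u \<in> S \<Longrightarrow> d \<in> Dm S \<Longrightarrow> mul u d \<in> Dm S"
    and mul_val: "u \<in> S \<Longrightarrow> d \<in> Dm S \<Longrightarrow> x \<in> Pt S \<Longrightarrow> x (mul u d) = x (mon u) + x d"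
    and mon_add: "u \<in> S \<Longrightarrow> u' \<in> S \<Longrightarrow> x \<in> Pt S \<Longrightarrow> x (mon (u + u')) = x (mon u) + x (mon u')"
    and mon_zero: "0 \<in> S \<Longrightarrow> x \<in> Pt S \<Longrightarrow> x (mon 0) = 0"
    and mul_ev: "0 \<in> S \<Longrightarrow> (\<And>a b. a \<in> S \<Longrightarrow> b \<in> S \<Longrightarrow> a + b \<in> S) \<Longrightarrow> u \<in> S \<Longrightarrow>
      (\<And>a. a \<in> S' \<Longrightarrow> \<exists>n. ((\<lambda>b. u + b) ^^ n) a \<in> S) \<Longrightarrow> d \<in> Dm S' \<Longrightarrow> \<exists>n. (mul u ^^ n) d \<in> Dm S"
    and Pt_extend: "0 \<in> S \<Longrightarrow> (\<And>a b. a \<in> S \<Longrightarrow> b \<in> S \<Longrightarrow> a + b \<in> S) \<Longrightarrow>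
      (\<And>a b. a \<in> S' \<Longrightarrow> b \<in> S' \<Longrightarrow> a + b \<in> S') \<Longrightarrow> S \<subseteq> S' \<Longrightarrow> u \<in> S \<Longrightarrow>
      (\<And>a. a \<in> S' \<Longrightarrow> \<exists>n. ((\<lambda>b. u + b) ^^ n) a \<in> S) \<Longrightarrow> x \<in> Pt S \<Longrightarrow> x (mon u) \<noteq> \<infinity> \<Longrightarrow>
      \<exists>y\<in>Pt S'. restrict y (Dm S) = x"

locale toric_gluing = toric_charts Dm Pt mon mul
  for Dm :: "('a \<Rightarrow> int) set \<Rightarrow> 'f set" and Pt mon mul +
  fixes G :: "('a, 'b) monoid_scheme" and \<C> :: "(('a \<Rightarrow> int) \<Rightarrow> real) set set"
  assumes cones: "\<sigma> \<in> \<C> \<Longrightarrow> finite_cone G \<sigma>"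
begin

abbreviation "\<Delta> \<equiv> fan_of_cones G \<C>"

abbreviation dom :: "(('a \<Rightarrow> int) \<Rightarrow> real) set \<Rightarrow> 'f set" where
  "dom \<sigma> \<equiv> Dm (dual_monoid G \<sigma>)"

abbreviation chart_of :: "(('a \<Rightarrow> int) \<Rightarrow> real) set \<Rightarrow> ('f \<Rightarrow> ereal) topology" where
  "chart_of \<sigma> \<equiv> subtopology (product_topology (\<lambda>_. euclidean) (dom \<sigma>)) (Pt (dual_monoid G \<sigma>))"

lemma \<Delta>_finite: "\<sigma> \<in> \<Delta> \<Longrightarrow> finite_cone G \<sigma>"
  using cones finite_cone_face by (auto simp: fan_of_cones_def)

lemma \<C>_\<Delta>: "\<sigma> \<in> \<C> \<Longrightarrow> \<sigma> \<in> \<Delta>"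
  using cones cone_face_refl by (auto simp: fan_of_cones_def)

lemma \<Delta>_face: "\<sigma> \<in> \<Delta> \<Longrightarrow> cone_face G \<tau> \<sigma> \<Longrightarrow> \<tau> \<in> \<Delta>"
  using cones cone_face_trans by (fastforce simp: fan_of_cones_def)

lemma topspace_chart_of [simp]: "topspace (chart_of \<sigma>) = Pt (dual_monoid G \<sigma>)"
  using Pt_ext by (auto simp: PiE_def)

lemma localization_face:
  assumes \<sigma>: "\<sigma> \<in> \<Delta>" and u: "u \<in> dual_monoid G \<sigma>" and \<tau>: "\<tau> = {x \<in> \<sigma>. x u = 0}"
  shows "localization (dom \<tau>) (dom \<sigma>) (mul u) (mon u) (Pt (dual_monoid G \<tau>)) (Pt (dual_monoid G \<sigma>))"
proof -
  have face: "cone_face G \<tau> \<sigma>"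
    using u \<tau> by (auto simp: cone_face_def)
  note fin\<sigma> = \<Delta>_finite[OF \<sigma>]
  have fin\<tau>: "finite_cone G \<tau>"
    by (rule finite_cone_face[OF fin\<sigma> face])
  note sub = dual_monoid_face[OF face]
  note add = dual_monoid_add[OF fin\<sigma>] dual_monoid_add[OF fin\<tau>]
  note zero = dual_monoid_zero[OF fin\<sigma>] dual_monoid_zero[OF fin\<tau>]
  note loc = face_localization[OF fin\<sigma> u \<tau>]
  have u\<tau>: "u \<in> dual_monoid G \<tau>"
    using sub u by blast
  show ?thesis
  proof
    show "\<exists>n. (mul u ^^ n) d \<in> dom \<sigma>" if "d \<in> dom \<tau>" for d
      by (rule mul_ev[OF zero(1) add(1) u loc(2) that])
    \<comment> \<open>On the face chart \<open>- u\<close> is an exponent too, so the monomial of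
      \<open>u\<close> is invertible and has finite value.\<close>
    show "x (mon u) \<noteq> \<infinity>" if "x \<in> Pt (dual_monoid G \<tau>)" for x
    proof
      assume "x (mon u) = \<infinity>"
      then have "x (mon (u + - u)) = \<infinity>"
        using mon_add[OF u\<tau> loc(1) that] by simp
      then show False
        using mon_zero[OF zero(2) that] by simp
    qed
    show "\<exists>y\<in>Pt (dual_monoid G \<tau>). restrict y (dom \<sigma>) = x" if "x \<in> Pt (dual_monoid G \<sigma>)" "x (mon u) \<noteq> \<infinity>" for x
      by (rule Pt_extend[OF zero(1) add(1) add(2) sub u loc(2) that])
  qed (use Pt_ext Pt_nminf Dm_mono[OF sub] Pt_restrict[OF zero(1) add(1) sub] mon_Dm[OF u] mul_Dm[OF add(2) u\<tau>]
      mul_val[OF u\<tau>] in auto)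
qed

sublocale open_gluing \<Delta> "cone_face G" dom chart_of
proof
  fix \<sigma> \<tau> \<rho> assume "\<sigma> \<in> \<Delta>" "\<tau> \<in> \<Delta>" "\<rho> \<in> \<Delta>" "cone_face G \<sigma> \<tau>" "cone_face G \<tau> \<rho>"
  then show "cone_face G \<sigma> \<rho>"
    using cone_face_trans[OF \<Delta>_finite] by blast
next
  fix \<tau> \<sigma> assume \<tau>\<sigma>: "\<tau> \<in> \<Delta>" "\<sigma> \<in> \<Delta>" "cone_face G \<tau> \<sigma>"
  then obtain u where "u \<in> dual_monoid G \<sigma>" "\<tau> = {x \<in> \<sigma>. x u = 0}"
    by (auto simp: cone_face_def)
  then interpret localization "dom \<tau>" "dom \<sigma>" "mul u" "mon u" "Pt (dual_monoid G \<tau>)" "Pt (dual_monoid G \<sigma>)"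
    by (rule localization_face[OF \<tau>\<sigma>(2)])
  show "continuous_map (chart_of \<tau>) (chart_of \<sigma>) (\<lambda>x. restrict x (dom \<sigma>))"
    by (rule restrict_continuous)
  show "inj_on (\<lambda>x. restrict x (dom \<sigma>)) (topspace (chart_of \<tau>))"
    by (rule inj_on_subset[OF restrict_inj]) auto
  show "open_map (chart_of \<tau>) (chart_of \<sigma>) (\<lambda>x. restrict x (dom \<sigma>))"
    by (rule restrict_open)
  show "dom \<sigma> \<subseteq> dom \<tau>"
    by (rule D'_D)
next
  fix \<sigma> \<tau>1 \<tau>2 y z assume *: "\<sigma> \<in> \<Delta>" "\<tau>1 \<in> \<Delta>" "\<tau>2 \<in> \<Delta>" "cone_face G \<tau>1 \<sigma>" "cone_face G \<tau>2 \<sigma>"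
    "y \<in> topspace (chart_of \<tau>1)" "z \<in> topspace (chart_of \<tau>2)" "restrict y (dom \<sigma>) = restrict z (dom \<sigma>)"
  obtain u1 u2 where u1: "u1 \<in> dual_monoid G \<sigma>" "\<tau>1 = {x \<in> \<sigma>. x u1 = 0}"
    and u2: "u2 \<in> dual_monoid G \<sigma>" "\<tau>2 = {x \<in> \<sigma>. x u2 = 0}"
    using * by (auto simp: cone_face_def)
  note fin\<sigma> = \<Delta>_finite[OF *(1)]
  interpret l1: localization "dom \<tau>1" "dom \<sigma>" "mul u1" "mon u1" "Pt (dual_monoid G \<tau>1)" "Pt (dual_monoid G \<sigma>)"
    by (rule localization_face[OF *(1) u1])
  interpret l2: localization "dom \<tau>2" "dom \<sigma>" "mul u2" "mon u2" "Pt (dual_monoid G \<tau>2)" "Pt (dual_monoid G \<sigma>)"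
    by (rule localization_face[OF *(1) u2])
  \<comment> \<open>The intersection of two faces is cut out by the sum of their exponents. A point
    finite at both monomials is finite at their product and hence extends to the chart of the
    intersection.\<close>
  define \<rho> where "\<rho> = {x \<in> \<sigma>. x (u1 + u2) = 0}"
  have u12: "u1 + u2 \<in> dual_monoid G \<sigma>"
    by (rule dual_monoid_add[OF fin\<sigma> u1(1) u2(1)])
  interpret l: localization "dom \<rho>" "dom \<sigma>" "mul (u1 + u2)" "mon (u1 + u2)" "Pt (dual_monoid G \<rho>)" "Pt (dual_monoid G \<sigma>)"
    by (rule localization_face[OF *(1) u12 \<rho>_def])
  have x12: "x (u1 + u2) = 0 \<longleftrightarrow> x u1 = 0 \<and> x u2 = 0" if "x \<in> \<sigma>" for x
  proof -
    have "0 \<le> x u1" "0 \<le> x u2" "x (u1 + u2) = x u1 + x u2"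
      using u1 u2 that finite_cone_add[OF fin\<sigma> that] by (auto simp: dual_monoid_def)
    then show ?thesis
      by auto
  qed
  have "cone_face G \<rho> \<sigma>"
    unfolding cone_face_def using u12 \<rho>_def by blast
  then have \<rho>: "\<rho> \<in> \<Delta>"
    by (rule \<Delta>_face[OF *(1)])
  have "\<rho> = {x \<in> \<tau>1. x u2 = 0}" "\<rho> = {x \<in> \<tau>2. x u1 = 0}"
    using x12 by (auto simp: \<rho>_def u1 u2)
  moreover have "u2 \<in> dual_monoid G \<tau>1" "u1 \<in> dual_monoid G \<tau>2"
    using dual_monoid_face *(4,5) u1 u2 by blast+
  ultimately have faces: "cone_face G \<rho> \<tau>1" "cone_face G \<rho> \<tau>2"
    unfolding cone_face_def by blast+
  let ?x = "restrict y (dom \<sigma>)"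
  have yP: "y \<in> Pt (dual_monoid G \<tau>1)" and zP: "z \<in> Pt (dual_monoid G \<tau>2)"
    using *(6,7) by simp_all
  have xP: "?x \<in> Pt (dual_monoid G \<sigma>)"
    by (rule l1.restrict_P'[OF yP])
  have "?x (mon u1) \<noteq> \<infinity>"
    using l1.t_fin[OF yP] l1.t by simp
  moreover have "?x (mon u2) \<noteq> \<infinity>"
    using l2.t_fin[OF zP] l2.t unfolding *(8) by simp
  ultimately have "?x (mon (u1 + u2)) \<noteq> \<infinity>"
    using mon_add[OF u1(1) u2(1) xP] by simp
  from l.extend_P[OF xP this] show "\<exists>l\<in>\<Delta>. cone_face G l \<tau>1 \<and> cone_face G l \<tau>2 \<and>
      (\<exists>x\<in>topspace (chart_of l). restrict x (dom \<sigma>) = restrict y (dom \<sigma>))"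
    unfolding topspace_chart_of using \<rho> faces by blast
qed (use cone_face_refl[OF \<Delta>_finite] Pt_ext in auto)

lemma chart_extend:
  assumes "\<sigma> \<in> \<Delta>" "u \<in> dual_monoid G \<sigma>" "x \<in> Pt (dual_monoid G \<sigma>)" "x (mon u) \<noteq> \<infinity>"
  shows "\<exists>y\<in>Pt (dual_monoid G {x \<in> \<sigma>. x u = 0}). restrict y (dom \<sigma>) = x"
proof -
  interpret localization "dom {x \<in> \<sigma>. x u = 0}" "dom \<sigma>" "mul u" "mon u"
    "Pt (dual_monoid G {x \<in> \<sigma>. x u = 0})" "Pt (dual_monoid G \<sigma>)"
    by (rule localization_face[OF assms(1,2) refl])
  show ?thesis
    by (rule extend_P[OF assms(3,4)])
qed

end

section \<open>Extending points to a localization\<close>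

definition localized_value :: "('f \<Rightarrow> 'f) \<Rightarrow> 'f set \<Rightarrow> ('f \<Rightarrow> ereal) \<Rightarrow> real \<Rightarrow> 'f \<Rightarrow> ereal" where
  "localized_value sh D x c d =
     (let n = SOME n. (sh ^^ n) d \<in> D in x ((sh ^^ n) d) + ereal (- (real n * c)))"

text \<open>The value of a fraction does not depend on the power of the denominator: two admissible
  powers are compared through their sum, as iterates of \<open>sh\<close> commute.\<close>

lemma localized_value_eq:
  assumes sh: "\<And>d. d \<in> D \<Longrightarrow> sh d \<in> D" and val: "\<And>d. d \<in> D \<Longrightarrow> x (sh d) = ereal c + x d"
    and n: "(sh ^^ n) d \<in> D"
  shows "localized_value sh D x c d = x ((sh ^^ n) d) + ereal (- (real n * c))"
proof -
  define N where "N = (SOME n. (sh ^^ n) d \<in> D)"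
  have N: "(sh ^^ N) d \<in> D"
    unfolding N_def by (rule someI[of _ n]) (rule n)
  have up: "(sh ^^ m) b \<in> D \<and> x ((sh ^^ m) b) = x b + ereal (real m * c)" if "b \<in> D" for m b
  proof (induction m)
    case (Suc m)
    then show ?case
      using sh val[of "(sh ^^ m) b"] by (cases "x b") (auto simp: algebra_simps)
  qed (use that in simp)
  have "(sh ^^ n) ((sh ^^ N) d) = (sh ^^ N) ((sh ^^ n) d)"
    by (simp add: funpow_add[symmetric, unfolded comp_def, THEN fun_cong] add.commute)
  then have "x ((sh ^^ N) d) + ereal (real n * c) = x ((sh ^^ n) d) + ereal (real N * c)"
    using up[OF N, of n] up[OF n, of N] by simp
  then have "x ((sh ^^ N) d) + ereal (- (real N * c)) = x ((sh ^^ n) d) + ereal (- (real n * c))"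
    by (cases "x ((sh ^^ N) d)"; cases "x ((sh ^^ n) d)") auto
  then show ?thesis
    by (simp add: localized_value_def N_def Let_def)
qed

lemma ereal_shift_add:
  "(\<alpha> + \<beta>) + ereal (- (real (n + m) * c)) = (\<alpha> + ereal (- (real n * c))) + (\<beta> + ereal (- (real m * c)))"
  by (cases \<alpha>; cases \<beta>) (auto simp: algebra_simps)

lemma ereal_min_add: "min \<alpha> \<beta> + ereal r = min (\<alpha> + ereal r) (\<beta> + ereal r)"
  by (cases \<alpha>; cases \<beta>) (auto simp: min_def)

lemma funpow_plus_plus:
  "((\<lambda>b. u + b) ^^ (n + m)) (a + b) = ((\<lambda>b. u + b) ^^ n) a + ((\<lambda>b. u + b) ^^ m) b"
  for u a b :: "'u::ab_group_add"
proof (induction n)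
  case 0
  show ?case
    by (induction m) (simp_all add: ac_simps)
qed (simp add: ac_simps)

text \<open>Only the extension axiom takes work: the extension is the localized value, and
  additivity is checked after adding enough copies of \<open>u\<close> to each summand.\<close>

interpretation tropical: toric_charts "\<lambda>S. S" tropical_points "\<lambda>u. u :: 'u::ab_group_add" "\<lambda>u b. u + b"
proof
  fix S S' :: "'u set" and u x
  assume zero: "0 \<in> S" and add: "\<And>a b. a \<in> S \<Longrightarrow> b \<in> S \<Longrightarrow> a + b \<in> S" and sub: "S \<subseteq> S'"
    and u: "u \<in> S" and ev: "\<And>a. a \<in> S' \<Longrightarrow> \<exists>n. ((\<lambda>b. u + b) ^^ n) a \<in> S"
    and add': "\<And>a b. a \<in> S' \<Longrightarrow> b \<in> S' \<Longrightarrow> a + b \<in> S'"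
    and x: "x \<in> tropical_points S" and fin: "x u \<noteq> \<infinity>"
  have xD: "x a \<noteq> -\<infinity>" "x (a + b) = x a + x b" "x 0 = 0" "x \<in> extensional S" if "a \<in> S" "b \<in> S" for a b
    using x that by (auto simp: tropical_points_def)
  from xD(1)[OF u u] fin obtain c where c: "x u = ereal c"
    by (cases "x u") auto
  have shS: "u + d \<in> S" "x (u + d) = ereal c + x d" if "d \<in> S" for d
    using add[OF u that] xD(2)[OF u that] c by auto
  define y where "y = (\<lambda>a\<in>S'. localized_value (\<lambda>b. u + b) S x c a)"
  have y: "y a = x (((\<lambda>b. u + b) ^^ n) a) + ereal (- (real n * c))"
    if "a \<in> S'" "((\<lambda>b. u + b) ^^ n) a \<in> S" for a n
    unfolding y_def using that localized_value_eq[of S "\<lambda>b. u + b" x c n a] shS by simp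
  have yx: "y a = x a" if "a \<in> S" for a
    using y[of a 0] that sub by (simp add: zero_ereal_def[symmetric] subsetD)
  have "y \<in> tropical_points S'"
    unfolding tropical_points_def
  proof (intro CollectI conjI ballI)
    fix a assume a: "a \<in> S'"
    obtain n where n: "((\<lambda>b. u + b) ^^ n) a \<in> S"
      using ev[OF a] by blast
    show "y a \<noteq> -\<infinity>"
      using y[OF a n] xD(1)[OF n n] by simp
    fix b assume b: "b \<in> S'"
    obtain m where m: "((\<lambda>b. u + b) ^^ m) b \<in> S"
      using ev[OF b] by blast
    have nm: "((\<lambda>b. u + b) ^^ (n + m)) (a + b) \<in> S"
      using add[OF n m] by (simp only: funpow_plus_plus)
    have "y (a + b) = x (((\<lambda>b. u + b) ^^ n) a + ((\<lambda>b. u + b) ^^ m) b) + ereal (- (real (n + m) * c))"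
      using y[OF add'[OF a b] nm] by (simp only: funpow_plus_plus)
    also have "\<dots> = y a + y b"
      unfolding xD(2)[OF n m] y[OF a n] y[OF b m] by (rule ereal_shift_add)
    finally show "y (a + b) = y a + y b" .
  qed (use yx[OF zero] xD(3)[OF u u] in \<open>auto simp: y_def\<close>)
  moreover have "restrict y S = x"
    using yx xD(4)[OF u u] by (auto simp: extensional_def fun_eq_iff)
  ultimately show "\<exists>y\<in>tropical_points S'. restrict y S = x"
    by blast
qed (auto simp: tropical_points_def subset_iff)

text \<open>The support is finite, so the sum of the powers needed for its elements serves as a
  common denominator.\<close>

lemma monoid_algebra_localize:
  fixes d :: "'u::ab_group_add \<Rightarrow>\<^sub>0 'k::field"
  assumes add: "\<And>a b. a \<in> S \<Longrightarrow> b \<in> S \<Longrightarrow> a + b \<in> S" and u: "u \<in> S"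
    and ev: "\<And>a. a \<in> S' \<Longrightarrow> \<exists>n. ((\<lambda>b. u + b) ^^ n) a \<in> S" and d: "d \<in> carrier (monoid_algebra S')"
  shows "\<exists>n. ((*) (single u 1) ^^ n) d \<in> carrier (monoid_algebra S)"
proof -
  have keys: "keys (((*) (single u 1) ^^ n) d) \<subseteq> ((\<lambda>b. u + b) ^^ n) ` keys d" for n
  proof (induction n)
    case (Suc n)
    show ?case
      using keys_mult[of "single u 1" "((*) (single u 1) ^^ n) d"] Suc by fastforce
  qed simp
  have "\<forall>a\<in>keys d. \<exists>n. ((\<lambda>b. u + b) ^^ n) a \<in> S"
    using ev d by (auto simp: monoid_algebra_def)
  then obtain n where n: "\<And>a. a \<in> keys d \<Longrightarrow> ((\<lambda>b. u + b) ^^ n a) a \<in> S"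
    by metis
  define m where "m = sum n (keys d)"
  have "((\<lambda>b. u + b) ^^ m) a \<in> S" if a: "a \<in> keys d" for a
  proof -
    have "n a \<le> m"
      unfolding m_def using a by (intro member_le_sum) auto
    then have "((\<lambda>b. u + b) ^^ m) a = ((\<lambda>b. u + b) ^^ (m - n a)) (((\<lambda>b. u + b) ^^ n a) a)"
      by (metis comp_apply funpow_add le_add_diff_inverse2)
    also have "\<dots> \<in> S"
      by (rule funpow_plus_in) (use n[OF a] add u in auto)
    finally show ?thesis .
  qed
  with keys[of m] show ?thesis
    by (auto simp: monoid_algebra_def)
qed

lemma (in valued_field) toric_charts_berkovich:
  "toric_charts (\<lambda>S. carrier (monoid_algebra S)) (berkovich_points v)
     (\<lambda>u. single u 1) (\<lambda>u f. single (u::'u::ab_group_add) 1 * f)"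
proof
  fix S :: "'u set" and x assume "0 \<in> S" "x \<in> berkovich_points v S"
  then show "x (single 0 1) = 0"
    by (simp only: berkovich_points_def mem_Collect_eq v_one)
next
  fix S :: "'u set" and u u' x assume u: "u \<in> S" "u' \<in> S" and x: "x \<in> berkovich_points v S"
  have "x (single u 1 * single u' 1) = x (single u 1) + x (single u' 1)"
    using u x by (simp add: berkovich_points_def monoid_algebra_def)
  then show "x (single (u + u') 1) = x (single u 1) + x (single u' 1)"
    by (simp add: mult_single)
next
  fix S S' :: "'u set" and x
  assume zero: "0 \<in> S" and add: "\<And>a b. a \<in> S \<Longrightarrow> b \<in> S \<Longrightarrow> a + b \<in> S" and sub: "S \<subseteq> S'"
    and x: "x \<in> berkovich_points v S'"
  interpret S: valued_monoid v S
    by standard (use zero add in auto)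
  have "f \<in> carrier (monoid_algebra S')" if "f \<in> S.A" for f
    using that sub by (auto simp: monoid_algebra_def)
  then show "restrict x (carrier (monoid_algebra S)) \<in> berkovich_points v S"
    using x by (auto simp: berkovich_points_def S.A_mult S.A_add S.A_single zero)
next
  fix S :: "'u set" and u and d :: "'u \<Rightarrow>\<^sub>0 'k"
  assume add: "\<And>a b. a \<in> S \<Longrightarrow> b \<in> S \<Longrightarrow> a + b \<in> S" and u: "u \<in> S" and d: "d \<in> carrier (monoid_algebra S)"
  show "single u 1 * d \<in> carrier (monoid_algebra S)"
    using keys_mult[of "single u 1" d] add u d by (fastforce simp: monoid_algebra_def)
next
  fix S S' :: "'u set" and u and d :: "'u \<Rightarrow>\<^sub>0 'k"
  assume add: "\<And>a b. a \<in> S \<Longrightarrow> b \<in> S \<Longrightarrow> a + b \<in> S" and u: "u \<in> S"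
    and ev: "\<And>a. a \<in> S' \<Longrightarrow> \<exists>n. ((\<lambda>b. u + b) ^^ n) a \<in> S" and d: "d \<in> carrier (monoid_algebra S')"
  show "\<exists>n. ((*) (single u 1) ^^ n) d \<in> carrier (monoid_algebra S)"
    by (rule monoid_algebra_localize[OF add u ev d])
next
  fix S S' :: "'u set" and u x
  assume zero: "0 \<in> S" and add: "\<And>a b. a \<in> S \<Longrightarrow> b \<in> S \<Longrightarrow> a + b \<in> S" and sub: "S \<subseteq> S'"
    and u: "u \<in> S" and ev: "\<And>a. a \<in> S' \<Longrightarrow> \<exists>n. ((\<lambda>b. u + b) ^^ n) a \<in> S"
    and add': "\<And>a b. a \<in> S' \<Longrightarrow> b \<in> S' \<Longrightarrow> a + b \<in> S'"
    and x: "x \<in> berkovich_points v S" and fin: "x (single u 1) \<noteq> \<infinity>"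
  interpret S: valued_monoid v S
    by standard (use zero add in auto)
  interpret S': valued_monoid v S'
    by standard (use zero sub add' in auto)
  show "\<exists>y\<in>berkovich_points v S'. restrict y (carrier (monoid_algebra S)) = x"
  proof -
    let ?t = "single u (1::'k)"
    note xD = S.berkovich_pointsD[OF x]
    have tA: "?t \<in> S.A"
      by (rule S.A_single[OF u])
    from xD(2)[OF tA] fin obtain c where c: "x ?t = ereal c"
      by (cases "x ?t") auto
    have shS: "?t * d \<in> S.A" "x (?t * d) = ereal c + x d" if "d \<in> S.A" for d
      using S.A_mult[OF tA that] xD(3)[OF tA that] c by auto
    have pow: "((*) ?t ^^ n) f = ?t ^ n * f" for n f
      by (induction n) (simp_all add: mult.assoc)
    have ev': "\<exists>n. ?t ^ n * f \<in> S.A" if "f \<in> S'.A" for f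
      using monoid_algebra_localize[OF add u ev that] unfolding pow .
    define y where "y = (\<lambda>f\<in>S'.A. localized_value ((*) ?t) S.A x c f)"
    have y: "y f = x (?t ^ n * f) + ereal (- (real n * c))" if "f \<in> S'.A" "?t ^ n * f \<in> S.A" for f n
      unfolding y_def using that localized_value_eq[of S.A "(*) ?t" x c n f] shS by (simp add: pow)
    have sub': "f \<in> S'.A" if "f \<in> S.A" for f
      using that sub by (auto simp: S.A_iff S'.A_iff)
    have yx: "y f = x f" if "f \<in> S.A" for f
      using y[of f 0] that sub'[OF that] by (simp add: zero_ereal_def[symmetric])
    have "y \<in> berkovich_points v S'"
      unfolding berkovich_points_def
    proof (intro CollectI conjI ballI allI)
      show "y (single 0 k) = v k" for k
        using yx[OF S.A_single[OF zero]] xD(1) by simp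
      fix f assume f: "f \<in> S'.A"
      obtain n where n: "?t ^ n * f \<in> S.A"
        using ev'[OF f] by blast
      show "y f \<noteq> -\<infinity>"
        using y[OF f n] xD(2)[OF n] by simp
      fix g assume g: "g \<in> S'.A"
      obtain m where m: "?t ^ m * g \<in> S.A"
        using ev'[OF g] by blast
      have eq: "?t ^ (n + m) * (f * g) = (?t ^ n * f) * (?t ^ m * g)"
        by (simp add: power_add ac_simps)
      have nm: "?t ^ (n + m) * (f * g) \<in> S.A"
        unfolding eq by (rule S.A_mult[OF n m])
      show "y (f * g) = y f + y g"
        unfolding y[OF S'.A_mult[OF f g] nm] y[OF f n] y[OF g m]
        unfolding eq xD(3)[OF n m] by (rule ereal_shift_add)
      \<comment> \<open>For the ultrametric inequality both elements are brought to the same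
        denominator, of exponent \<open>n + m\<close>.\<close>
      have f': "?t ^ (n + m) * f \<in> S.A"
        using S.A_mult[OF S.A_power[OF tA, of m] n] by (simp add: power_add ac_simps)
      have g': "?t ^ (n + m) * g \<in> S.A"
        using S.A_mult[OF S.A_power[OF tA, of n] m] by (simp add: power_add ac_simps)
      have fg': "?t ^ (n + m) * (f + g) \<in> S.A"
        using S.A_add[OF f' g'] by (simp add: distrib_left)
      have "min (y f) (y g) = min (x (?t ^ (n + m) * f)) (x (?t ^ (n + m) * g)) + ereal (- (real (n + m) * c))"
        unfolding y[OF f f'] y[OF g g'] by (rule ereal_min_add[symmetric])
      also have "\<dots> \<le> x (?t ^ (n + m) * (f + g)) + ereal (- (real (n + m) * c))"
        using xD(4)[OF f' g'] by (intro add_right_mono) (simp add: distrib_left)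
      also have "\<dots> = y (f + g)"
        by (rule y[OF S'.A_add[OF f g] fg', symmetric])
      finally show "min (y f) (y g) \<le> y (f + g)" .
    qed (simp add: y_def)
    moreover have "restrict y S.A = x"
      using yx xD(5) by (auto simp: extensional_def fun_eq_iff)
    ultimately show ?thesis
      by blast
  qed
qed (auto simp: berkovich_points_def monoid_algebra_def subset_iff)

section \<open>The lattice of the Lawrence toric variety\<close>

lemma relation_lattice_iff:
  "c \<in> relation_lattice M E a \<longleftrightarrow> keys c \<subseteq> E \<and> (\<forall>m. (\<Sum>e\<in>E. lookup c e * a e m) = 0)"
  by (auto simp: relation_lattice_def kernel_def dual_lattice_def fun_eq_iff)

abbreviation lawrence_embed :: "('e \<Rightarrow>\<^sub>0 int) \<Rightarrow> 'e + 'e \<Rightarrow>\<^sub>0 int" where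
  "lawrence_embed \<equiv> frag_extend (\<lambda>e. frag_of (Inl e) - frag_of (Inr e))"

lemma subgroup_lawrence_relations:
  fixes a :: "'e \<Rightarrow> 'm \<Rightarrow> int"
  shows "subgroup (lawrence_relations M E a) (free_Abelian_group (E <+> E))"
proof (rule group.subgroupI)
  show "group (free_Abelian_group (E <+> E))"
    by simp
  have "0 \<in> relation_lattice M E a"
    by (simp add: relation_lattice_iff)
  then show "lawrence_relations M E a \<noteq> {}"
    by (auto simp: lawrence_relations_def)
  have keys: "keys (lawrence_embed c) \<subseteq> E <+> E" if "keys c \<subseteq> E" for c
  proof -
    have "keys (frag_of (Inl e) - frag_of (Inr e) :: 'e + 'e \<Rightarrow>\<^sub>0 int) \<subseteq> E <+> E" if "e \<in> E" for e
      using keys_diff[of "frag_of (Inl e) :: 'e + 'e \<Rightarrow>\<^sub>0 int" "frag_of (Inr e)"] that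
      by (auto simp: keys_frag_of)
    then show ?thesis
      using keys_frag_extend[of "\<lambda>e. frag_of (Inl e) - frag_of (Inr e) :: 'e + 'e \<Rightarrow>\<^sub>0 int" c] that
      by blast
  qed
  show sub: "lawrence_relations M E a \<subseteq> carrier (free_Abelian_group (E <+> E))"
    using keys by (auto simp: lawrence_relations_def relation_lattice_iff)
  fix x assume "x \<in> lawrence_relations M E a"
  then obtain c where c: "c \<in> relation_lattice M E a" "x = lawrence_embed c"
    by (auto simp: lawrence_relations_def)
  have "- c \<in> relation_lattice M E a"
    using c(1) by (simp add: relation_lattice_iff sum_negf)
  then have "- x \<in> lawrence_relations M E a"
    unfolding lawrence_relations_def c(2) by (intro image_eqI[of _ _ "- c"]) (simp_all add: frag_extend_minus)
  moreover have "inv\<^bsub>free_Abelian_group (E <+> E)\<^esub> x = - x"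
    using sub \<open>x \<in> lawrence_relations M E a\<close> by (auto simp: inv_free_Abelian_group)
  ultimately show "inv\<^bsub>free_Abelian_group (E <+> E)\<^esub> x \<in> lawrence_relations M E a"
    by simp
  fix y assume "y \<in> lawrence_relations M E a"
  then obtain c' where c': "c' \<in> relation_lattice M E a" "y = lawrence_embed c'"
    by (auto simp: lawrence_relations_def)
  have "c + c' \<in> relation_lattice M E a"
    using c(1) c'(1) keys_add[of c c'] by (auto simp: relation_lattice_iff lookup_add distrib_right sum.distrib)
  then show "x \<otimes>\<^bsub>free_Abelian_group (E <+> E)\<^esub> y \<in> lawrence_relations M E a"
    unfolding lawrence_relations_def c(2) c'(2)
    by (intro image_eqI[of _ _ "c + c'"]) (simp_all add: frag_extend_add)
qed

abbreviation lawrence_coset :: "('m, 'b) monoid_scheme \<Rightarrow> 'e set \<Rightarrow> ('e \<Rightarrow> 'm \<Rightarrow> int) \<Rightarrow>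
    ('e + 'e \<Rightarrow>\<^sub>0 int) \<Rightarrow> ('e + 'e \<Rightarrow>\<^sub>0 int) set" where
  "lawrence_coset M E a x \<equiv> lawrence_relations M E a #>\<^bsub>free_Abelian_group (E <+> E)\<^esub> x"

lemma normal_lawrence_relations: "lawrence_relations M E a \<lhd> free_Abelian_group (E <+> E)"
  using comm_group.normal_iff_subgroup[OF abelian_free_Abelian_group] subgroup_lawrence_relations by blast

lemma carrier_lawrence_lattice:
  "carrier (lawrence_lattice M E a) = lawrence_coset M E a ` {x. keys x \<subseteq> E <+> E}"
  by (simp add: lawrence_lattice_def carrier_FactGroup free_Abelian_group_def)

lemma mult_lawrence_lattice:
  assumes "keys x \<subseteq> E <+> E" "keys y \<subseteq> E <+> E"
  shows "lawrence_coset M E a x \<otimes>\<^bsub>lawrence_lattice M E a\<^esub> lawrence_coset M E a y = lawrence_coset M E a (x + y)"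
  using normal.rcos_sum[OF normal_lawrence_relations, of x E y M a] assms
  by (simp add: lawrence_lattice_def)

abbreviation lawrence_dual :: "('m, 'b) monoid_scheme \<Rightarrow> 'e set \<Rightarrow> ('e \<Rightarrow> 'm \<Rightarrow> int) \<Rightarrow>
    (('e + 'e \<Rightarrow>\<^sub>0 int) set \<Rightarrow> int) set" where
  "lawrence_dual M E a \<equiv> carrier (dual_lattice (lawrence_lattice M E a))"

lemma lawrence_dual_coset_add:
  assumes u: "u \<in> lawrence_dual M E a" and "keys x \<subseteq> E <+> E" "keys y \<subseteq> E <+> E"
  shows "u (lawrence_coset M E a (x + y)) = u (lawrence_coset M E a x) + u (lawrence_coset M E a y)"
proof -
  have "lawrence_coset M E a x \<in> carrier (lawrence_lattice M E a)" "lawrence_coset M E a y \<in> carrier (lawrence_lattice M E a)"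
    using assms by (auto simp: carrier_lawrence_lattice)
  then show ?thesis
    using u mult_lawrence_lattice[OF assms(2,3), of M a, symmetric]
    by (auto simp: dual_lattice_def hom_def)
qed

text \<open>The classes of the rays generate the lattice. The support condition is carried through
  the induction because additivity is available only for elements supported on
  \<open>E <+> E\<close>.\<close>

lemma lawrence_dual_eqI:
  fixes a :: "'e \<Rightarrow> 'm \<Rightarrow> int"
  assumes u: "u \<in> lawrence_dual M E a" and u': "u' \<in> lawrence_dual M E a"
    and eq: "\<And>i. i \<in> E <+> E \<Longrightarrow> u (lawrence_ray M E a i) = u' (lawrence_ray M E a i)"
  shows "u = u'"
proof
  fix C
  show "u C = u' C"
  proof (cases "C \<in> carrier (lawrence_lattice M E a)")
    case False
    then show ?thesis
      using u u' by (auto simp: dual_lattice_def)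
  next
    case True
    then obtain x where x: "keys x \<subseteq> E <+> E" "C = lawrence_coset M E a x"
      by (auto simp: carrier_lawrence_lattice)
    define ev where "ev w y = w (lawrence_coset M E a y)" for w :: "('e + 'e \<Rightarrow>\<^sub>0 int) set \<Rightarrow> int" and y
    have add: "ev w (y + z) = ev w y + ev w z"
      if "w \<in> lawrence_dual M E a" "keys y \<subseteq> E <+> E" "keys z \<subseteq> E <+> E" for w y z
      using lawrence_dual_coset_add[OF that] by (simp add: ev_def)
    have zero: "ev w 0 = 0" if "w \<in> lawrence_dual M E a" for w
      using add[OF that, of 0 0] by simp
    have ev_diff: "keys (y - z) \<subseteq> E <+> E \<and> ev w (y - z) = ev w y - ev w z"
      if "w \<in> lawrence_dual M E a" "keys y \<subseteq> E <+> E" "keys z \<subseteq> E <+> E" for w y z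
    proof -
      have k: "keys (y - z) \<subseteq> E <+> E"
        using keys_diff[of y z] that by blast
      with add[OF that(1) k that(3)] show ?thesis
        by simp
    qed
    have "keys x \<subseteq> E <+> E \<and> ev u x = ev u' x"
      using x(1)
    proof (induction x rule: frag_induction)
      case (one i)
      then show ?case
        using eq[OF one] by (auto simp: keys_frag_of ev_def lawrence_ray_def)
    next
      case (diff y z)
      then show ?case
        using ev_diff[OF u, of y z] ev_diff[OF u', of y z] by auto
    qed (use zero u u' in auto)
    then show ?thesis
      by (simp add: x(2) ev_def)
  qed
qed

abbreviation lawrence_fold :: "('e + 'e \<Rightarrow>\<^sub>0 int) \<Rightarrow> 'e \<Rightarrow>\<^sub>0 int" where
  "lawrence_fold \<equiv> frag_extend (\<lambda>i. frag_of (case_sum id id i))"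

lemma lawrence_fold_embed: "lawrence_fold (lawrence_embed c) = 0"
  using subset_UNIV[of "keys c"]
  by (induction c rule: frag_induction) (simp_all add: frag_extend_diff)

text \<open>Folding kills the relations, so the image of a coset is a singleton and
  \<open>the_elem\<close> is meaningful.\<close>

lemma lawrence_to_affine_coset: "lawrence_to_affine (lawrence_coset M E a x) = lawrence_fold x"
proof -
  have "0 \<in> relation_lattice M E a"
    by (simp add: relation_lattice_iff)
  then have "0 \<in> lawrence_relations M E a"
    unfolding lawrence_relations_def by (rule image_eqI[rotated]) simp
  then have "lawrence_fold ` lawrence_coset M E a x = {lawrence_fold x}"
    by (auto simp: r_coset_def frag_extend_add lawrence_relations_def lawrence_fold_embed image_iff)
  then show ?thesis
    by (simp add: lawrence_to_affine_def)
qed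

lemma coordinate_exponent_coset:
  "keys x \<subseteq> E <+> E \<Longrightarrow>
    coordinate_exponent M E a e (lawrence_coset M E a x) = lookup (lawrence_fold x) e"
  by (simp add: coordinate_exponent_def lawrence_to_affine_coset carrier_lawrence_lattice)

lemma coordinate_exponent_dual: "coordinate_exponent M E a e \<in> lawrence_dual M E a"
proof -
  have "coordinate_exponent M E a e (C \<otimes>\<^bsub>lawrence_lattice M E a\<^esub> C') =
      coordinate_exponent M E a e C + coordinate_exponent M E a e C'"
    if C: "C \<in> carrier (lawrence_lattice M E a)" "C' \<in> carrier (lawrence_lattice M E a)" for C C'
  proof -
    obtain x y where xy: "keys x \<subseteq> E <+> E" "keys y \<subseteq> E <+> E"
      "C = lawrence_coset M E a x" "C' = lawrence_coset M E a y"
      using C by (auto simp: carrier_lawrence_lattice)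
    have "keys (x + y) \<subseteq> E <+> E"
      using keys_add[of x y] xy by blast
    then show ?thesis
      using xy by (simp add: mult_lawrence_lattice coordinate_exponent_coset frag_extend_add lookup_add)
  qed
  then show ?thesis
    by (auto simp: dual_lattice_def hom_def) (simp add: coordinate_exponent_def)
qed

lemma coordinate_exponent_ray:
  assumes "f \<in> E"
  shows "coordinate_exponent M E a e (lawrence_ray M E a (Inl f)) = (if f = e then 1 else 0)"
    "coordinate_exponent M E a e (lawrence_ray M E a (Inr f)) = (if f = e then 1 else 0)"
  using assms unfolding lawrence_ray_def
  by (subst coordinate_exponent_coset; auto simp: keys_frag_of)+

definition plus_set where "plus_set M E a r \<xi> = {e \<in> E. \<xi> \<in> halfspace_plus M a r e}"
definition minus_set where "minus_set M E a r \<xi> = {e \<in> E. \<xi> \<in> halfspace_minus M a r e}"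

lemma plus_minus_set: "\<xi> \<in> arr_vertices M E a r \<Longrightarrow> plus_set M E a r \<xi> \<union> minus_set M E a r \<xi> = E"
  by (auto simp: plus_set_def minus_set_def arr_vertices_def halfspace_plus_def halfspace_minus_def)

lemma lawrence_cone_eq:
  "lawrence_cone M E a r \<xi> = cone_over (lawrence_lattice M E a)
     (lawrence_ray M E a ` (plus_set M E a r \<xi> <+> minus_set M E a r \<xi>))"
  by (simp add: lawrence_cone_def plus_set_def minus_set_def)

lemma finite_lawrence_cone: "finite E \<Longrightarrow> finite_cone (lawrence_lattice M E a) (lawrence_cone M E a r \<xi>)"
  unfolding finite_cone_def lawrence_cone_eq
  by (intro exI[of _ "lawrence_ray M E a ` (plus_set M E a r \<xi> <+> minus_set M E a r \<xi>)"])
    (auto simp: plus_set_def minus_set_def)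

lemma dual_monoid_lawrence_cone:
  assumes "finite E"
  shows "dual_monoid (lawrence_lattice M E a) (lawrence_cone M E a r \<xi>) =
    {u \<in> lawrence_dual M E a. (\<forall>e\<in>plus_set M E a r \<xi>. 0 \<le> u (lawrence_ray M E a (Inl e))) \<and>
       (\<forall>e\<in>minus_set M E a r \<xi>. 0 \<le> u (lawrence_ray M E a (Inr e)))}"
proof -
  have "finite (lawrence_ray M E a ` (plus_set M E a r \<xi> <+> minus_set M E a r \<xi>))"
    using assms by (auto simp: plus_set_def minus_set_def)
  then show ?thesis
    by (auto simp: lawrence_cone_eq dual_monoid_cone_over)
qed

section \<open>The ideal of the hypertoric variety\<close>

text \<open>The span over the field of the images of the integer relations. Written as an
  intersection of subspaces, it inherits at once every condition that defines a subspace and holds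
  for the integer relations.\<close>

definition relation_space :: "('m, 'b) monoid_scheme \<Rightarrow> 'e set \<Rightarrow> ('e \<Rightarrow> 'm \<Rightarrow> int) \<Rightarrow> ('e \<Rightarrow> 'k::field) set" where
  "relation_space M E a =
     \<Inter>{L. linear_subspace L \<and> (\<lambda>c e. of_int (lookup c e)) ` relation_lattice M E a \<subseteq> L}"

lemma linear_subspace_relation_space: "linear_subspace (relation_space M E a)"
  by (auto simp: relation_space_def linear_subspace_def)

lemma relation_space_supp:
  fixes l :: "'e \<Rightarrow> 'k::field"
  assumes "l \<in> relation_space M E a" "e \<notin> E"
  shows "l e = 0"
proof -
  have "linear_subspace {l :: 'e \<Rightarrow> 'k. \<forall>e. e \<notin> E \<longrightarrow> l e = 0}"
    by (auto simp: linear_subspace_def)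
  moreover have "(\<lambda>c e. of_int (lookup c e)) ` relation_lattice M E a \<subseteq>
      {l :: 'e \<Rightarrow> 'k. \<forall>e. e \<notin> E \<longrightarrow> l e = 0}"
    by (auto simp: relation_lattice_iff in_keys_iff subset_iff) (metis of_int_0)
  ultimately have "l \<in> {l. \<forall>e. e \<notin> E \<longrightarrow> l e = 0}"
    using assms(1) unfolding relation_space_def by blast
  then show ?thesis
    using assms(2) by blast
qed

context valued_monoid
begin

lemma ring_monoid_algebra: "ring (monoid_algebra S :: ('u \<Rightarrow>\<^sub>0 'k) ring)"
proof (rule ringI)
  show "abelian_group (monoid_algebra S :: ('u \<Rightarrow>\<^sub>0 'k) ring)"
  proof (rule abelian_groupI)
    fix x :: "'u \<Rightarrow>\<^sub>0 'k" assume "x \<in> A"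
    then show "\<exists>y\<in>A. y \<oplus>\<^bsub>monoid_algebra S\<^esub> x = \<zero>\<^bsub>monoid_algebra S\<^esub>"
      by (intro bexI[of _ "- x"] A_uminus) (simp_all add: monoid_algebra_def)
  qed (use A_add A_zero in \<open>auto simp: monoid_algebra_def ac_simps\<close>)
  show "Group.monoid (monoid_algebra S :: ('u \<Rightarrow>\<^sub>0 'k) ring)"
    by (rule monoidI) (use A_mult A_one in \<open>auto simp: monoid_algebra_def ac_simps\<close>)
qed (auto simp: monoid_algebra_def algebra_simps)

text \<open>The elements of value \<infinity> form an ideal, so testing generators is
  enough.\<close>

lemma berkovich_genideal:
  assumes \<nu>: "\<nu> \<in> berkovich_points v S" and gens: "gens \<subseteq> A"
  shows "(\<forall>f\<in>Idl\<^bsub>monoid_algebra S\<^esub> gens. \<nu> f = \<infinity>) \<longleftrightarrow> (\<forall>f\<in>gens. \<nu> f = \<infinity>)"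
proof
  show "\<forall>f\<in>gens. \<nu> f = \<infinity>" if "\<forall>f\<in>Idl\<^bsub>monoid_algebra S\<^esub> gens. \<nu> f = \<infinity>"
    using that by (auto simp: genideal_def)
  assume gens_inf: "\<forall>f\<in>gens. \<nu> f = \<infinity>"
  have "ideal {f \<in> A. \<nu> f = \<infinity>} (monoid_algebra S)"
  proof (rule idealI[OF ring_monoid_algebra])
    interpret R: ring "monoid_algebra S :: ('u \<Rightarrow>\<^sub>0 'k) ring"
      by (rule ring_monoid_algebra)
    have minus: "\<ominus>\<^bsub>monoid_algebra S\<^esub> f = - f" if "f \<in> A" for f
      using that A_uminus[OF that] by (intro R.minus_equality) (simp_all add: monoid_algebra_def)
    show "subgroup {f \<in> A. \<nu> f = \<infinity>} (add_monoid (monoid_algebra S))"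
    proof (rule R.add.subgroupI)
      fix f g assume "f \<in> {f \<in> A. \<nu> f = \<infinity>}" "g \<in> {f \<in> A. \<nu> f = \<infinity>}"
      then show "f \<oplus>\<^bsub>monoid_algebra S\<^esub> g \<in> {f \<in> A. \<nu> f = \<infinity>}"
        using A_add[of f g] berkovich_pointsD(4)[OF \<nu>, of f g] by (auto simp: monoid_algebra_def)
    next
      fix f assume "f \<in> {f \<in> A. \<nu> f = \<infinity>}"
      then show "\<ominus>\<^bsub>monoid_algebra S\<^esub> f \<in> {f \<in> A. \<nu> f = \<infinity>}"
        using A_uminus berkovich_simps(3)[OF \<nu>] by (auto simp: minus)
    qed (use berkovich_simps(1)[OF \<nu>] A_zero in blast)+
  next
    fix f g assume "f \<in> {f \<in> A. \<nu> f = \<infinity>}" and g: "g \<in> A"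
    then show "g \<otimes>\<^bsub>monoid_algebra S\<^esub> f \<in> {f \<in> A. \<nu> f = \<infinity>}" "f \<otimes>\<^bsub>monoid_algebra S\<^esub> g \<in> {f \<in> A. \<nu> f = \<infinity>}"
      using A_mult berkovich_pointsD(3)[OF \<nu>] by (auto simp: monoid_algebra_def)
  qed
  then have "Idl\<^bsub>monoid_algebra S\<^esub> gens \<subseteq> {f \<in> A. \<nu> f = \<infinity>}"
    using gens gens_inf by (auto simp: genideal_def)
  then show "\<forall>f\<in>Idl\<^bsub>monoid_algebra S\<^esub> gens. \<nu> f = \<infinity>"
    by auto
qed

end

section \<open>The section of the tropicalization map\<close>

locale hypertoric = valued_field v for v :: "'k::field \<Rightarrow> ereal" +
  fixes M :: "('m, 'b) monoid_scheme" and E :: "'e set" and a :: "'e \<Rightarrow> 'm \<Rightarrow> int" and r :: "'e \<Rightarrow> int"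
  assumes finite_E: "finite E"
begin

abbreviation "G \<equiv> lawrence_lattice M E a"
abbreviation "verts \<equiv> arr_vertices M E a r"
abbreviation "vcone \<xi> \<equiv> lawrence_cone M E a r \<xi>"
abbreviation "dmon \<sigma> \<equiv> dual_monoid G \<sigma>"
abbreviation "X e \<equiv> coordinate_exponent M E a e"
abbreviation "alg \<sigma> \<equiv> (carrier (monoid_algebra (dmon \<sigma>)) :: ((('e + 'e \<Rightarrow>\<^sub>0 int) set \<Rightarrow> int) \<Rightarrow>\<^sub>0 'k) set)"
abbreviation "berk \<sigma> \<equiv> berkovich_points v (dmon \<sigma>)"
abbreviation "Man \<equiv> hypertoric_an v M E a r"
abbreviation "Trop \<equiv> hypertoric_Trop v M E a r"

sublocale an: toric_gluing "\<lambda>S. carrier (monoid_algebra S)" "berkovich_points v"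
  "\<lambda>u. single u 1" "\<lambda>u f. single u 1 * f" G "lawrence_cone M E a r ` arr_vertices M E a r"
proof -
  interpret toric_charts "\<lambda>S. carrier (monoid_algebra S)" "berkovich_points v"
    "\<lambda>u. single u 1" "\<lambda>u f. single (u :: ('e + 'e \<Rightarrow>\<^sub>0 int) set \<Rightarrow> int) 1 * f"
    by (rule toric_charts_berkovich)
  show "toric_gluing (\<lambda>S. carrier (monoid_algebra S)) (berkovich_points v) (\<lambda>u. single u 1)
      (\<lambda>u f. single u 1 * f) G (lawrence_cone M E a r ` arr_vertices M E a r)"
    by unfold_locales (use finite_lawrence_cone finite_E in auto)
qed

sublocale tr: toric_gluing "\<lambda>S. S" tropical_points "\<lambda>u. u" "\<lambda>u b. u + b"
  G "lawrence_cone M E a r ` arr_vertices M E a r"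
  by unfold_locales (use finite_lawrence_cone finite_E in auto)

lemma lawrence_an_eq: "lawrence_an v M E a r = an.glued"
  by (simp add: lawrence_an_def toric_an_def berkovich_chart_def lawrence_fan_def)

lemma lawrence_trop_space_eq: "lawrence_trop_space M E a r = tr.glued"
  by (simp add: lawrence_trop_space_def toric_trop_space_def tropical_chart_def lawrence_fan_def)

definition trp :: "((('e + 'e \<Rightarrow>\<^sub>0 int) set \<Rightarrow> int) \<Rightarrow> real) set \<Rightarrow>
    (((('e + 'e \<Rightarrow>\<^sub>0 int) set \<Rightarrow> int) \<Rightarrow>\<^sub>0 'k) \<Rightarrow> ereal) \<Rightarrow> (('e + 'e \<Rightarrow>\<^sub>0 int) set \<Rightarrow> int) \<Rightarrow> ereal" where
  "trp \<sigma> \<nu> = (\<lambda>u\<in>dmon \<sigma>. \<nu> (single u 1))"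

lemma lawrence_trop_eq: "lawrence_trop M E a r Pts = tr.rel `` ((\<lambda>(\<sigma>, \<nu>). (\<sigma>, trp \<sigma> \<nu>)) ` Pts)"
  by (simp add: lawrence_trop_def toric_trop_def toric_trop_rel_def tropical_chart_def lawrence_fan_def trp_def)

lemma cone_\<Delta>: "\<xi> \<in> verts \<Longrightarrow> vcone \<xi> \<in> an.\<Delta>"
  by (rule an.\<C>_\<Delta>) auto

lemma \<Delta>_cone:
  assumes "\<sigma> \<in> an.\<Delta>"
  obtains \<xi> where "\<xi> \<in> verts" "cone_face G \<sigma> (vcone \<xi>)"
  using assms by (auto simp: fan_of_cones_def)

lemma valued_monoid_mon: "\<sigma> \<in> an.\<Delta> \<Longrightarrow> valued_monoid v (dmon \<sigma>)"
  by unfold_locales (auto intro: dual_monoid_zero dual_monoid_add an.\<Delta>_finite)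

lemma lawrence_chart_cone:
  assumes \<xi>: "\<xi> \<in> verts"
  shows "lawrence_chart v (dmon (vcone \<xi>)) (lawrence_dual M E a) E (plus_set M E a r \<xi>) (minus_set M E a r \<xi>)
    (\<lambda>e u. u (lawrence_ray M E a (Inl e))) (\<lambda>e u. u (lawrence_ray M E a (Inr e))) X (relation_space M E a)"
proof -
  interpret valued_monoid v "dmon (vcone \<xi>)"
    by (rule valued_monoid_mon[OF cone_\<Delta>[OF \<xi>]])
  show ?thesis
  proof
    show "u = u'" if "u \<in> lawrence_dual M E a" "u' \<in> lawrence_dual M E a"
      "\<And>e. e \<in> E \<Longrightarrow> u (lawrence_ray M E a (Inl e)) = u' (lawrence_ray M E a (Inl e)) \<and>
        u (lawrence_ray M E a (Inr e)) = u' (lawrence_ray M E a (Inr e))" for u u'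
      by (rule lawrence_dual_eqI) (use that in auto)
  qed (use \<xi> in \<open>auto simp: finite_E dual_lattice_zero dual_lattice_add dual_lattice_uminus coordinate_exponent_dual
      coordinate_exponent_ray plus_minus_set dual_monoid_lawrence_cone linear_subspace_relation_space
      dest: relation_space_supp\<close>)
qed

lemma X_mon:
  assumes "\<sigma> \<in> an.\<Delta>" "e \<in> E"
  shows "X e \<in> dmon \<sigma>"
proof -
  obtain \<xi> where \<xi>: "\<xi> \<in> verts" "cone_face G \<sigma> (vcone \<xi>)"
    using \<Delta>_cone[OF assms(1)] .
  then show ?thesis
    using lawrence_chart.X_S[OF lawrence_chart_cone[OF \<xi>(1)] assms(2)] dual_monoid_face by blast
qed

definition gen :: "('e \<Rightarrow>\<^sub>0 int) \<Rightarrow> (('e + 'e \<Rightarrow>\<^sub>0 int) set \<Rightarrow> int) \<Rightarrow>\<^sub>0 'k" where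
  "gen c = (\<Sum>e\<in>E. single (X e) (of_int (lookup c e)))"

text \<open>The generators \<open>gen c\<close> are the same polynomials in all charts, so this test
  does not depend on the chart that represents a point.\<close>

definition kills :: "(((('e + 'e \<Rightarrow>\<^sub>0 int) set \<Rightarrow> int) \<Rightarrow>\<^sub>0 'k) \<Rightarrow> ereal) \<Rightarrow> bool" where
  "kills \<nu> \<longleftrightarrow> (\<forall>c\<in>relation_lattice M E a. \<nu> (gen c) = \<infinity>)"

lemma gen_alg: "\<sigma> \<in> an.\<Delta> \<Longrightarrow> gen c \<in> alg \<sigma>"
  unfolding gen_def using X_mon valued_monoid_mon
  by (intro valued_monoid.A_sum[of v] valued_monoid.A_single[of v]) auto

lemma kills_restrict: "\<sigma> \<in> an.\<Delta> \<Longrightarrow> kills (restrict \<nu> (alg \<sigma>)) \<longleftrightarrow> kills \<nu>"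
  using gen_alg by (simp add: kills_def)

lemma kills_ideal:
  assumes \<sigma>: "\<sigma> \<in> an.\<Delta>" and \<nu>: "\<nu> \<in> berk \<sigma>"
  shows "(\<forall>f\<in>hypertoric_ideal M E a \<sigma>. \<nu> f = \<infinity>) \<longleftrightarrow> kills \<nu>"
proof -
  have "{gen c | c. c \<in> relation_lattice M E a} \<subseteq> alg \<sigma>"
    using gen_alg[OF \<sigma>] by auto
  from valued_monoid.berkovich_genideal[OF valued_monoid_mon[OF \<sigma>] \<nu> this] show ?thesis
    unfolding hypertoric_ideal_def kills_def gen_def by blast
qed

lemma topspace_an: "an.pt \<sigma> \<nu> \<in> topspace an.glued" if "\<sigma> \<in> an.\<Delta>" "\<nu> \<in> berk \<sigma>"
  using that unfolding an.topspace_glued an.topspace_chart_of by blast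

lemma pt_Man_iff:
  assumes \<sigma>: "\<sigma> \<in> an.\<Delta>" and \<nu>: "\<nu> \<in> berk \<sigma>"
  shows "an.pt \<sigma> \<nu> \<in> Man \<longleftrightarrow> kills \<nu>"
proof -
  have \<nu>': "\<nu> \<in> topspace (an.chart_of \<sigma>)"
    using \<nu> by (simp only: an.topspace_chart_of)
  have *: "\<tau> \<in> an.\<Delta> \<and> \<mu> \<in> berk \<tau> \<and> (kills \<mu> \<longleftrightarrow> kills \<nu>)" if "(\<tau>, \<mu>) \<in> an.pt \<sigma> \<nu>" for \<tau> \<mu>
  proof -
    have c: "an.common \<sigma> \<nu> \<tau> \<mu>"
      using that an.mem_pt_iff[OF \<sigma> \<nu>'] by simp
    then obtain z where "restrict z (alg \<sigma>) = \<nu>" "restrict z (alg \<tau>) = \<mu>" "\<tau> \<in> an.\<Delta>"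
      unfolding an.common_def by blast
    then show ?thesis
      using an.common_chart[OF c] kills_restrict[OF \<sigma>, of z] kills_restrict[of \<tau> z]
      unfolding an.topspace_chart_of by auto
  qed
  show ?thesis
  proof
    assume "an.pt \<sigma> \<nu> \<in> Man"
    then have "\<forall>f\<in>hypertoric_ideal M E a \<sigma>. \<nu> f = \<infinity>"
      using an.pt_self[of \<sigma> \<nu>] by (auto simp: hypertoric_an_def)
    then show "kills \<nu>"
      by (simp add: kills_ideal \<sigma> \<nu>)
  next
    assume "kills \<nu>"
    then have "\<forall>f\<in>hypertoric_ideal M E a \<tau>. \<mu> f = \<infinity>" if "(\<tau>, \<mu>) \<in> an.pt \<sigma> \<nu>" for \<tau> \<mu>
      using *[OF that] kills_ideal[of \<tau> \<mu>] by blast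
    then show "an.pt \<sigma> \<nu> \<in> Man"
      using topspace_an[OF \<sigma> \<nu>] unfolding hypertoric_an_def lawrence_an_eq by blast
  qed
qed

lemma trp_points: "\<sigma> \<in> an.\<Delta> \<Longrightarrow> \<nu> \<in> berk \<sigma> \<Longrightarrow> trp \<sigma> \<nu> \<in> tropical_points (dmon \<sigma>)"
  using valued_monoid.trop_of_points[OF valued_monoid_mon, of \<sigma> \<nu>] valued_monoid.trop_of_def[OF valued_monoid_mon, of \<sigma> \<nu>]
  by (simp add: trp_def)

lemma trp_restrict:
  assumes "\<sigma> \<in> an.\<Delta>" "\<tau> \<in> an.\<Delta>" "cone_face G \<tau> \<sigma>"
  shows "trp \<sigma> (restrict \<nu> (alg \<sigma>)) = restrict (trp \<tau> \<nu>) (dmon \<sigma>)"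
proof -
  have "single u 1 \<in> alg \<sigma>" if "u \<in> dmon \<sigma>" for u
    using that by (simp add: monoid_algebra_def)
  then show ?thesis
    using dual_monoid_face[OF assms(3)] by (auto simp: trp_def fun_eq_iff subset_iff)
qed

lemma trop_common:
  assumes "an.common \<sigma> \<nu> \<tau> \<mu>"
  shows "tr.common \<sigma> (trp \<sigma> \<nu>) \<tau> (trp \<tau> \<mu>)"
proof -
  obtain \<rho> z where *: "\<sigma> \<in> an.\<Delta>" "\<tau> \<in> an.\<Delta>" "\<rho> \<in> an.\<Delta>" "cone_face G \<rho> \<sigma>" "cone_face G \<rho> \<tau>" "z \<in> berk \<rho>"
    "restrict z (alg \<sigma>) = \<nu>" "restrict z (alg \<tau>) = \<mu>"
    using assms unfolding an.common_def an.topspace_chart_of by blast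
  then have "restrict (trp \<rho> z) (dmon \<sigma>) = trp \<sigma> \<nu>" "restrict (trp \<rho> z) (dmon \<tau>) = trp \<tau> \<mu>"
    using trp_restrict[of \<sigma> \<rho> z] trp_restrict[of \<tau> \<rho> z] by simp_all
  then show ?thesis
    unfolding tr.common_def tr.topspace_chart_of using * trp_points[OF *(3,6)] by blast
qed

text \<open>The definition takes the image of a whole class; identified pairs tropicalize to
  identified pairs, so one representative decides.\<close>

lemma trop_pt:
  assumes \<sigma>: "\<sigma> \<in> an.\<Delta>" and \<nu>: "\<nu> \<in> berk \<sigma>"
  shows "lawrence_trop M E a r (an.pt \<sigma> \<nu>) = tr.pt \<sigma> (trp \<sigma> \<nu>)"
proof -
  have \<nu>': "\<nu> \<in> topspace (an.chart_of \<sigma>)"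
    using \<nu> by (simp only: an.topspace_chart_of)
  have "tr.rel `` {(\<tau>, trp \<tau> \<mu>)} = tr.pt \<sigma> (trp \<sigma> \<nu>)" if "(\<tau>, \<mu>) \<in> an.pt \<sigma> \<nu>" for \<tau> \<mu>
  proof -
    have c: "an.common \<sigma> \<nu> \<tau> \<mu>"
      using that an.mem_pt_iff[OF \<sigma> \<nu>'] by simp
    have "trp \<sigma> \<nu> \<in> topspace (tr.chart_of \<sigma>)"
      unfolding tr.topspace_chart_of by (rule trp_points[OF \<sigma> \<nu>])
    then have "tr.pt \<sigma> (trp \<sigma> \<nu>) = tr.pt \<tau> (trp \<tau> \<mu>)"
      using tr.pt_eq_iff[OF \<sigma>] trop_common[OF c] by blast
    then show ?thesis
      by (simp add: tr.pt_def)
  qed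
  then have "tr.rel `` {(\<lambda>(\<sigma>, \<nu>). (\<sigma>, trp \<sigma> \<nu>)) x} = tr.pt \<sigma> (trp \<sigma> \<nu>)" if "x \<in> an.pt \<sigma> \<nu>" for x
    using that by (cases x) auto
  then have "(\<Union>x\<in>an.pt \<sigma> \<nu>. tr.rel `` {(\<lambda>(\<sigma>, \<nu>). (\<sigma>, trp \<sigma> \<nu>)) x}) = tr.pt \<sigma> (trp \<sigma> \<nu>)"
    using an.pt_self[of \<sigma> \<nu>] by auto
  moreover have "(\<Union>x\<in>an.pt \<sigma> \<nu>. tr.rel `` {(\<lambda>(\<sigma>, \<nu>). (\<sigma>, trp \<sigma> \<nu>)) x}) =
      tr.rel `` ((\<lambda>(\<sigma>, \<nu>). (\<sigma>, trp \<sigma> \<nu>)) ` an.pt \<sigma> \<nu>)"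
    by blast
  ultimately show ?thesis
    by (simp only: lawrence_trop_eq)
qed

lemma face_finite:
  assumes "\<sigma> \<in> an.\<Delta>" "u \<in> dmon \<sigma>" "\<rho> = {x \<in> \<sigma>. x u = 0}" "y \<in> tropical_points (dmon \<rho>)"
  shows "y u \<noteq> \<infinity>"
  using localization.t_fin[OF tr.localization_face[OF assms(1-3)] assms(4)] .

text \<open>Extension requires only that the inverted monomial have finite value, which can be read
  off from the tropical point. Injectivity of tropical restriction then identifies the
  tropicalization of the extension.\<close>

lemma extend_to_face:
  assumes \<sigma>: "\<sigma> \<in> an.\<Delta>" and \<rho>: "\<rho> \<in> an.\<Delta>" "cone_face G \<rho> \<sigma>" and y: "y \<in> tropical_points (dmon \<rho>)"
    and \<nu>: "\<nu> \<in> berk \<sigma>" "trp \<sigma> \<nu> = restrict y (dmon \<sigma>)"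
  obtains \<mu> where "\<mu> \<in> berk \<rho>" "restrict \<mu> (alg \<sigma>) = \<nu>" "trp \<rho> \<mu> = y"
proof -
  obtain u where u: "u \<in> dmon \<sigma>" "\<rho> = {x \<in> \<sigma>. x u = 0}"
    using \<rho>(2) by (auto simp: cone_face_def)
  have "\<nu> (single u 1) = trp \<sigma> \<nu> u"
    using u by (simp add: trp_def)
  also have "\<dots> = y u"
    using u by (simp add: \<nu>(2))
  finally have "\<nu> (single u 1) \<noteq> \<infinity>"
    using face_finite[OF \<sigma> u y] by simp
  then obtain \<mu> where \<mu>: "\<mu> \<in> berk \<rho>" "restrict \<mu> (alg \<sigma>) = \<nu>"
    using an.chart_extend[OF \<sigma> u(1) \<nu>(1)] u(2) by blast
  have "restrict (trp \<rho> \<mu>) (dmon \<sigma>) = restrict y (dmon \<sigma>)"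
    using trp_restrict[OF \<sigma> \<rho>, of \<mu>] \<mu>(2) \<nu>(2) by simp
  then have "trp \<rho> \<mu> = y"
    using tr.chart_inj[OF \<rho>(1) \<sigma> \<rho>(2)] trp_points[OF \<rho>(1) \<mu>(1)] y
    unfolding tr.topspace_chart_of by (auto dest: inj_onD)
  with \<mu> that show thesis
    by blast
qed

text \<open>The preimage of a tropical chart is the corresponding analytic chart: a point
  represented elsewhere is extended to the common face and then restricted.\<close>

lemma lift_to_chart:
  assumes \<sigma>: "\<sigma> \<in> an.\<Delta>" and w: "w \<in> tropical_points (dmon \<sigma>)"
    and P: "P \<in> topspace an.glued" "lawrence_trop M E a r P = tr.pt \<sigma> w"
  obtains \<nu> where "\<nu> \<in> berk \<sigma>" "P = an.pt \<sigma> \<nu>" "trp \<sigma> \<nu> = w"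
proof -
  obtain \<sigma>' \<nu>' where \<sigma>': "\<sigma>' \<in> an.\<Delta>" and \<nu>': "\<nu>' \<in> berk \<sigma>'" and P_eq: "P = an.pt \<sigma>' \<nu>'"
    using P(1) unfolding an.topspace_glued an.topspace_chart_of by blast
  have "tr.pt \<sigma>' (trp \<sigma>' \<nu>') = tr.pt \<sigma> w"
    using P(2) trop_pt[OF \<sigma>' \<nu>'] by (simp add: P_eq)
  then have "tr.common \<sigma>' (trp \<sigma>' \<nu>') \<sigma> w"
    using tr.pt_eq_iff[OF \<sigma>'] trp_points[OF \<sigma>' \<nu>'] unfolding tr.topspace_chart_of by blast
  then obtain \<rho> y where \<rho>: "\<rho> \<in> an.\<Delta>" "cone_face G \<rho> \<sigma>'" "cone_face G \<rho> \<sigma>" and y: "y \<in> tropical_points (dmon \<rho>)"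
    and yr: "restrict y (dmon \<sigma>') = trp \<sigma>' \<nu>'" "restrict y (dmon \<sigma>) = w"
    unfolding tr.common_def tr.topspace_chart_of by blast
  obtain \<mu> where \<mu>: "\<mu> \<in> berk \<rho>" "restrict \<mu> (alg \<sigma>') = \<nu>'" "trp \<rho> \<mu> = y"
    using extend_to_face[OF \<sigma>' \<rho>(1,2) y \<nu>' yr(1)[symmetric]] .
  have \<mu>': "\<mu> \<in> topspace (an.chart_of \<rho>)"
    unfolding an.topspace_chart_of by (rule \<mu>(1))
  show thesis
  proof (rule that)
    show "restrict \<mu> (alg \<sigma>) \<in> berk \<sigma>"
      using an.restrict_chart[OF \<rho>(1) \<sigma> \<rho>(3) \<mu>'] unfolding an.topspace_chart_of .
    show "P = an.pt \<sigma> (restrict \<mu> (alg \<sigma>))"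
      using an.pt_restrict[OF \<rho>(1) \<sigma>' \<rho>(2) \<mu>'] an.pt_restrict[OF \<rho>(1) \<sigma> \<rho>(3) \<mu>'] by (simp add: P_eq \<mu>(2))
    show "trp \<sigma> (restrict \<mu> (alg \<sigma>)) = w"
      using trp_restrict[OF \<sigma> \<rho>(1,3), of \<mu>] by (simp add: \<mu>(3) yr(2))
  qed
qed

definition H :: "(('m \<Rightarrow> int) \<Rightarrow> real) \<Rightarrow> (((('e + 'e \<Rightarrow>\<^sub>0 int) set \<Rightarrow> int) \<Rightarrow>\<^sub>0 'k) \<Rightarrow> ereal) set" where
  "H \<xi> = {\<nu> \<in> berk (vcone \<xi>). kills \<nu>}"

definition T :: "(('m \<Rightarrow> int) \<Rightarrow> real) \<Rightarrow> ((('e + 'e \<Rightarrow>\<^sub>0 int) set \<Rightarrow> int) \<Rightarrow> ereal) set" where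
  "T \<xi> = trp (vcone \<xi>) ` H \<xi>"

text \<open>The coefficient vectors of linear forms of value \<infinity> form a subspace, so
  vanishing on the integer relations passes to their span.\<close>

lemma H_chart:
  assumes \<xi>: "\<xi> \<in> verts"
  shows "lawrence_chart.H v (dmon (vcone \<xi>)) E X (relation_space M E a) = H \<xi>"
proof -
  interpret c: lawrence_chart v "dmon (vcone \<xi>)" "lawrence_dual M E a" E "plus_set M E a r \<xi>" "minus_set M E a r \<xi>"
    "\<lambda>e u. u (lawrence_ray M E a (Inl e))" "\<lambda>e u. u (lawrence_ray M E a (Inr e))" X "relation_space M E a"
    by (rule lawrence_chart_cone[OF \<xi>])
  have gen_lin: "gen c = c.lin (\<lambda>e. of_int (lookup c e))" for c
    by (simp add: gen_def c.lin_def)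
  have "(\<forall>l\<in>relation_space M E a. \<nu> (c.lin l) = \<infinity>) \<longleftrightarrow> kills \<nu>" if \<nu>: "\<nu> \<in> berk (vcone \<xi>)" for \<nu>
  proof
    assume "\<forall>l\<in>relation_space M E a. \<nu> (c.lin l) = \<infinity>"
    then show "kills \<nu>"
      unfolding kills_def gen_lin by (auto simp: relation_space_def)
  next
    assume k: "kills \<nu>"
    have "linear_subspace {l. \<nu> (c.lin l) = \<infinity>}"
      unfolding linear_subspace_def
    proof (intro conjI ballI allI)
      show "0 \<in> {l. \<nu> (c.lin l) = \<infinity>}"
        by (simp add: c.lin_def c.berkovich_simps[OF \<nu>])
      fix x assume x: "x \<in> {l. \<nu> (c.lin l) = \<infinity>}"
      have "c.lin (\<lambda>e. c * x e) = single 0 c * c.lin x" for c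
        by (simp add: c.lin_def sum_distrib_left mult_single)
      then show "(\<lambda>e. c * x e) \<in> {l. \<nu> (c.lin l) = \<infinity>}" for c
        using x c.berkovich_pointsD(3)[OF \<nu> c.A_single[OF c.zero_S] c.lin_A] by simp
      fix y assume y: "y \<in> {l. \<nu> (c.lin l) = \<infinity>}"
      have "c.lin (x + y) = c.lin x + c.lin y"
        by (simp add: c.lin_def single_add sum.distrib)
      then show "x + y \<in> {l. \<nu> (c.lin l) = \<infinity>}"
        using x y c.berkovich_pointsD(4)[OF \<nu> c.lin_A[of x] c.lin_A[of y]] by simp
    qed
    moreover have "(\<lambda>c e. of_int (lookup c e)) ` relation_lattice M E a \<subseteq> {l. \<nu> (c.lin l) = \<infinity>}"
      using k unfolding kills_def gen_lin by blast
    ultimately show "\<forall>l\<in>relation_space M E a. \<nu> (c.lin l) = \<infinity>"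
      unfolding relation_space_def by blast
  qed
  then show ?thesis
    unfolding c.H_def H_def by blast
qed

definition sec :: "(('m \<Rightarrow> int) \<Rightarrow> real) \<Rightarrow> ((('e + 'e \<Rightarrow>\<^sub>0 int) set \<Rightarrow> int) \<Rightarrow> ereal) \<Rightarrow>
    ((('e + 'e \<Rightarrow>\<^sub>0 int) set \<Rightarrow> int) \<Rightarrow>\<^sub>0 'k) \<Rightarrow> ereal" where
  "sec \<xi> = lawrence_chart.sec v (dmon (vcone \<xi>)) E (plus_set M E a r \<xi>) (minus_set M E a r \<xi>)
     (\<lambda>e u. u (lawrence_ray M E a (Inl e))) (\<lambda>e u. u (lawrence_ray M E a (Inr e))) X (relation_space M E a)"

lemma sec_props:
  assumes \<xi>: "\<xi> \<in> verts"
  shows "w \<in> T \<xi> \<Longrightarrow> sec \<xi> w \<in> H \<xi>" "w \<in> T \<xi> \<Longrightarrow> trp (vcone \<xi>) (sec \<xi> w) = w"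
    "\<nu> \<in> H \<xi> \<Longrightarrow> f \<in> alg (vcone \<xi>) \<Longrightarrow> sec \<xi> (trp (vcone \<xi>) \<nu>) f \<le> \<nu> f"
    "continuous_map (subtopology (tropical_chart (dmon (vcone \<xi>))) (T \<xi>)) (berkovich_chart v (dmon (vcone \<xi>))) (sec \<xi>)"
    "w \<in> T \<xi> \<Longrightarrow> f \<in> alg (vcone \<xi>) \<Longrightarrow> sec \<xi> w f < y \<Longrightarrow>
      openin (subtopology (tropical_chart (dmon (vcone \<xi>))) (T \<xi>)) N \<Longrightarrow> w \<in> N \<Longrightarrow>
      \<exists>w'\<in>N. \<forall>\<nu>\<in>H \<xi>. trp (vcone \<xi>) \<nu> = w' \<longrightarrow> \<nu> f < y"
proof -
  interpret c: lawrence_chart v "dmon (vcone \<xi>)" "lawrence_dual M E a" E "plus_set M E a r \<xi>" "minus_set M E a r \<xi>"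
    "\<lambda>e u. u (lawrence_ray M E a (Inl e))" "\<lambda>e u. u (lawrence_ray M E a (Inr e))" X "relation_space M E a"
    by (rule lawrence_chart_cone[OF \<xi>])
  have H: "c.H = H \<xi>"
    by (rule H_chart[OF \<xi>])
  have trp: "c.trop_of \<nu> = trp (vcone \<xi>) \<nu>" for \<nu>
    by (simp add: c.trop_of_def trp_def)
  have T: "c.T = T \<xi>"
    by (simp add: c.T_def T_def H trp)
  have sec: "sec \<xi> = c.sec"
    by (simp add: sec_def)
  show "w \<in> T \<xi> \<Longrightarrow> sec \<xi> w \<in> H \<xi>" "w \<in> T \<xi> \<Longrightarrow> trp (vcone \<xi>) (sec \<xi> w) = w"
    using c.sec_H[of w] c.trop_of_sec[of w] by (simp_all add: sec T H trp)
  show "\<nu> \<in> H \<xi> \<Longrightarrow> f \<in> alg (vcone \<xi>) \<Longrightarrow> sec \<xi> (trp (vcone \<xi>) \<nu>) f \<le> \<nu> f"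
    using c.sec_le[of \<nu> f] by (simp add: sec H trp)
  show "continuous_map (subtopology (tropical_chart (dmon (vcone \<xi>))) (T \<xi>)) (berkovich_chart v (dmon (vcone \<xi>))) (sec \<xi>)"
    using c.continuous_sec by (simp add: sec T)
  show "\<exists>w'\<in>N. \<forall>\<nu>\<in>H \<xi>. trp (vcone \<xi>) \<nu> = w' \<longrightarrow> \<nu> f < y"
    if prem: "w \<in> T \<xi>" "f \<in> alg (vcone \<xi>)" "sec \<xi> w f < y"
      "openin (subtopology (tropical_chart (dmon (vcone \<xi>))) (T \<xi>)) N" "w \<in> N"
  proof -
    have c: "w \<in> c.T" "c.sec w f < y" "openin (subtopology (tropical_chart (dmon (vcone \<xi>))) c.T) N"
      using prem by (simp_all only: sec T)
    show ?thesis
      using c.fibre_near_sec[OF c(1) prem(2) c(2,3) prem(5)] unfolding H trp .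
  qed
qed

lemma T_points: "\<xi> \<in> verts \<Longrightarrow> w \<in> T \<xi> \<Longrightarrow> w \<in> tropical_points (dmon (vcone \<xi>))"
  using trp_points[OF cone_\<Delta>] by (auto simp: T_def H_def)

lemma Trop_iff:
  assumes \<xi>: "\<xi> \<in> verts" and w: "w \<in> tropical_points (dmon (vcone \<xi>))"
  shows "tr.pt (vcone \<xi>) w \<in> Trop \<longleftrightarrow> w \<in> T \<xi>"
proof
  note \<sigma> = cone_\<Delta>[OF \<xi>]
  assume "tr.pt (vcone \<xi>) w \<in> Trop"
  then obtain P where P: "P \<in> Man" "lawrence_trop M E a r P = tr.pt (vcone \<xi>) w"
    by (auto simp: hypertoric_Trop_def)
  have "P \<in> topspace an.glued"
    using P(1) by (simp add: hypertoric_an_def lawrence_an_eq)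
  then obtain \<nu> where \<nu>: "\<nu> \<in> berk (vcone \<xi>)" "P = an.pt (vcone \<xi>) \<nu>" "trp (vcone \<xi>) \<nu> = w"
    using lift_to_chart[OF \<sigma> w _ P(2)] by blast
  then have "\<nu> \<in> H \<xi>"
    using P(1) pt_Man_iff[OF \<sigma>] by (simp add: H_def)
  with \<nu>(3) show "w \<in> T \<xi>"
    by (auto simp: T_def)
next
  note \<sigma> = cone_\<Delta>[OF \<xi>]
  assume "w \<in> T \<xi>"
  then obtain \<nu> where \<nu>: "\<nu> \<in> berk (vcone \<xi>)" "kills \<nu>" "w = trp (vcone \<xi>) \<nu>"
    by (auto simp: T_def H_def)
  then have "an.pt (vcone \<xi>) \<nu> \<in> Man" "lawrence_trop M E a r (an.pt (vcone \<xi>) \<nu>) = tr.pt (vcone \<xi>) w"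
    using pt_Man_iff[OF \<sigma>] trop_pt[OF \<sigma>] by simp_all
  then show "tr.pt (vcone \<xi>) w \<in> Trop"
    unfolding hypertoric_Trop_def by (intro image_eqI[of _ _ "an.pt (vcone \<xi>) \<nu>"]) simp_all
qed

lemma Trop_cases:
  assumes "W \<in> Trop"
  obtains \<xi> w where "\<xi> \<in> verts" "w \<in> T \<xi>" "W = tr.pt (vcone \<xi>) w"
proof -
  obtain P where P: "P \<in> Man" "W = lawrence_trop M E a r P"
    using assms by (auto simp: hypertoric_Trop_def)
  then have "P \<in> topspace an.glued"
    by (simp add: hypertoric_an_def lawrence_an_eq)
  then obtain \<sigma> \<nu> where \<sigma>: "\<sigma> \<in> an.\<Delta>" and \<nu>: "\<nu> \<in> topspace (an.chart_of \<sigma>)" and P_eq: "P = an.pt \<sigma> \<nu>"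
    unfolding an.topspace_glued by blast
  obtain \<xi> where \<xi>: "\<xi> \<in> verts" "cone_face G \<sigma> (vcone \<xi>)"
    using \<Delta>_cone[OF \<sigma>] .
  note \<sigma>' = cone_\<Delta>[OF \<xi>(1)]
  let ?\<nu> = "restrict \<nu> (alg (vcone \<xi>))"
  have \<nu>': "?\<nu> \<in> berk (vcone \<xi>)"
    using an.restrict_chart[OF \<sigma> \<sigma>' \<xi>(2) \<nu>] unfolding an.topspace_chart_of .
  have P': "P = an.pt (vcone \<xi>) ?\<nu>"
    using an.pt_restrict[OF \<sigma> \<sigma>' \<xi>(2) \<nu>] P_eq by simp
  have W: "W = tr.pt (vcone \<xi>) (trp (vcone \<xi>) ?\<nu>)"
    unfolding P(2) P' by (rule trop_pt[OF \<sigma>' \<nu>'])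
  moreover have "trp (vcone \<xi>) ?\<nu> \<in> T \<xi>"
    using Trop_iff[OF \<xi>(1) trp_points[OF \<sigma>' \<nu>']] assms unfolding W by blast
  ultimately show thesis
    using that \<xi>(1) by blast
qed

text \<open>On the vertex chart this is minimality of \<open>sec\<close>. A function on the face
  chart is moved into the vertex chart by a power of the inverted monomial, whose value is the same
  for both valuations.\<close>

lemma sec_face_le:
  assumes \<xi>: "\<xi> \<in> verts" and \<rho>: "\<rho> \<in> an.\<Delta>" "cone_face G \<rho> (vcone \<xi>)"
    and \<mu>: "\<mu> \<in> berk \<rho>" "restrict \<mu> (alg (vcone \<xi>)) = sec \<xi> w" and w: "w \<in> T \<xi>"
    and \<mu>': "\<mu>' \<in> berk \<rho>" "trp \<rho> \<mu>' = trp \<rho> \<mu>" "kills \<mu>'" and f: "f \<in> alg \<rho>"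
  shows "\<mu> f \<le> \<mu>' f"
proof -
  note \<sigma> = cone_\<Delta>[OF \<xi>]
  obtain u where u: "u \<in> dmon (vcone \<xi>)" "\<rho> = {x \<in> vcone \<xi>. x u = 0}"
    using \<rho>(2) by (auto simp: cone_face_def)
  let ?t = "single u (1::'k)"
  interpret localization "alg \<rho>" "alg (vcone \<xi>)" "(*) ?t" ?t "berk \<rho>" "berk (vcone \<xi>)"
    by (rule an.localization_face[OF \<sigma> u])
  have "u \<in> dmon \<rho>"
    using u(1) dual_monoid_face[OF \<rho>(2)] by blast
  then have t_eq: "\<mu>' ?t = \<mu> ?t"
    using fun_cong[OF \<mu>'(2), of u] by (simp add: trp_def)
  have "restrict \<mu>' (alg (vcone \<xi>)) \<in> H \<xi>"
    using restrict_P'[OF \<mu>'(1)] kills_restrict[OF \<sigma>] \<mu>'(3) by (simp add: H_def)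
  moreover have "trp (vcone \<xi>) (restrict \<mu>' (alg (vcone \<xi>))) = w"
    using trp_restrict[OF \<sigma> \<rho>, of \<mu>] trp_restrict[OF \<sigma> \<rho>, of \<mu>'] \<mu>(2) \<mu>'(2) sec_props(2)[OF \<xi> w] by simp
  ultimately have le: "\<mu> g \<le> \<mu>' g" if "g \<in> alg (vcone \<xi>)" for g
    using sec_props(3)[OF \<xi> _ that, of "restrict \<mu>' (alg (vcone \<xi>))"] that fun_cong[OF \<mu>(2), of g] by simp
  obtain n where n: "((*) ?t ^^ n) f \<in> alg (vcone \<xi>)"
    using sh_ev[OF f] by blast
  show ?thesis
    unfolding val_eq[OF \<mu>(1) f, of n] val_eq[OF \<mu>'(1) f, of n] t_eq by (intro add_right_mono le n)
qed

text \<open>Each chart section is least in its fibre, so their extensions to a common face bound each other.\<close>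

lemma sec_well_defined:
  assumes \<xi>: "\<xi> \<in> verts" "w \<in> T \<xi>" and \<xi>': "\<xi>' \<in> verts" "w' \<in> T \<xi>'"
    and eq: "tr.pt (vcone \<xi>) w = tr.pt (vcone \<xi>') w'"
  shows "an.pt (vcone \<xi>) (sec \<xi> w) = an.pt (vcone \<xi>') (sec \<xi>' w')"
proof -
  note \<sigma> = cone_\<Delta>[OF \<xi>(1)] and \<sigma>' = cone_\<Delta>[OF \<xi>'(1)]
  have "tr.common (vcone \<xi>) w (vcone \<xi>') w'"
    using tr.pt_eq_iff[OF \<sigma>] T_points[OF \<xi>] eq unfolding tr.topspace_chart_of by blast
  then obtain \<rho> y where \<rho>: "\<rho> \<in> an.\<Delta>" "cone_face G \<rho> (vcone \<xi>)" "cone_face G \<rho> (vcone \<xi>')"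
    and y: "y \<in> tropical_points (dmon \<rho>)"
    and yr: "restrict y (dmon (vcone \<xi>)) = w" "restrict y (dmon (vcone \<xi>')) = w'"
    unfolding tr.common_def tr.topspace_chart_of by blast
  have sH: "sec \<xi> w \<in> berk (vcone \<xi>)" "kills (sec \<xi> w)" "sec \<xi>' w' \<in> berk (vcone \<xi>')" "kills (sec \<xi>' w')"
    using sec_props(1)[OF \<xi>] sec_props(1)[OF \<xi>'] by (auto simp: H_def)
  obtain \<mu> where \<mu>: "\<mu> \<in> berk \<rho>" "restrict \<mu> (alg (vcone \<xi>)) = sec \<xi> w" "trp \<rho> \<mu> = y"
    using extend_to_face[OF \<sigma> \<rho>(1,2) y sH(1) trans[OF sec_props(2)[OF \<xi>] yr(1)[symmetric]]] .
  obtain \<mu>' where \<mu>': "\<mu>' \<in> berk \<rho>" "restrict \<mu>' (alg (vcone \<xi>')) = sec \<xi>' w'" "trp \<rho> \<mu>' = y"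
    using extend_to_face[OF \<sigma>' \<rho>(1,3) y sH(3) trans[OF sec_props(2)[OF \<xi>'] yr(2)[symmetric]]] .
  have k: "kills \<mu>" "kills \<mu>'"
    using kills_restrict[OF \<sigma>, of \<mu>] kills_restrict[OF \<sigma>', of \<mu>'] sH \<mu>(2) \<mu>'(2) by simp_all
  have "\<mu> f = \<mu>' f" if "f \<in> alg \<rho>" for f
    using sec_face_le[OF \<xi>(1) \<rho>(1,2) \<mu>(1,2) \<xi>(2) \<mu>'(1) _ k(2) that]
      sec_face_le[OF \<xi>'(1) \<rho>(1,3) \<mu>'(1,2) \<xi>'(2) \<mu>(1) _ k(1) that] \<mu>(3) \<mu>'(3) by simp
  moreover have "\<mu> \<in> extensional (alg \<rho>)" "\<mu>' \<in> extensional (alg \<rho>)"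
    using an.Pt_ext \<mu>(1) \<mu>'(1) by blast+
  ultimately have "\<mu> = \<mu>'"
    by (intro extensionalityI) auto
  moreover have "an.pt (vcone \<xi>) (sec \<xi> w) = an.pt \<rho> \<mu>" "an.pt (vcone \<xi>') (sec \<xi>' w') = an.pt \<rho> \<mu>'"
    using an.pt_restrict[OF \<rho>(1) \<sigma> \<rho>(2), of \<mu>] an.pt_restrict[OF \<rho>(1) \<sigma>' \<rho>(3), of \<mu>'] \<mu> \<mu>'
    unfolding an.topspace_chart_of by simp_all
  ultimately show ?thesis
    by simp
qed

definition the_section :: "(((('e + 'e \<Rightarrow>\<^sub>0 int) set \<Rightarrow> int) \<Rightarrow> real) set \<times> ((('e + 'e \<Rightarrow>\<^sub>0 int) set \<Rightarrow> int) \<Rightarrow> ereal)) set \<Rightarrow>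
    (((('e + 'e \<Rightarrow>\<^sub>0 int) set \<Rightarrow> int) \<Rightarrow> real) set \<times> (((('e + 'e \<Rightarrow>\<^sub>0 int) set \<Rightarrow> int) \<Rightarrow>\<^sub>0 'k) \<Rightarrow> ereal)) set" where
  "the_section = (\<lambda>W\<in>Trop. SOME P. \<exists>\<xi>\<in>verts. \<exists>w\<in>T \<xi>. W = tr.pt (vcone \<xi>) w \<and> P = an.pt (vcone \<xi>) (sec \<xi> w))"

lemma the_section_pt:
  assumes \<xi>: "\<xi> \<in> verts" "w \<in> T \<xi>"
  shows "the_section (tr.pt (vcone \<xi>) w) = an.pt (vcone \<xi>) (sec \<xi> w)"
proof -
  have "tr.pt (vcone \<xi>) w \<in> Trop"
    using Trop_iff[OF \<xi>(1) T_points[OF \<xi>]] \<xi>(2) by blast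
  moreover have "(SOME P. \<exists>\<xi>'\<in>verts. \<exists>w'\<in>T \<xi>'. tr.pt (vcone \<xi>) w = tr.pt (vcone \<xi>') w' \<and> P = an.pt (vcone \<xi>') (sec \<xi>' w')) =
      an.pt (vcone \<xi>) (sec \<xi> w)"
    by (rule some_equality) (use \<xi> sec_well_defined[OF \<xi>] in blast)+
  ultimately show ?thesis
    by (simp add: the_section_def)
qed

lemma Trop_topspace: "Trop \<subseteq> topspace tr.glued"
proof
  fix W assume "W \<in> Trop"
  then obtain \<xi> w where \<xi>: "\<xi> \<in> verts" "w \<in> T \<xi>" and W: "W = tr.pt (vcone \<xi>) w"
    using Trop_cases by blast
  show "W \<in> topspace tr.glued"
    using cone_\<Delta>[OF \<xi>(1)] T_points[OF \<xi>] unfolding W tr.topspace_glued tr.topspace_chart_of by blast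
qed

lemma the_section_Man: "W \<in> Trop \<Longrightarrow> the_section W \<in> Man"
  and trop_the_section: "W \<in> Trop \<Longrightarrow> lawrence_trop M E a r (the_section W) = W"
proof -
  assume "W \<in> Trop"
  then obtain \<xi> w where \<xi>: "\<xi> \<in> verts" "w \<in> T \<xi>" and W: "W = tr.pt (vcone \<xi>) w"
    using Trop_cases by blast
  note \<sigma> = cone_\<Delta>[OF \<xi>(1)]
  have s: "sec \<xi> w \<in> berk (vcone \<xi>)" "kills (sec \<xi> w)"
    using sec_props(1)[OF \<xi>] by (auto simp: H_def)
  show "the_section W \<in> Man"
    using pt_Man_iff[OF \<sigma> s(1)] s(2) by (simp add: W the_section_pt[OF \<xi>])
  show "lawrence_trop M E a r (the_section W) = W"
    using trop_pt[OF \<sigma> s(1)] sec_props(2)[OF \<xi>] by (simp add: W the_section_pt[OF \<xi>])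
qed

text \<open>Continuity is local: the vertex charts are open in the glued tropical space, and over
  each of them the map is the continuous chart section.\<close>

lemma continuous_the_section:
  "continuous_map (subtopology tr.glued Trop) (subtopology an.glued Man) the_section"
proof -
  have top: "topspace (subtopology tr.glued Trop) = Trop"
    using Trop_topspace by auto
  have "openin (subtopology tr.glued Trop) {W \<in> Trop. the_section W \<in> V}" if V: "openin an.glued V" for V
  proof (subst openin_subopen, intro ballI)
    fix W assume "W \<in> {W \<in> Trop. the_section W \<in> V}"
    then have W: "W \<in> Trop" "the_section W \<in> V"
      by auto
    obtain \<xi> w where \<xi>: "\<xi> \<in> verts" "w \<in> T \<xi>" and Weq: "W = tr.pt (vcone \<xi>) w"
      using Trop_cases[OF W(1)] .
    note \<sigma> = cone_\<Delta>[OF \<xi>(1)]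
    define V' where "V' = {\<nu> \<in> topspace (an.chart_of (vcone \<xi>)). an.pt (vcone \<xi>) \<nu> \<in> V}"
    have "openin (an.chart_of (vcone \<xi>)) V'"
      using V \<sigma> unfolding V'_def an.openin_glued by blast
    then have "openin (subtopology (tr.chart_of (vcone \<xi>)) (T \<xi>))
        {w' \<in> topspace (subtopology (tr.chart_of (vcone \<xi>)) (T \<xi>)). sec \<xi> w' \<in> V'}"
      using openin_continuous_map_preimage[OF sec_props(4)[OF \<xi>(1)]] unfolding tropical_chart_def berkovich_chart_def by blast
    then obtain O' where O': "openin (tr.chart_of (vcone \<xi>)) O'"
      "{w' \<in> topspace (subtopology (tr.chart_of (vcone \<xi>)) (T \<xi>)). sec \<xi> w' \<in> V'} = O' \<inter> T \<xi>"
      unfolding openin_subtopology by blast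
    have mem: "w' \<in> O' \<longleftrightarrow> an.pt (vcone \<xi>) (sec \<xi> w') \<in> V" if "w' \<in> T \<xi>" for w'
    proof -
      have "w' \<in> topspace (subtopology (tr.chart_of (vcone \<xi>)) (T \<xi>))"
        unfolding topspace_subtopology[of "tr.chart_of (vcone \<xi>)"] tr.topspace_chart_of
        using T_points[OF \<xi>(1) that] that by blast
      moreover have "sec \<xi> w' \<in> topspace (an.chart_of (vcone \<xi>))"
        unfolding an.topspace_chart_of using sec_props(1)[OF \<xi>(1) that] by (simp add: H_def)
      ultimately show ?thesis
        using O'(2) that unfolding V'_def by blast
    qed
    have "openin tr.glued (tr.pt (vcone \<xi>) ` O')"
      by (rule tr.pt_open[OF \<sigma> O'(1)])
    then have "openin (subtopology tr.glued Trop) (tr.pt (vcone \<xi>) ` O' \<inter> Trop)"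
      by (auto simp: openin_subtopology)
    moreover have "W \<in> tr.pt (vcone \<xi>) ` O' \<inter> Trop"
      using W mem[OF \<xi>(2)] the_section_pt[OF \<xi>] by (auto simp: Weq)
    moreover have "tr.pt (vcone \<xi>) ` O' \<inter> Trop \<subseteq> {W \<in> Trop. the_section W \<in> V}"
    proof
      fix W' assume W': "W' \<in> tr.pt (vcone \<xi>) ` O' \<inter> Trop"
      then obtain w' where w': "w' \<in> O'" "W' = tr.pt (vcone \<xi>) w'"
        by blast
      have "w' \<in> tropical_points (dmon (vcone \<xi>))"
        using w'(1) openin_subset[OF O'(1)] unfolding tr.topspace_chart_of by blast
      from Trop_iff[OF \<xi>(1) this] have w'T: "w' \<in> T \<xi>"
        using W' w'(2) by simp
      then show "W' \<in> {W \<in> Trop. the_section W \<in> V}"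
        using mem[OF w'T] w' W' the_section_pt[OF \<xi>(1) w'T] by simp
    qed
    ultimately show "\<exists>N. openin (subtopology tr.glued Trop) N \<and> W \<in> N \<and> N \<subseteq> {W \<in> Trop. the_section W \<in> V}"
      by blast
  qed
  moreover have "the_section W \<in> topspace an.glued" if "W \<in> Trop" for W
    using the_section_Man[OF that] by (simp add: hypertoric_an_def lawrence_an_eq)
  ultimately have "continuous_map (subtopology tr.glued Trop) an.glued the_section"
    unfolding continuous_map_def top by auto
  then show ?thesis
    using the_section_Man top by (auto simp: continuous_map_in_subtopology)
qed

text \<open>If \<open>s\<close> differed from the least section at some \<open>f\<close>, its value
  would lie strictly above. By continuity a number \<open>y\<close> in between is still exceeded on
  a neighbourhood, which however contains a point whose whole fibre has values below
  \<open>y\<close>.\<close>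

lemma section_unique:
  assumes cont: "continuous_map (subtopology tr.glued Trop) (subtopology an.glued Man) s"
    and trop: "\<And>W. W \<in> Trop \<Longrightarrow> lawrence_trop M E a r (s W) = W" and W: "W \<in> Trop"
  shows "s W = the_section W"
proof -
  have top: "topspace (subtopology tr.glued Trop) = Trop"
    using Trop_topspace by auto
  have contan: "continuous_map (subtopology tr.glued Trop) an.glued s"
    and Man: "\<And>W. W \<in> Trop \<Longrightarrow> s W \<in> Man"
    using cont top by (auto simp: continuous_map_in_subtopology)
  obtain \<xi> w where \<xi>: "\<xi> \<in> verts" "w \<in> T \<xi>" and Weq: "W = tr.pt (vcone \<xi>) w"
    using Trop_cases[OF W] .
  note \<sigma> = cone_\<Delta>[OF \<xi>(1)]
  \<comment> \<open>A section cannot leave the chart, because the preimage of the tropical chart is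
    the analytic one.\<close>
  have lift: "\<exists>\<nu>\<in>H \<xi>. s (tr.pt (vcone \<xi>) w') = an.pt (vcone \<xi>) \<nu> \<and> trp (vcone \<xi>) \<nu> = w'" if w': "w' \<in> T \<xi>" for w'
  proof -
    have inT: "tr.pt (vcone \<xi>) w' \<in> Trop"
      using Trop_iff[OF \<xi>(1) T_points[OF \<xi>(1) w']] w' by blast
    have "s (tr.pt (vcone \<xi>) w') \<in> topspace an.glued"
      using Man[OF inT] by (simp add: hypertoric_an_def lawrence_an_eq)
    then obtain \<nu> where \<nu>: "\<nu> \<in> berk (vcone \<xi>)" "s (tr.pt (vcone \<xi>) w') = an.pt (vcone \<xi>) \<nu>" "trp (vcone \<xi>) \<nu> = w'"
      using lift_to_chart[OF \<sigma> T_points[OF \<xi>(1) w'] _ trop[OF inT]] by blast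
    then show ?thesis
      using pt_Man_iff[OF \<sigma> \<nu>(1)] Man[OF inT] by (auto simp: H_def)
  qed
  obtain \<nu> where \<nu>: "\<nu> \<in> H \<xi>" "s W = an.pt (vcone \<xi>) \<nu>" "trp (vcone \<xi>) \<nu> = w"
    using lift[OF \<xi>(2)] Weq by blast
  have "\<nu> f = sec \<xi> w f" if f: "f \<in> alg (vcone \<xi>)" for f
  proof (rule ccontr)
    assume "\<nu> f \<noteq> sec \<xi> w f"
    then have "sec \<xi> w f < \<nu> f"
      using sec_props(3)[OF \<xi>(1) \<nu>(1) f] \<nu>(3) by simp
    then obtain y where y: "sec \<xi> w f < y" "y < \<nu> f"
      using dense by blast
    define V where "V = {\<mu> \<in> topspace (an.chart_of (vcone \<xi>)). \<mu> f \<in> {y<..}}"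
    have "openin (an.chart_of (vcone \<xi>)) V"
      unfolding V_def
    proof (rule openin_continuous_map_preimage)
      show "continuous_map (an.chart_of (vcone \<xi>)) euclidean (\<lambda>\<mu>. \<mu> f)"
        using f by (intro continuous_map_from_subtopology continuous_map_product_projection)
      show "openin euclidean {y<..}"
        by simp
    qed
    then have "openin an.glued (an.pt (vcone \<xi>) ` V)"
      by (rule an.pt_open[OF \<sigma>])
    then have "openin (subtopology tr.glued Trop) {W' \<in> Trop. s W' \<in> an.pt (vcone \<xi>) ` V}"
      using openin_continuous_map_preimage[OF contan] unfolding top by blast
    then obtain O' where O': "openin tr.glued O'" "{W' \<in> Trop. s W' \<in> an.pt (vcone \<xi>) ` V} = O' \<inter> Trop"
      unfolding openin_subtopology by blast
    define N where "N = {w' \<in> topspace (tr.chart_of (vcone \<xi>)). tr.pt (vcone \<xi>) w' \<in> O'} \<inter> T \<xi>"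
    have "openin (tr.chart_of (vcone \<xi>)) {w' \<in> topspace (tr.chart_of (vcone \<xi>)). tr.pt (vcone \<xi>) w' \<in> O'}"
      using O'(1) \<sigma> unfolding tr.openin_glued by blast
    then have N: "openin (subtopology (tropical_chart (dmon (vcone \<xi>))) (T \<xi>)) N"
      unfolding N_def tropical_chart_def openin_subtopology by blast
    have inN: "w' \<in> N \<longleftrightarrow> s (tr.pt (vcone \<xi>) w') \<in> an.pt (vcone \<xi>) ` V" if "w' \<in> T \<xi>" for w'
    proof -
      have "tr.pt (vcone \<xi>) w' \<in> Trop"
        using Trop_iff[OF \<xi>(1) T_points[OF \<xi>(1) that]] that by blast
      then have "tr.pt (vcone \<xi>) w' \<in> O' \<longleftrightarrow> s (tr.pt (vcone \<xi>) w') \<in> an.pt (vcone \<xi>) ` V"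
        using O'(2) by blast
      then show ?thesis
        unfolding N_def tr.topspace_chart_of using T_points[OF \<xi>(1) that] that by blast
    qed
    have "\<nu> \<in> V"
      unfolding V_def an.topspace_chart_of using \<nu>(1) y(2) by (simp add: H_def)
    then have "w \<in> N"
      using inN[OF \<xi>(2)] \<nu>(2) Weq by auto
    then obtain w' where w': "w' \<in> N" and less: "\<forall>\<mu>\<in>H \<xi>. trp (vcone \<xi>) \<mu> = w' \<longrightarrow> \<mu> f < y"
      using sec_props(5)[OF \<xi> f y(1) N] by blast
    have w'T: "w' \<in> T \<xi>"
      using w' by (simp add: N_def)
    then obtain \<mu>1 where \<mu>1: "\<mu>1 \<in> H \<xi>" "s (tr.pt (vcone \<xi>) w') = an.pt (vcone \<xi>) \<mu>1" "trp (vcone \<xi>) \<mu>1 = w'"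
      using lift by blast
    obtain \<mu>0 where \<mu>0: "\<mu>0 \<in> V" "s (tr.pt (vcone \<xi>) w') = an.pt (vcone \<xi>) \<mu>0"
      using inN[OF w'T] w' by blast
    have "\<mu>0 = \<mu>1"
      using an.pt_inj[OF \<sigma>, of \<mu>0 \<mu>1] \<mu>0 \<mu>1(2) unfolding V_def by simp
    moreover have "y < \<mu>0 f"
      using \<mu>0(1) by (simp add: V_def)
    ultimately show False
      using less \<mu>1 by auto
  qed
  moreover have "\<nu> \<in> extensional (alg (vcone \<xi>))" "sec \<xi> w \<in> extensional (alg (vcone \<xi>))"
    using \<nu>(1) sec_props(1)[OF \<xi>] by (auto simp: H_def berkovich_points_def)
  ultimately have "\<nu> = sec \<xi> w"
    by (intro extensionalityI) auto
  then show ?thesis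
    using \<nu>(2) the_section_pt[OF \<xi>] by (simp add: Weq)
qed

end

theorem theorem6p3:
  fixes v :: "'k::field \<Rightarrow> ereal"
    and M :: "('m, 'b) monoid_scheme"
    and d :: nat
    and E :: "'e set"
    and a :: "'e \<Rightarrow> 'm \<Rightarrow> int"
    and r :: "'e \<Rightarrow> int"
  assumes "nonarch_valuation v" and "valuation_complete v"
    and "comm_group M" and "M \<cong> free_Abelian_group {..<d}"
    and "finite E" and "primitive_spanning M E a"
  shows "\<exists>!s. s \<in> extensional (hypertoric_Trop v M E a r) \<and>
    continuous_map
      (subtopology (lawrence_trop_space M E a r) (hypertoric_Trop v M E a r))
      (subtopology (lawrence_an v M E a r) (hypertoric_an v M E a r)) s \<and>
    (\<forall>w\<in>hypertoric_Trop v M E a r. lawrence_trop M E a r (s w) = w)"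
proof -
  interpret hypertoric v M E a r
    by unfold_locales (use assms in auto)
  show ?thesis
    unfolding lawrence_an_eq lawrence_trop_space_eq
  proof (rule ex1I[of _ the_section], intro conjI ballI)
    show "the_section \<in> extensional Trop"
      by (simp add: the_section_def)
    show "continuous_map (subtopology tr.glued Trop) (subtopology an.glued Man) the_section"
      by (rule continuous_the_section)
    show "lawrence_trop M E a r (the_section w) = w" if "w \<in> Trop" for w
      by (rule trop_the_section[OF that])
    fix s assume s: "s \<in> extensional Trop \<and> continuous_map (subtopology tr.glued Trop) (subtopology an.glued Man) s \<and>
      (\<forall>w\<in>Trop. lawrence_trop M E a r (s w) = w)"
    show "s = the_section"
      using section_unique[of s] s by (intro extensionalityI[of _ Trop]) (auto simp: the_section_def)
  qed
qed

end
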